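(* Let $G=\mathbb{R}\ltimes\mathbb{R}_+$ be the "$ax+b$-group", i.e. the set $\mathbb{R}\times(0,\infty)$ with product $(x,a)(x',a')=(x+ax',aa')$, let $X_0=a\partial_a$, $X_1=a\partial_x$, and let $L^p_k(G)$ be the Sobolev spaces associated with the family $\{X_0,X_1\}$, i.e. with $\Delta=-(X_0^2+X_1^2)$. Then, for every $p\in(1,\infty)$ and every positive integer $k$, the Sobolev space $L^p_k(G)$ is not an algebra under pointwise product.
   Context: On $G$ the right Haar measure is $d\rho(x,a)=a^{-1}\,da\,dx$, and $\{X_0,X_1\}$ is a basis of the left invariant vector fields. $\|\cdot\|_p$ denotes the norm of $L^p(\rho)$. For $p\in(1,\infty)$, $\Delta_p$ is the smallest closed extension of $\Delta|_{C_c^\infty(G)}$ to $L^p(\rho)$; for $\alpha>0$ its fractional power (in the sense of Komatsu's theory of fractional powers of operators) is denoted by $\Delta^\alpha$. For $\alpha\ge 0$, $L^p_\alpha(G)=\{f\in L^p(\rho):\Delta^{\alpha/2}f\in L^p(\rho)\}$ with norm $\|f\|_{\alpha,p}=\|f\|_p+\|\Delta^{\alpha/2}f\|_p$. "Not an algebra under pointwise product" means that $L^p_k(G)$ is not closed under pointwise multiplication. *)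

theory Defs
  imports "HOL-Analysis.Analysis" "HOL-Algebra.Group"
begin

section \<open>The group\<close>

definition axb :: "(real \<times> real) monoid" where
  "axb = \<lparr>carrier = UNIV \<times> {0<..},
          mult = (\<lambda>(x, a) (x', a'). (x + a * x', a * a')),
          one = (0, 1)\<rparr>"

lemma group_axb: "group axb"
proof (rule groupI)
  fix z assume "z \<in> carrier axb"
  then show "\<exists>w\<in>carrier axb. w \<otimes>\<^bsub>axb\<^esub> z = \<one>\<^bsub>axb\<^esub>"
    by (intro bexI[of _ "(- fst z / snd z, 1 / snd z)"]) (auto simp: axb_def)
qed (auto simp: axb_def algebra_simps)

definition rho :: "(real \<times> real) measure" where
  "rho = density (restrict_space lborel (carrier axb)) (\<lambda>(x, a). ennreal (1 / a))"

section \<open>Smooth functions and the operator on test functions\<close>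

text \<open>On an open set this is the class of functions all of whose iterated directional
  derivatives of order at most \<open>n\<close> exist (in the Frechet sense below order \<open>n\<close>) and are
  continuous.\<close>

primrec times_cont_diff_on ::
    "nat \<Rightarrow> 'a::real_normed_vector set \<Rightarrow> ('a \<Rightarrow> 'b::real_normed_vector) \<Rightarrow> bool" where
  "times_cont_diff_on 0 S f \<longleftrightarrow> continuous_on S f"
| "times_cont_diff_on (Suc n) S f \<longleftrightarrow>
     (\<forall>z\<in>S. f differentiable (at z)) \<and>
     (\<forall>v. times_cont_diff_on n S (\<lambda>z. frechet_derivative f (at z) v))"

definition test_functions :: "(real \<times> real \<Rightarrow> complex) set" where
  "test_functions = {f. (\<forall>n. times_cont_diff_on n (carrier axb) f) \<and>
     (\<exists>K. compact K \<and> K \<subseteq> carrier axb \<and> (\<forall>z. z \<notin> K \<longrightarrow> f z = 0))}"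

definition X0 :: "(real \<times> real \<Rightarrow> complex) \<Rightarrow> real \<times> real \<Rightarrow> complex" where
  "X0 f = (\<lambda>z. snd z *\<^sub>R frechet_derivative f (at z) (0, 1))"

definition X1 :: "(real \<times> real \<Rightarrow> complex) \<Rightarrow> real \<times> real \<Rightarrow> complex" where
  "X1 f = (\<lambda>z. snd z *\<^sub>R frechet_derivative f (at z) (1, 0))"

definition Delta :: "(real \<times> real \<Rightarrow> complex) \<Rightarrow> real \<times> real \<Rightarrow> complex" where
  "Delta f = (\<lambda>z. - (X0 (X0 f) z + X1 (X1 f) z))"

section \<open>Operators on Lebesgue spaces\<close>

text \<open>Elements of \<open>L\<^sup>p(M)\<close> are represented by measurable functions.  (Unbounded) operators
  on \<open>L\<^sup>p(M)\<close> are represented by their graphs, as relations between such functions; a closed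
  operator has a graph that is invariant under changing either component on a null set.\<close>

definition Lp :: "'a measure \<Rightarrow> real \<Rightarrow> ('a \<Rightarrow> complex) set" where
  "Lp M p = {f \<in> borel_measurable M. integrable M (\<lambda>z. norm (f z) powr p)}"

definition Lp_norm :: "'a measure \<Rightarrow> real \<Rightarrow> ('a \<Rightarrow> complex) \<Rightarrow> real" where
  "Lp_norm M p f = (\<integral>z. norm (f z) powr p \<partial>M) powr (1 / p)"

definition Lp_tendsto ::
    "'a measure \<Rightarrow> real \<Rightarrow> (nat \<Rightarrow> 'a \<Rightarrow> complex) \<Rightarrow> ('a \<Rightarrow> complex) \<Rightarrow> bool" where
  "Lp_tendsto M p u f \<longleftrightarrow>
     (\<forall>n. u n \<in> Lp M p) \<and> f \<in> Lp M p \<and>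
     (\<lambda>n. Lp_norm M p (\<lambda>z. u n z - f z)) \<longlonglongrightarrow> 0"

text \<open>The closure of a graph in \<open>L\<^sup>p(M) \<times> L\<^sup>p(M)\<close>; for a closable operator this is the graph
  of its smallest closed extension.\<close>

definition closure_op ::
    "'a measure \<Rightarrow> real \<Rightarrow> (('a \<Rightarrow> complex) \<times> ('a \<Rightarrow> complex)) set \<Rightarrow>
     (('a \<Rightarrow> complex) \<times> ('a \<Rightarrow> complex)) set" where
  "closure_op M p T =
     {(f, g). \<exists>u v. (\<forall>n. (u n, v n) \<in> T) \<and> Lp_tendsto M p u f \<and> Lp_tendsto M p v g}"

text \<open>The Bochner integral over \<open>N\<close> of an \<open>L\<^sup>p(M)\<close>-valued function \<open>F\<close>, defined by
  approximation with simple functions \<open>\<Sum>i<k n. indicator (E n i) * y n i\<close> as in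
  \<^const>\<open>has_bochner_integral\<close>.  Together with the convergence, the measurability of the
  norms forces \<open>F\<close> to be strongly measurable.\<close>

definition has_Lp_integral ::
    "'b measure \<Rightarrow> 'a measure \<Rightarrow> real \<Rightarrow> ('b \<Rightarrow> 'a \<Rightarrow> complex) \<Rightarrow> ('a \<Rightarrow> complex) \<Rightarrow> bool" where
  "has_Lp_integral N M p F g \<longleftrightarrow>
     (\<forall>t\<in>space N. F t \<in> Lp M p) \<and>
     (\<exists>(k :: nat \<Rightarrow> nat) (E :: nat \<Rightarrow> nat \<Rightarrow> 'b set) (y :: nat \<Rightarrow> nat \<Rightarrow> 'a \<Rightarrow> complex).
        let err = (\<lambda>n t. Lp_norm M p
                     (\<lambda>z. F t z - (\<Sum>i<k n. indicator (E n i) t *\<^sub>R y n i z)))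
        in (\<forall>n. \<forall>i<k n. E n i \<in> sets N \<and> emeasure N (E n i) < \<infinity> \<and> y n i \<in> Lp M p) \<and>
           (\<forall>n. err n \<in> borel_measurable N) \<and>
           (\<lambda>n. \<integral>\<^sup>+t. ennreal (err n t) \<partial>N) \<longlonglongrightarrow> 0 \<and>
           Lp_tendsto M p (\<lambda>n z. \<Sum>i<k n. measure N (E n i) *\<^sub>R y n i z) g)"

section \<open>Komatsu's fractional powers\<close>

text \<open>The graph of \<open>A (t + A)\<^sup>-\<^sup>1\<close>: if \<open>v = A u\<close> then it maps \<open>t u + v\<close> to \<open>v\<close>.\<close>

definition resolvent_op ::
    "(('a \<Rightarrow> complex) \<times> ('a \<Rightarrow> complex)) set \<Rightarrow> real \<Rightarrow>
     (('a \<Rightarrow> complex) \<times> ('a \<Rightarrow> complex)) set" where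
  "resolvent_op A t = {(\<lambda>z. t *\<^sub>R u z + v z, v) | u v. (u, v) \<in> A}"

text \<open>For a non-negative operator \<open>A\<close> and \<open>0 < \<alpha> < \<sigma>\<close>, Komatsu's operator \<open>A\<^sub>\<sigma>\<^sup>\<alpha>\<close> has as domain
  \<open>D\<^sup>\<sigma>\<close> the set of \<open>f\<close> for which \<open>t\<^sup>\<sigma> \<parallel>(A (t + A)\<^sup>-\<^sup>1)\<^sup>m f\<parallel>\<close> is bounded, where \<open>m > \<sigma>\<close> is an
  integer, and is given there by
  \<open>\<Gamma>(m) / (\<Gamma>(\<alpha>) \<Gamma>(m - \<alpha>)) \<integral>\<^sub>0\<^sup>\<infinity> t\<^bsup>\<alpha>-1\<^esup> (A (t + A)\<^sup>-\<^sup>1)\<^sup>m f dt\<close>.  Neither the domain nor the value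
  depends on \<open>m\<close>.  In the definition, \<open>F t\<close> stands for \<open>(A (t + A)\<^sup>-\<^sup>1)\<^sup>m f\<close>.\<close>

definition komatsu_op ::
    "'a measure \<Rightarrow> real \<Rightarrow> (('a \<Rightarrow> complex) \<times> ('a \<Rightarrow> complex)) set \<Rightarrow> real \<Rightarrow> real \<Rightarrow>
     (('a \<Rightarrow> complex) \<times> ('a \<Rightarrow> complex)) set" where
  "komatsu_op M p A \<sigma> \<alpha> =
     {(f, \<lambda>z. (Gamma (real m) / (Gamma \<alpha> * Gamma (real m - \<alpha>))) *\<^sub>R g z) | f g m.
        \<sigma> < real m \<and>
        (\<exists>F. (\<forall>t>0. (f, F t) \<in> resolvent_op A t ^^ m) \<and>
             (\<exists>C. \<forall>t>0. t powr \<sigma> * Lp_norm M p (F t) \<le> C) \<and>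
             has_Lp_integral (restrict_space lborel {0<..}) M p
               (\<lambda>t z. t powr (\<alpha> - 1) *\<^sub>R F t z) g)}"

text \<open>For \<open>\<alpha> > 0\<close>, Komatsu's \<open>A\<^sub>+\<^sup>\<alpha>\<close> is the smallest closed extension of \<open>A\<^sub>\<sigma>\<^sup>\<alpha>\<close>, which is the
  same for all \<open>\<sigma> > \<alpha>\<close>; hence it is also the closure of the union of these operators.\<close>

definition fractional_power ::
    "'a measure \<Rightarrow> real \<Rightarrow> (('a \<Rightarrow> complex) \<times> ('a \<Rightarrow> complex)) set \<Rightarrow> real \<Rightarrow>
     (('a \<Rightarrow> complex) \<times> ('a \<Rightarrow> complex)) set" where
  "fractional_power M p A \<alpha> = closure_op M p (\<Union>\<sigma>\<in>{\<alpha><..}. komatsu_op M p A \<sigma> \<alpha>)"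

section \<open>Sobolev spaces\<close>

definition Delta_p ::
    "real \<Rightarrow> ((real \<times> real \<Rightarrow> complex) \<times> (real \<times> real \<Rightarrow> complex)) set" where
  "Delta_p p = closure_op rho p {(f, Delta f) | f. f \<in> test_functions}"

definition sobolev :: "real \<Rightarrow> real \<Rightarrow> (real \<times> real \<Rightarrow> complex) set" where
  "sobolev p \<alpha> =
     (if \<alpha> = 0 then Lp rho p
      else {f \<in> Lp rho p. \<exists>g \<in> Lp rho p. (f, g) \<in> fractional_power rho p (Delta_p p) (\<alpha> / 2)})"

end

theory Submission
  imports Defs "HOL-Complex_Analysis.Complex_Analysis"
begin

text \<open>
  The proof exhibits one explicit \<open>\<phi>\<close> in every \<open>L\<^sup>p\<^sub>k\<close> whose square is not even in \<open>L\<^sup>p\<close>.  If \<open>g\<close> is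
  holomorphic on the upper half plane, then \<open>s \<theta> (x, a) = a sinh \<theta> g(x + \<i> a cosh \<theta>)\<close> satisfies the
  wave equation \<open>\<partial>\<^sub>\<theta>\<^sup>2 s = - \<Delta> s\<close>, since \<open>g(x + \<i> b)\<close> is harmonic in \<open>(x, b)\<close>.  The scale invariance of
  \<open>da / a\<close> bounds all \<open>\<theta>\<close>-derivatives of \<open>s\<close> in \<open>L\<^sup>p\<close> uniformly in \<open>\<theta>\<close>; therefore the
  resolvents of \<open>\<Delta>\<close> act on \<open>\<phi> = \<partial>\<^sub>\<theta> s 0\<close> by integrating the wave against
  kernels \<open>polynomial * exp (- \<surd>t \<theta>)\<close>, which makes \<open>(\<Delta> (t + \<Delta>)\<^sup>-\<^sup>1)\<^sup>m \<phi>\<close> explicit, bounded in \<open>L\<^sup>p\<close> as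
  \<open>t \<rightarrow> 0\<close> and \<open>O(t\<^sup>-\<^sup>m)\<close> as \<open>t \<rightarrow> \<infinity>\<close>, so Komatsu's integrals converge.  With
  \<open>g(\<zeta>) = \<zeta> powr (- \<beta>) / (\<zeta> + \<i>) ^ 6\<close> and \<open>\<beta> = 1 + 1 / (2 p)\<close> one has \<open>\<phi> (x, a) = a g(x + \<i> a)\<close>, whose
  singularity at \<open>(0, 0)\<close> is \<open>p\<close>-integrable but not \<open>2 p\<close>-integrable.
\<close>

section \<open>Bounds in Lebesgue spaces and Minkowski's integral inequality\<close>

text \<open>In the coordinates b = a cosh \<theta>, b' = a sinh \<theta> one has (a \<partial>_a)^2
  - \<partial>_\<theta>^2 = a^2 (\<partial>_b^2 - \<partial>_b'^2). The wave b' g(x + \<i> b) is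
  linear in b', so \<partial>_b'^2 drops out, and harmonicity turns the rest into minus the
  contribution of \<open>X1\<close>. The obstacle is that \<open>Delta_p\<close> is known only as a
  closure from test functions: every statement about it must be a limit of pairs, by cutoffs for the
  wave, difference quotients for its derivatives and Riemann sums for the resolvents, and all these
  limits rest on one envelope. Along the wave \<Delta> is - \<partial>_\<theta>^2, whose resolvent
  on the line is convolution with exp (- \<surd>t |\<theta>|) / (2 \<surd>t); since
  \<partial>_\<theta> s is even in \<theta>, the half line is enough. As for \<beta>: in the cone a
  ~ |x| the measure dx da / a behaves like dr with r = |\<zeta>|, and |\<phi>| like r^(1 - \<beta>)
  = r^(- 1 / (2 p)). Its p-th power is r^(- 1 / 2), integrable at 0, its 2 p-th power is r^(- 1), at
  the borderline of divergence.\<close>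

definition Lp_le :: "'a measure \<Rightarrow> real \<Rightarrow> ('a \<Rightarrow> complex) \<Rightarrow> real \<Rightarrow> bool" where
  "Lp_le M p f C \<longleftrightarrow> f \<in> borel_measurable M \<and> 0 \<le> C \<and>
     (\<integral>\<^sup>+z. ennreal (norm (f z) powr p) \<partial>M) \<le> ennreal (C powr p)"

lemma Lp_leI:
  "f \<in> borel_measurable M \<Longrightarrow> 0 \<le> C \<Longrightarrow>
   (\<integral>\<^sup>+z. ennreal (norm (f z) powr p) \<partial>M) \<le> ennreal (C powr p) \<Longrightarrow> Lp_le M p f C"
  by (simp add: Lp_le_def)

lemma Lp_le_measurable: "Lp_le M p f C \<Longrightarrow> f \<in> borel_measurable M"
  and Lp_le_nonneg: "Lp_le M p f C \<Longrightarrow> 0 \<le> C"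
  by (auto simp: Lp_le_def)

lemma Lp_le_imp_Lp:
  assumes "Lp_le M p f C"
  shows "f \<in> Lp M p"
proof -
  have "(\<integral>\<^sup>+z. ennreal (norm (f z) powr p) \<partial>M) < \<infinity>"
    using assms unfolding Lp_le_def using ennreal_less_top by (auto simp: le_less_trans)
  then show ?thesis
    using Lp_le_measurable[OF assms] unfolding Lp_def by (auto simp: integrable_iff_bounded)
qed

lemma Lp_norm_le:
  assumes "Lp_le M p f C" "0 < p"
  shows "Lp_norm M p f \<le> C"
proof -
  have "integrable M (\<lambda>z. norm (f z) powr p)"
    using Lp_le_imp_Lp[OF assms(1)] by (simp add: Lp_def)
  then have "ennreal (\<integral>z. norm (f z) powr p \<partial>M) \<le> ennreal (C powr p)"
    using assms(1) by (simp add: Lp_le_def nn_integral_eq_integral)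
  then have "(\<integral>z. norm (f z) powr p \<partial>M) \<le> C powr p"
    by (simp add: ennreal_le_iff)
  then have "(\<integral>z. norm (f z) powr p \<partial>M) powr (1/p) \<le> (C powr p) powr (1/p)"
    using assms(2) by (intro powr_mono2) (auto intro: integral_nonneg_AE)
  also have "\<dots> = C" using assms by (simp add: powr_powr Lp_le_nonneg)
  finally show ?thesis by (simp add: Lp_norm_def)
qed

lemma Lp_norm_nonneg: "0 \<le> Lp_norm M p f"
  by (simp add: Lp_norm_def)

lemma Lp_imp_Lp_le:
  assumes "f \<in> Lp M p" "0 < p" "Lp_norm M p f \<le> C"
  shows "Lp_le M p f C"
proof (rule Lp_leI)
  have i: "integrable M (\<lambda>z. norm (f z) powr p)"
    using assms(1) by (simp add: Lp_def)
  have "(\<integral>z. norm (f z) powr p \<partial>M) = Lp_norm M p f powr p"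
    using assms(2) by (simp add: Lp_norm_def powr_powr integral_nonneg_AE)
  also have "\<dots> \<le> C powr p" using assms by (intro powr_mono2) (auto simp: Lp_norm_nonneg)
  finally show "(\<integral>\<^sup>+z. ennreal (norm (f z) powr p) \<partial>M) \<le> ennreal (C powr p)"
    by (simp add: nn_integral_eq_integral[OF i])
  show "0 \<le> C" using Lp_norm_nonneg assms(3) order_trans by blast
qed (use assms in \<open>simp add: Lp_def\<close>)

lemma Lp_le_mono_AE:
  assumes "Lp_le M p f C" "g \<in> borel_measurable M" "AE z in M. norm (g z) \<le> norm (f z)"
    "C \<le> D" "0 < p"
  shows "Lp_le M p g D"
proof (rule Lp_leI)
  have "(\<integral>\<^sup>+z. ennreal (norm (g z) powr p) \<partial>M) \<le> (\<integral>\<^sup>+z. ennreal (norm (f z) powr p) \<partial>M)"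
    using assms(3) by (intro nn_integral_mono_AE) (auto intro!: powr_mono2 ennreal_leI less_imp_le[OF assms(5)])
  also have "\<dots> \<le> ennreal (C powr p)" using assms by (simp add: Lp_le_def)
  also have "\<dots> \<le> ennreal (D powr p)" using assms Lp_le_nonneg[OF assms(1)]
    by (intro ennreal_leI powr_mono2) auto
  finally show "(\<integral>\<^sup>+z. ennreal (norm (g z) powr p) \<partial>M) \<le> ennreal (D powr p)" .
  show "0 \<le> D" using Lp_le_nonneg[OF assms(1)] assms by simp
qed fact

lemma Lp_le_mono: "Lp_le M p f C \<Longrightarrow> C \<le> D \<Longrightarrow> 0 < p \<Longrightarrow> Lp_le M p f D"
  by (rule Lp_le_mono_AE[of M p f C]) (auto simp: Lp_le_measurable)

lemma Lp_le_scale: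
  assumes "Lp_le M p f C" "0 < p"
  shows "Lp_le M p (\<lambda>z. c * f z) (norm c * C)"
proof (rule Lp_leI)
  note [measurable] = Lp_le_measurable[OF assms(1)]
  show "(\<lambda>z. c * f z) \<in> borel_measurable M" by measurable
  have "(\<integral>\<^sup>+z. ennreal (norm (c * f z) powr p) \<partial>M)
      = (\<integral>\<^sup>+z. ennreal (norm c powr p) * ennreal (norm (f z) powr p) \<partial>M)"
    by (simp add: norm_mult powr_mult ennreal_mult)
  also have "\<dots> = ennreal (norm c powr p) * (\<integral>\<^sup>+z. ennreal (norm (f z) powr p) \<partial>M)"
    by (intro nn_integral_cmult) measurable
  also have "\<dots> \<le> ennreal (norm c powr p) * ennreal (C powr p)"
    using assms by (intro mult_left_mono) (auto simp: Lp_le_def)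
  also have "\<dots> = ennreal ((norm c * C) powr p)"
    using Lp_le_nonneg[OF assms(1)] by (simp add: powr_mult ennreal_mult)
  finally show "(\<integral>\<^sup>+z. ennreal (norm (c * f z) powr p) \<partial>M) \<le> ennreal ((norm c * C) powr p)" .
qed (use Lp_le_nonneg[OF assms(1)] in simp)

lemma Lp_le_scaleR:
  assumes "Lp_le M p f C" "0 < p"
  shows "Lp_le M p (\<lambda>z. c *\<^sub>R f z) (\<bar>c\<bar> * C)"
  using Lp_le_scale[OF assms, of "of_real c"] by (simp add: scaleR_conv_of_real)

lemma Lp_le_zero: "Lp_le M p (\<lambda>z. 0) 0"
  by (rule Lp_leI) auto

text \<open>Convexity arguments divide by the bound and therefore need it positive. Letting the
  slack tend to 0 recovers bounds that may vanish.\<close>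

lemma Lp_le_eps:
  assumes "\<And>e. e > 0 \<Longrightarrow> Lp_le M p f (C + e)" "0 < p" "0 \<le> C"
  shows "Lp_le M p f C"
proof (rule Lp_leI)
  show "f \<in> borel_measurable M" using assms(1)[of 1] Lp_le_measurable by auto
  have ev: "eventually (\<lambda>e::real. 0 \<le> e) (at_right 0)"
    by (intro eventually_at_rightI[of 0 1]) auto
  have "((\<lambda>e. ennreal ((C + e) powr p)) \<longlongrightarrow> ennreal ((C + 0) powr p)) (at_right 0)"
    using assms(2,3) ev by (intro tendsto_ennrealI tendsto_powr' tendsto_intros) auto
  moreover have "eventually (\<lambda>e. (\<integral>\<^sup>+z. ennreal (norm (f z) powr p) \<partial>M) \<le> ennreal ((C + e) powr p)) (at_right 0)"
    using assms(1) unfolding Lp_le_def by (intro eventually_at_rightI[of 0 1]) auto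
  ultimately show "(\<integral>\<^sup>+z. ennreal (norm (f z) powr p) \<partial>M) \<le> ennreal (C powr p)"
    using tendsto_lowerbound[of "\<lambda>e. ennreal ((C + e) powr p)" "ennreal ((C + 0) powr p)" "at_right (0::real)"]
    by (simp del: tendsto_ennreal_iff)
qed fact

text \<open>Convexity of x^p at the point (u + v) / (C + D), written as the mean of u / C and v / D
  with weights C / (C + D) and D / (C + D). Integrated with \<integral> u^p \<le> C^p and
  \<integral> v^p \<le> D^p, the right side is at most (C + D)^p.\<close>

lemma powr_add_convex:
  fixes u v C D p :: real
  assumes "0 \<le> u" "0 \<le> v" "0 < C" "0 < D" "1 \<le> p"
  shows "(u + v) powr p \<le> (C + D) powr (p - 1) * (C powr (1 - p) * u powr p + D powr (1 - p) * v powr p)"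
proof -
  have cv: "convex_on {0..} (\<lambda>x::real. x powr p)"
  proof (rule convex_onI)
    fix t x y :: real assume t: "0 < t" "t < 1" and xy: "x \<in> {0..}" "y \<in> {0..}"
    \<comment> \<open>The boundary of the half line is treated apart: if x or y is 0, convexity
      reduces to s^p \<le> s for 0 < s < 1.\<close>
    have aux: "(s * x) powr p \<le> s * x powr p" if "0 < s" "s < 1" "0 \<le> x" for s x :: real
    proof -
      have "s powr p \<le> s powr 1" using that assms(5) by (intro powr_mono') auto
      then show ?thesis using that by (simp add: powr_mult mult_right_mono)
    qed
    show "((1 - t) *\<^sub>R x + t *\<^sub>R y) powr p \<le> (1 - t) * x powr p + t * y powr p"
    proof (cases "x = 0 \<or> y = 0")
      case True
      then show ?thesis using aux[of t y] aux[of "1 - t" x] t xy assms(5) by auto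
    next
      case False
      then show ?thesis using convex_onD[OF powr_convex[OF assms(5)], of t x y] t xy by auto
    qed
  qed simp
  have CD: "C + D > 0" using assms by simp
  have "((u + v) / (C + D)) powr p = ((1 - D/(C+D)) *\<^sub>R (u/C) + (D/(C+D)) *\<^sub>R (v/D)) powr p"
  proof -
    have "1 - D/(C+D) = C/(C+D)" using CD by (simp add: field_simps)
    then show ?thesis using assms by (simp add: add_divide_distrib)
  qed
  also have "\<dots> \<le> (1 - D/(C+D)) * (u/C) powr p + (D/(C+D)) * (v/D) powr p"
    using convex_onD[OF cv, of "D/(C+D)" "u/C" "v/D"] assms CD by (auto simp: field_simps)
  also have "\<dots> = (C powr (1 - p) * u powr p + D powr (1 - p) * v powr p) / (C + D)"
  proof -
    have "C powr (1 - p) * u powr p = C * (u/C) powr p" "D powr (1 - p) * v powr p = D * (v/D) powr p"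
      using assms by (simp_all add: powr_divide powr_diff)
    moreover have "1 - D/(C+D) = C/(C+D)" using CD by (simp add: field_simps)
    ultimately show ?thesis by (simp add: add_divide_distrib)
  qed
  finally have "(u + v) powr p \<le> (C + D) powr p * ((C powr (1 - p) * u powr p + D powr (1 - p) * v powr p) / (C + D))"
    using assms CD by (simp add: powr_divide field_simps)
  also have "\<dots> = (C + D) powr (p - 1) * (C powr (1 - p) * u powr p + D powr (1 - p) * v powr p)"
    using CD by (simp add: powr_diff)
  finally show ?thesis .
qed

lemma Lp_le_add:
  assumes "Lp_le M p f C" "Lp_le M p g D" "1 \<le> p"
  shows "Lp_le M p (\<lambda>z. f z + g z) (C + D)"
proof -
  note [measurable] = Lp_le_measurable[OF assms(1)] Lp_le_measurable[OF assms(2)]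
  have p: "0 < p" using assms by simp
  have pos: "Lp_le M p (\<lambda>z. f z + g z) (A + B)"
    if f: "Lp_le M p f A" and g: "Lp_le M p g B" and A: "0 < A" and B: "0 < B" for A B
  proof (rule Lp_leI)
    let ?K = "(A + B) powr (p - 1)"
    have "(\<integral>\<^sup>+z. ennreal (norm (f z + g z) powr p) \<partial>M)
      \<le> (\<integral>\<^sup>+z. ennreal (?K * A powr (1 - p)) * ennreal (norm (f z) powr p)
            + ennreal (?K * B powr (1 - p)) * ennreal (norm (g z) powr p) \<partial>M)"
    proof (rule nn_integral_mono)
      fix z
      have "norm (f z + g z) powr p \<le> (norm (f z) + norm (g z)) powr p"
        using p by (intro powr_mono2 norm_triangle_ineq) auto
      also have "\<dots> \<le> ?K * (A powr (1 - p) * norm (f z) powr p + B powr (1 - p) * norm (g z) powr p)"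
        using A B assms by (intro powr_add_convex) auto
      finally show "ennreal (norm (f z + g z) powr p) \<le> ennreal (?K * A powr (1 - p)) * ennreal (norm (f z) powr p)
            + ennreal (?K * B powr (1 - p)) * ennreal (norm (g z) powr p)"
        by (simp add: ennreal_mult[symmetric] ennreal_plus[symmetric] algebra_simps del: ennreal_plus)
    qed
    also have "\<dots> = ennreal (?K * A powr (1 - p)) * (\<integral>\<^sup>+z. ennreal (norm (f z) powr p) \<partial>M)
            + ennreal (?K * B powr (1 - p)) * (\<integral>\<^sup>+z. ennreal (norm (g z) powr p) \<partial>M)"
      by (subst nn_integral_add; (subst nn_integral_cmult)?; measurable?) (simp add: nn_integral_cmult)
    also have "\<dots> \<le> ennreal (?K * A powr (1 - p)) * ennreal (A powr p)
            + ennreal (?K * B powr (1 - p)) * ennreal (B powr p)"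
      using f g by (intro add_mono mult_left_mono) (auto simp: Lp_le_def)
    also have "\<dots> = ennreal (?K * A powr (1 - p) * A powr p + ?K * B powr (1 - p) * B powr p)"
      by (simp add: ennreal_mult)
    also have "?K * A powr (1 - p) * A powr p + ?K * B powr (1 - p) * B powr p = (A + B) powr p"
    proof -
      have 1: "A powr (1 - p) * A powr p = A" "B powr (1 - p) * B powr p = B" "?K * (A + B) = (A + B) powr p"
        using A B by (simp_all add: powr_add[symmetric] powr_diff)
      have "?K * A powr (1 - p) * A powr p + ?K * B powr (1 - p) * B powr p
        = ?K * (A powr (1 - p) * A powr p + B powr (1 - p) * B powr p)" by (simp add: algebra_simps)
      then show ?thesis by (simp only: 1)
    qed
    finally show "(\<integral>\<^sup>+z. ennreal (norm (f z + g z) powr p) \<partial>M) \<le> ennreal ((A + B) powr p)" .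
  qed (use A B in auto)
  show ?thesis
  proof (rule Lp_le_eps)
    \<comment> \<open>Half of the slack goes to each bound, so that both are positive even if C or D
      is 0.\<close>
    fix e :: real assume "e > 0"
    then have "Lp_le M p (\<lambda>z. f z + g z) ((C + e/2) + (D + e/2))"
      using Lp_le_nonneg[OF assms(1)] Lp_le_nonneg[OF assms(2)] p
      by (intro pos Lp_le_mono[OF assms(1)] Lp_le_mono[OF assms(2)]) auto
    then show "Lp_le M p (\<lambda>z. f z + g z) (C + D + e)" by (simp add: algebra_simps)
  qed (use p Lp_le_nonneg[OF assms(1)] Lp_le_nonneg[OF assms(2)] in auto)
qed

lemma Lp_le_diff:
  assumes "Lp_le M p f C" "Lp_le M p g D" "1 \<le> p"
  shows "Lp_le M p (\<lambda>z. f z - g z) (C + D)"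
  using Lp_le_add[OF assms(1) Lp_le_scale[OF assms(2), of "-1"]] assms(3) by simp

text \<open>A convex function lies above its tangent at c. In this form c stays a free parameter and
  the left side is linear in u, so the inequality can be integrated before c is chosen.\<close>

lemma powr_tangent:
  fixes u c p :: real
  assumes "0 \<le> u" "0 < c" "1 \<le> p"
  shows "p * c powr (p - 1) * u \<le> u powr p + (p - 1) * c powr p"
proof (cases "u = 0")
  case True
  then show ?thesis using assms by simp
next
  case False
  then have u: "0 < u" using assms by simp
  have "((\<lambda>x. x powr p) has_real_derivative p * c powr (p - 1)) (at c within {0<..})"
    using assms by (auto intro!: derivative_eq_intros)
  then have "p * c powr (p - 1) * (u - c) \<le> u powr p - c powr p"
    by (intro convex_on_imp_above_tangent[OF powr_convex]) (use assms u in \<open>auto simp: interior_open connected_Ioi\<close>)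
  moreover have "p * c powr (p - 1) * c = p * c powr p" using assms by (simp add: powr_diff)
  ultimately show ?thesis by (simp add: right_diff_distrib left_diff_distrib)
qed

text \<open>Jensen's inequality for the measure with density \<open>\<eta>\<close>.  Integrating the tangent inequality at an arbitrary
  \<open>c\<close> first shows that the integral \<open>H\<close> of \<open>f\<close> is finite, so that \<open>c = H / C\<close> may be chosen afterwards.\<close>

lemma powr_nn_integral_le:
  fixes f \<eta> :: "'b \<Rightarrow> real"
  assumes [measurable]: "f \<in> borel_measurable N" "\<eta> \<in> borel_measurable N"
    and pos: "\<And>t. 0 < \<eta> t" "\<And>t. 0 \<le> f t" and C: "(\<integral>\<^sup>+t. ennreal (\<eta> t) \<partial>N) \<le> ennreal C" "0 < C" and p: "1 \<le> p"
    and J: "(\<integral>\<^sup>+t. ennreal (\<eta> t powr (1 - p) * f t powr p) \<partial>N) < \<infinity>"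
  shows "(\<integral>\<^sup>+t. ennreal (f t) \<partial>N) < \<infinity>"
    "ennreal (enn2real (\<integral>\<^sup>+t. ennreal (f t) \<partial>N) powr p)
      \<le> ennreal (C powr (p - 1)) * (\<integral>\<^sup>+t. ennreal (\<eta> t powr (1 - p) * f t powr p) \<partial>N)"
proof -
  define H where "H = (\<integral>\<^sup>+t. ennreal (f t) \<partial>N)"
  define J where "J = (\<integral>\<^sup>+t. ennreal (\<eta> t powr (1 - p) * f t powr p) \<partial>N)"
  have main: "ennreal (p * c powr (p - 1)) * H \<le> J + ennreal ((p - 1) * c powr p * C)" if c: "0 < c" for c
  proof -
    have "ennreal (p * c powr (p - 1)) * H = (\<integral>\<^sup>+t. ennreal (p * c powr (p - 1) * f t) \<partial>N)"
      unfolding H_def using p by (subst nn_integral_cmult[symmetric]) (auto simp: ennreal_mult pos)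
    also have "\<dots> \<le> (\<integral>\<^sup>+t. ennreal (\<eta> t powr (1 - p) * f t powr p) + ennreal ((p - 1) * c powr p) * ennreal (\<eta> t) \<partial>N)"
    proof (rule nn_integral_mono)
      fix t
      have "p * c powr (p - 1) * (f t / \<eta> t) \<le> (f t / \<eta> t) powr p + (p - 1) * c powr p"
        using pos c p by (intro powr_tangent) (auto intro: divide_nonneg_pos)
      then have "\<eta> t * (p * c powr (p - 1) * (f t / \<eta> t)) \<le> \<eta> t * ((f t / \<eta> t) powr p + (p - 1) * c powr p)"
        using pos(1)[of t] by (intro mult_left_mono) auto
      also have "\<eta> t * (p * c powr (p - 1) * (f t / \<eta> t)) = p * c powr (p - 1) * f t"
        using pos(1)[of t] by simp
      also have "\<eta> t * ((f t / \<eta> t) powr p + (p - 1) * c powr p)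
         = \<eta> t powr (1 - p) * f t powr p + (p - 1) * c powr p * \<eta> t"
        using pos(1)[of t] pos(2)[of t] by (simp add: powr_divide powr_diff algebra_simps)
      finally show "ennreal (p * c powr (p - 1) * f t) \<le> ennreal (\<eta> t powr (1 - p) * f t powr p) + ennreal ((p - 1) * c powr p) * ennreal (\<eta> t)"
        using p pos(1)[of t] by (simp add: ennreal_mult[symmetric] ennreal_plus[symmetric] ennreal_leI del: ennreal_plus)
    qed
    also have "\<dots> = J + ennreal ((p - 1) * c powr p) * (\<integral>\<^sup>+t. ennreal (\<eta> t) \<partial>N)"
      unfolding J_def by (subst nn_integral_add) (auto simp: nn_integral_cmult)
    also have "\<dots> \<le> J + ennreal ((p - 1) * c powr p) * ennreal C"
      using C by (intro add_left_mono mult_left_mono) auto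
    finally show ?thesis using p C by (simp add: ennreal_mult)
  qed
  have Jf: "J < \<infinity>" using assms(8) by (simp add: J_def)
  have "ennreal p * H < \<infinity>" using main[of 1] Jf by (auto simp: less_top[symmetric] top_unique)
  then have Hf: "H < \<infinity>" using p by (auto simp: ennreal_mult_less_top ennreal_eq_0_iff)
  then show "(\<integral>\<^sup>+t. ennreal (f t) \<partial>N) < \<infinity>" by (simp add: H_def)
  define h where "h = enn2real H"
  define j where "j = enn2real J"
  have hj: "H = ennreal h" "J = ennreal j" "0 \<le> h" "0 \<le> j" using Hf Jf by (auto simp: h_def j_def)
  have main': "p * c powr (p - 1) * h \<le> j + (p - 1) * c powr p * C" if "0 < c" for c
    using main[OF that] hj p C
    by (simp add: ennreal_mult[symmetric] ennreal_plus[symmetric] ennreal_le_iff del: ennreal_plus)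
  have "h powr p \<le> C powr (p - 1) * j"
  proof (cases "h = 0")
    case True
    then show ?thesis using p hj by simp
  next
    case False
    then have h: "0 < h" using hj by simp
    have "p * (h / C) powr (p - 1) * h \<le> j + (p - 1) * (h / C) powr p * C"
      using h C by (intro main') auto
    moreover have "(h / C) powr (p - 1) * h = h powr p / C powr (p - 1)" "(h / C) powr p * C = h powr p / C powr (p - 1)"
      using h C by (simp_all add: powr_divide powr_diff)
    ultimately have "p * (h powr p / C powr (p - 1)) \<le> j + (p - 1) * (h powr p / C powr (p - 1))"
      by (simp only: mult.assoc)
    moreover have "X \<le> j" if "p * X \<le> j + (p - 1) * X" for X
      using that by (simp add: left_diff_distrib)
    ultimately have "h powr p / C powr (p - 1) \<le> j" by blast
    then show ?thesis using C by (simp add: field_simps)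
  qed
  then show "ennreal (enn2real (\<integral>\<^sup>+t. ennreal (f t) \<partial>N) powr p)
      \<le> ennreal (C powr (p - 1)) * (\<integral>\<^sup>+t. ennreal (\<eta> t powr (1 - p) * f t powr p) \<partial>N)"
    unfolding H_def[symmetric] J_def[symmetric] h_def[symmetric] using hj
    by (simp add: ennreal_mult[symmetric] ennreal_leI)
qed

text \<open>Jensen with density \<eta> bounds |\<integral> F|^p by C^(p-1) \<integral> \<eta>^(1-p)
  |F|^p for almost every z. By Tonelli the z-integral of this is at most C^(p-1) \<integral>
  \<eta>^(1-p) \<eta>^p = C^(p-1) \<integral> \<eta> \<le> C^p. Finiteness of \<open>J\<close>
  almost everywhere also yields integrability in t.\<close>

lemma Lp_le_integral_pos:
  fixes F :: "'b \<Rightarrow> 'a \<Rightarrow> complex"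
  assumes N: "sigma_finite_measure N" and M: "sigma_finite_measure M"
    and F[measurable]: "(\<lambda>(t, z). F t z) \<in> borel_measurable (N \<Otimes>\<^sub>M M)"
    and le: "\<And>t. t \<in> space N \<Longrightarrow> Lp_le M p (F t) (\<eta> t)" and \<eta>[measurable]: "\<eta> \<in> borel_measurable N"
    and pos: "\<And>t. 0 < \<eta> t"
    and C: "(\<integral>\<^sup>+t. ennreal (\<eta> t) \<partial>N) \<le> ennreal C" "0 < C" and p: "1 \<le> p"
  shows "AE z in M. integrable N (\<lambda>t. F t z)" "Lp_le M p (\<lambda>z. \<integral>t. F t z \<partial>N) C"
proof -
  interpret N: sigma_finite_measure N by fact
  interpret M: sigma_finite_measure M by fact
  interpret P: pair_sigma_finite N M ..
  define J where "J = (\<lambda>z. \<integral>\<^sup>+t. ennreal (\<eta> t powr (1 - p) * norm (F t z) powr p) \<partial>N)"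
  have [measurable]: "(\<lambda>(t, z). ennreal (\<eta> t powr (1 - p) * norm (F t z) powr p)) \<in> borel_measurable (N \<Otimes>\<^sub>M M)"
    by measurable
  have [measurable]: "(\<lambda>(z, t). F t z) \<in> borel_measurable (M \<Otimes>\<^sub>M N)"
    using measurable_compose[OF measurable_pair_swap' F] by (simp add: split_beta' comp_def)
  have [measurable]: "J \<in> borel_measurable M" unfolding J_def by measurable
  have "(\<integral>\<^sup>+z. J z \<partial>M) = (\<integral>\<^sup>+t. (\<integral>\<^sup>+z. ennreal (\<eta> t powr (1 - p) * norm (F t z) powr p) \<partial>M) \<partial>N)"
    unfolding J_def by (intro P.Fubini') measurable
  also have "\<dots> \<le> (\<integral>\<^sup>+t. ennreal (\<eta> t) \<partial>N)"
  proof (rule nn_integral_mono)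
    fix t assume t: "t \<in> space N"
    note [measurable] = Lp_le_measurable[OF le[OF t]]
    have "(\<integral>\<^sup>+z. ennreal (\<eta> t powr (1 - p) * norm (F t z) powr p) \<partial>M)
       = ennreal (\<eta> t powr (1 - p)) * (\<integral>\<^sup>+z. ennreal (norm (F t z) powr p) \<partial>M)"
      by (subst nn_integral_cmult[symmetric]) (auto simp: ennreal_mult)
    also have "\<dots> \<le> ennreal (\<eta> t powr (1 - p)) * ennreal (\<eta> t powr p)"
      using le[OF t] by (intro mult_left_mono) (auto simp: Lp_le_def)
    also have "\<dots> = ennreal (\<eta> t)" using pos[of t] by (simp add: ennreal_mult[symmetric] powr_add[symmetric])
    finally show "(\<integral>\<^sup>+z. ennreal (\<eta> t powr (1 - p) * norm (F t z) powr p) \<partial>M) \<le> ennreal (\<eta> t)" .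
  qed
  also note C(1)
  finally have JC: "(\<integral>\<^sup>+z. J z \<partial>M) \<le> ennreal C" .
  then have "(\<integral>\<^sup>+z. J z \<partial>M) \<noteq> \<infinity>" by (auto simp: top_unique)
  then have AE: "AE z in M. J z < \<infinity>" using nn_integral_PInf_AE[of J M] by (auto simp: less_top)
  have pt: "(\<integral>\<^sup>+t. ennreal (norm (F t z)) \<partial>N) < \<infinity>"
      "ennreal (enn2real (\<integral>\<^sup>+t. ennreal (norm (F t z)) \<partial>N) powr p) \<le> ennreal (C powr (p - 1)) * J z"
    if "J z < \<infinity>" "z \<in> space M" for z
    using that powr_nn_integral_le[OF _ \<eta> pos norm_ge_zero C p, of "\<lambda>t. F t z"] unfolding J_def by auto
  show int: "AE z in M. integrable N (\<lambda>t. F t z)"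
    using AE by (rule AE_mp) (use pt in \<open>auto simp: integrable_iff_bounded\<close>)
  show "Lp_le M p (\<lambda>z. \<integral>t. F t z \<partial>N) C"
  proof (rule Lp_leI)
    show "(\<lambda>z. \<integral>t. F t z \<partial>N) \<in> borel_measurable M" by measurable
    have "(\<integral>\<^sup>+z. ennreal (norm (\<integral>t. F t z \<partial>N) powr p) \<partial>M) \<le> (\<integral>\<^sup>+z. ennreal (C powr (p - 1)) * J z \<partial>M)"
    proof (rule nn_integral_mono_AE, use AE in \<open>rule AE_mp\<close>, rule AE_I2, rule impI)
      fix z assume z: "z \<in> space M" "J z < \<infinity>"
      have i: "integrable N (\<lambda>t. F t z)" using pt(1)[OF z(2,1)] z by (auto simp: integrable_iff_bounded)
      have "norm (\<integral>t. F t z \<partial>N) \<le> enn2real (\<integral>\<^sup>+t. ennreal (norm (F t z)) \<partial>N)"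
        using integral_norm_bound[of N "\<lambda>t. F t z"] i integral_eq_nn_integral[of "\<lambda>t. norm (F t z)" N] by auto
      then have "ennreal (norm (\<integral>t. F t z \<partial>N) powr p) \<le> ennreal (enn2real (\<integral>\<^sup>+t. ennreal (norm (F t z)) \<partial>N) powr p)"
        using p by (intro ennreal_leI powr_mono2) auto
      also have "\<dots> \<le> ennreal (C powr (p - 1)) * J z" using pt(2)[OF z(2,1)] .
      finally show "ennreal (norm (\<integral>t. F t z \<partial>N) powr p) \<le> ennreal (C powr (p - 1)) * J z" .
    qed
    also have "\<dots> = ennreal (C powr (p - 1)) * (\<integral>\<^sup>+z. J z \<partial>M)" by (intro nn_integral_cmult) measurable
    also have "\<dots> \<le> ennreal (C powr (p - 1)) * ennreal C" using JC by (intro mult_left_mono) auto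
    also have "\<dots> = ennreal (C powr p)" using C by (simp add: ennreal_mult[symmetric] powr_diff)
    finally show "(\<integral>\<^sup>+z. ennreal (norm (\<integral>t. F t z \<partial>N) powr p) \<partial>M) \<le> ennreal (C powr p)" .
  qed (use C in simp)
qed

text \<open>Minkowski's integral inequality. A bound \<eta> that may vanish is replaced by its
  positive part plus a small multiple of a strictly positive integrable \<open>w\<close>, and the
  multiple then tends to 0.\<close>

lemma Lp_le_integral:
  fixes F :: "'b \<Rightarrow> 'a \<Rightarrow> complex"
  assumes N: "sigma_finite_measure N" and M: "sigma_finite_measure M"
    and F: "(\<lambda>(t, z). F t z) \<in> borel_measurable (N \<Otimes>\<^sub>M M)"
    and le: "\<And>t. t \<in> space N \<Longrightarrow> Lp_le M p (F t) (\<eta> t)" and \<eta>[measurable]: "\<eta> \<in> borel_measurable N"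
    and C: "(\<integral>\<^sup>+t. ennreal (\<eta> t) \<partial>N) \<le> ennreal C" "0 \<le> C" and p: "1 \<le> p"
  shows "AE z in M. integrable N (\<lambda>t. F t z)" "Lp_le M p (\<lambda>z. \<integral>t. F t z \<partial>N) C"
proof -
  obtain w :: "'b \<Rightarrow> real" where w[measurable]: "w \<in> borel_measurable N" and w0: "\<And>t. 0 < w t" and wi: "integrable N w"
    using sigma_finite_measure.obtain_positive_integrable_function[OF N] by metis
  define W where "W = (\<integral>t. w t \<partial>N)"
  have W: "0 \<le> W" unfolding W_def using w0 by (intro integral_nonneg_AE) (auto intro: less_imp_le)
  have main: "(AE z in M. integrable N (\<lambda>t. F t z)) \<and> Lp_le M p (\<lambda>z. \<integral>t. F t z \<partial>N) (C + e)" if e: "0 < e" for e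
  proof -
    \<comment> \<open>The added mass is e W / (W + 1) \<le> e; the 1 in the denominator covers W =
      0.\<close>
    define \<eta>' where "\<eta>' t = max 0 (\<eta> t) + e / (W + 1) * w t" for t
    have [measurable]: "\<eta>' \<in> borel_measurable N" unfolding \<eta>'_def by measurable
    have \<eta>0: "0 < \<eta>' t" for t unfolding \<eta>'_def using e W w0[of t] by (intro add_nonneg_pos mult_pos_pos) auto
    have "(\<integral>\<^sup>+t. ennreal (\<eta>' t) \<partial>N) = (\<integral>\<^sup>+t. ennreal (\<eta> t) + ennreal (e / (W + 1)) * ennreal (w t) \<partial>N)"
      unfolding \<eta>'_def using e W w0
      by (intro nn_integral_cong) (auto simp: ennreal_mult[symmetric] less_imp_le max_def ennreal_neg)
    also have "\<dots> = (\<integral>\<^sup>+t. ennreal (\<eta> t) \<partial>N) + ennreal (e / (W + 1)) * (\<integral>\<^sup>+t. ennreal (w t) \<partial>N)"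
      by (subst nn_integral_add) (auto simp: nn_integral_cmult)
    also have "(\<integral>\<^sup>+t. ennreal (w t) \<partial>N) = ennreal W"
      unfolding W_def using wi w0 by (intro nn_integral_eq_integral) (auto intro: less_imp_le)
    also have "(\<integral>\<^sup>+t. ennreal (\<eta> t) \<partial>N) + ennreal (e / (W + 1)) * ennreal W \<le> ennreal C + ennreal e"
      using C e W by (intro add_mono) (auto simp: ennreal_mult[symmetric] field_simps intro!: ennreal_leI)
    finally have "(\<integral>\<^sup>+t. ennreal (\<eta>' t) \<partial>N) \<le> ennreal (C + e)" using C e by simp
    moreover have "Lp_le M p (F t) (\<eta>' t)" if "t \<in> space N" for t
      using le[OF that] p e W w0[of t]
      by (rule_tac Lp_le_mono[of _ _ _ "\<eta> t"]) (auto simp: \<eta>'_def intro!: add_increasing2 mult_nonneg_nonneg)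
    ultimately show ?thesis
      using Lp_le_integral_pos[OF N M F, where p = p and C = "C + e" and \<eta> = \<eta>'] C e p \<eta>0 by auto
  qed
  show "AE z in M. integrable N (\<lambda>t. F t z)" by (rule conjunct1[OF main[OF zero_less_one]])
  show "Lp_le M p (\<lambda>z. \<integral>t. F t z \<partial>N) C"
  proof (rule Lp_le_eps)
    show "Lp_le M p (\<lambda>z. \<integral>t. F t z \<partial>N) (C + e)" if "0 < e" for e using main[OF that] by (rule conjunct2)
  qed (use C(2) p in auto)
qed

section \<open>Closed subspaces of operators\<close>

lemma Lp_le_minus_commute:
  "Lp_le M p (\<lambda>z. f z - g z) C \<Longrightarrow> 0 < p \<Longrightarrow> Lp_le M p (\<lambda>z. g z - f z) C"
  using Lp_le_scale[of M p "\<lambda>z. f z - g z" C "-1"] by simp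

lemma Lp_iff_Lp_le: "0 < p \<Longrightarrow> f \<in> Lp M p \<longleftrightarrow> (\<exists>C. Lp_le M p f C)"
  using Lp_le_imp_Lp Lp_imp_Lp_le by blast

lemma Lp_diff_cancel:
  assumes "u \<in> Lp M p" "Lp_le M p (\<lambda>z. u z - f z) e" "1 \<le> p"
  shows "f \<in> Lp M p"
proof -
  obtain C where "Lp_le M p u C" using assms Lp_iff_Lp_le[of p u M] by auto
  from Lp_le_diff[OF this assms(2,3)] show ?thesis by (auto intro: Lp_le_imp_Lp)
qed

text \<open>Approximation within every e replaces sequences, which spares diagonal arguments when
  closures are iterated. Conversely, approximants within 1 / (n + 1) form the sequences, and
  membership of the limits in L^p follows from that of the approximants.\<close>

lemma closure_op_iff:
  assumes p: "1 \<le> p"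
  shows "(f, g) \<in> closure_op M p T \<longleftrightarrow>
     (\<forall>e>0. \<exists>(u, v)\<in>T. u \<in> Lp M p \<and> v \<in> Lp M p \<and>
        Lp_le M p (\<lambda>z. u z - f z) e \<and> Lp_le M p (\<lambda>z. v z - g z) e)" (is "?L = ?R")
proof
  assume ?L
  then obtain u v where T: "\<And>n. (u n, v n) \<in> T" and u: "Lp_tendsto M p u f" and v: "Lp_tendsto M p v g"
    unfolding closure_op_def by auto
  have *: "eventually (\<lambda>n. Lp_le M p (\<lambda>z. u n z - f z) e) sequentially"
    if u: "Lp_tendsto M p u f" and e: "0 < e" for u :: "nat \<Rightarrow> 'a \<Rightarrow> complex" and f e
  proof -
    have "eventually (\<lambda>n. Lp_norm M p (\<lambda>z. u n z - f z) < e) sequentially"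
      using u e unfolding Lp_tendsto_def by (auto dest: order_tendstoD)
    moreover have "(\<lambda>z. u n z - f z) \<in> Lp M p" for n
    proof -
      obtain C D where "Lp_le M p (u n) C" "Lp_le M p f D"
        using u p Lp_iff_Lp_le[of p] unfolding Lp_tendsto_def by (metis less_le_trans zero_less_one)
      from Lp_le_diff[OF this p] show ?thesis by (rule Lp_le_imp_Lp)
    qed
    ultimately show ?thesis using p by (auto elim!: eventually_mono intro!: Lp_imp_Lp_le)
  qed
  show ?R
  proof (intro allI impI)
    fix e :: real assume e: "e > 0"
    have "eventually (\<lambda>n. Lp_le M p (\<lambda>z. u n z - f z) e \<and> Lp_le M p (\<lambda>z. v n z - g z) e) sequentially"
      using *[OF u e] *[OF v e] by eventually_elim auto
    then obtain n where "Lp_le M p (\<lambda>z. u n z - f z) e \<and> Lp_le M p (\<lambda>z. v n z - g z) e"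
      by (auto simp: eventually_sequentially)
    with T[of n] u v show "\<exists>(u, v)\<in>T. u \<in> Lp M p \<and> v \<in> Lp M p \<and>
        Lp_le M p (\<lambda>z. u z - f z) e \<and> Lp_le M p (\<lambda>z. v z - g z) e"
      unfolding Lp_tendsto_def by (intro bexI[of _ "(u n, v n)"]) auto
  qed
next
  assume R: ?R
  have "\<exists>x. fst x \<in> Lp M p \<and> snd x \<in> Lp M p \<and> x \<in> T \<and>
        Lp_le M p (\<lambda>z. fst x z - f z) (inverse (real (Suc n))) \<and> Lp_le M p (\<lambda>z. snd x z - g z) (inverse (real (Suc n)))" for n
  proof -
    have "0 < inverse (real (Suc n))" by simp
    then obtain u v where "(u, v) \<in> T" "u \<in> Lp M p" "v \<in> Lp M p"
      "Lp_le M p (\<lambda>z. u z - f z) (inverse (real (Suc n)))" "Lp_le M p (\<lambda>z. v z - g z) (inverse (real (Suc n)))"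
      using R by blast
    then show ?thesis by (intro exI[of _ "(u, v)"]) (simp only: fst_conv snd_conv simp_thms)
  qed
  then obtain x where x: "\<And>n. fst (x n) \<in> Lp M p \<and> snd (x n) \<in> Lp M p \<and> x n \<in> T \<and>
        Lp_le M p (\<lambda>z. fst (x n) z - f z) (inverse (real (Suc n))) \<and> Lp_le M p (\<lambda>z. snd (x n) z - g z) (inverse (real (Suc n)))"
    using choice[of "\<lambda>n x. fst x \<in> Lp M p \<and> snd x \<in> Lp M p \<and> x \<in> T \<and> Lp_le M p (\<lambda>z. fst x z - f z) (inverse (real (Suc n))) \<and> Lp_le M p (\<lambda>z. snd x z - g z) (inverse (real (Suc n)))"] by blast
  have f: "f \<in> Lp M p" "g \<in> Lp M p"
    using Lp_diff_cancel[OF conjunct1[OF x[of 0]], OF _ p] Lp_diff_cancel[OF conjunct1[OF conjunct2[OF x[of 0]]], OF _ p] x[of 0]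
    by blast+
  have lim: "(\<lambda>n. Lp_norm M p (\<lambda>z. h n z - k z)) \<longlonglongrightarrow> 0"
    if "\<And>n. Lp_le M p (\<lambda>z. h n z - k z) (inverse (real (Suc n)))" for h k
  proof (rule tendsto_sandwich[OF _ _ tendsto_const LIMSEQ_inverse_real_of_nat])
    show "\<forall>\<^sub>F n in sequentially. 0 \<le> Lp_norm M p (\<lambda>z. h n z - k z)" by (simp add: Lp_norm_nonneg)
    show "\<forall>\<^sub>F n in sequentially. Lp_norm M p (\<lambda>z. h n z - k z) \<le> inverse (real (Suc n))"
      using that p by (intro always_eventually allI Lp_norm_le) auto
  qed
  have "Lp_tendsto M p (\<lambda>n. fst (x n)) f" "Lp_tendsto M p (\<lambda>n. snd (x n)) g"
    unfolding Lp_tendsto_def by (intro conjI allI lim f; use x in blast)+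
  moreover have "\<forall>n. (fst (x n), snd (x n)) \<in> T" using x by simp
  ultimately show ?L
    unfolding closure_op_def mem_Collect_eq prod.case by (intro exI conjI)
qed

text \<open>The graph of a closed linear operator, for functions instead of classes. The last clause
  also makes it invariant under measurable changes on null sets, since the differences then satisfy
  \<open>Lp_le\<close> with every e.\<close>

definition closed_subspace where
  "closed_subspace M p A \<longleftrightarrow>
     (\<forall>f g. (f, g) \<in> A \<longrightarrow> f \<in> Lp M p \<and> g \<in> Lp M p) \<and>
     (\<forall>f g f' g' c. (f, g) \<in> A \<longrightarrow> (f', g') \<in> A \<longrightarrow> (\<lambda>z. c * f z + f' z, \<lambda>z. c * g z + g' z) \<in> A) \<and>
     (\<lambda>z. 0, \<lambda>z. 0) \<in> A \<and>
     (\<forall>f g. (\<forall>e>0. \<exists>(u, v)\<in>A. Lp_le M p (\<lambda>z. u z - f z) e \<and> Lp_le M p (\<lambda>z. v z - g z) e) \<longrightarrow> (f, g) \<in> A)"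

text \<open>A linear combination of pairs is only asked to agree with an element of \<open>T\<close>
  on the space of \<open>M\<close>. For \<open>Delta\<close> this is the half plane, where linearity
  is a computation with derivatives.\<close>

lemma closed_subspace_closure_op:
  assumes p: "1 \<le> p" and zero: "(\<lambda>z. 0, \<lambda>z. 0) \<in> T"
    and lin: "\<And>u v u' v' c. (u, v) \<in> T \<Longrightarrow> (u', v') \<in> T \<Longrightarrow>
       \<exists>(U, V)\<in>T. \<forall>z\<in>space M. U z = c * u z + u' z \<and> V z = c * v z + v' z"
  shows "closed_subspace M p (closure_op M p T)"
  unfolding closed_subspace_def
proof (intro conjI allI impI)
  have p0: "0 < p" using p by simp
  show "f \<in> Lp M p" "g \<in> Lp M p" if "(f, g) \<in> closure_op M p T" for f g
    using that by (auto simp: closure_op_def Lp_tendsto_def)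
  show "(\<lambda>z. 0, \<lambda>z. 0) \<in> closure_op M p T"
    unfolding closure_op_iff[OF p]
  proof (intro allI impI)
    fix e :: real assume e: "0 < e"
    have "Lp_le M p (\<lambda>z. 0 - 0) e" using Lp_le_mono[OF Lp_le_zero, of e p M] e p0 by simp
    then show "\<exists>(u, v)\<in>T. u \<in> Lp M p \<and> v \<in> Lp M p \<and> Lp_le M p (\<lambda>z. u z - 0) e \<and> Lp_le M p (\<lambda>z. v z - 0) e"
      using zero Lp_le_imp_Lp[OF Lp_le_zero] by blast
  qed
  show "(f, g) \<in> closure_op M p T"
    if cl: "\<forall>e>0. \<exists>(u, v)\<in>closure_op M p T. Lp_le M p (\<lambda>z. u z - f z) e \<and> Lp_le M p (\<lambda>z. v z - g z) e" for f g
    unfolding closure_op_iff[OF p]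
  proof (intro allI impI)
    fix e :: real assume e: "0 < e"
    then have "0 < e / 2" by simp
    then obtain u v where uv: "(u, v) \<in> closure_op M p T"
        "Lp_le M p (\<lambda>z. u z - f z) (e/2)" "Lp_le M p (\<lambda>z. v z - g z) (e/2)"
      using cl by blast
    from \<open>0 < e / 2\<close> obtain u' v' where uv': "(u', v') \<in> T" "u' \<in> Lp M p" "v' \<in> Lp M p"
        "Lp_le M p (\<lambda>z. u' z - u z) (e/2)" "Lp_le M p (\<lambda>z. v' z - v z) (e/2)"
      using uv(1)[unfolded closure_op_iff[OF p]] by blast
    have "Lp_le M p (\<lambda>z. u' z - f z) e" "Lp_le M p (\<lambda>z. v' z - g z) e"
      using Lp_le_add[OF uv'(4) uv(2) p] Lp_le_add[OF uv'(5) uv(3) p] by simp_all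
    with uv' show "\<exists>(u, v)\<in>T. u \<in> Lp M p \<and> v \<in> Lp M p \<and>
        Lp_le M p (\<lambda>z. u z - f z) e \<and> Lp_le M p (\<lambda>z. v z - g z) e"
      by blast
  qed
  show "(\<lambda>z. c * f z + f' z, \<lambda>z. c * g z + g' z) \<in> closure_op M p T"
    if fg: "(f, g) \<in> closure_op M p T" and fg': "(f', g') \<in> closure_op M p T" for f g f' g' c
    unfolding closure_op_iff[OF p]
  proof (intro allI impI)
    fix e :: real assume e: "0 < e"
    define d where "d = e / (norm c + 1)"
    have c1: "0 < norm c + 1" by (simp add: add_nonneg_pos)
    then have d: "0 < d" using e by (simp add: d_def)
    have "(norm c + 1) * d = e" using c1 by (simp add: d_def)
    then have de: "norm c * d + d = e" by (simp add: distrib_right)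
    obtain u v where uv: "(u, v) \<in> T" "Lp_le M p (\<lambda>z. u z - f z) d" "Lp_le M p (\<lambda>z. v z - g z) d"
        "u \<in> Lp M p" "v \<in> Lp M p"
      using fg[unfolded closure_op_iff[OF p]] d by blast
    obtain u' v' where uv': "(u', v') \<in> T" "Lp_le M p (\<lambda>z. u' z - f' z) d" "Lp_le M p (\<lambda>z. v' z - g' z) d"
        "u' \<in> Lp M p" "v' \<in> Lp M p"
      using fg'[unfolded closure_op_iff[OF p]] d by blast
    obtain U V where UV: "(U, V) \<in> T" "\<And>z. z \<in> space M \<Longrightarrow> U z = c * u z + u' z" "\<And>z. z \<in> space M \<Longrightarrow> V z = c * v z + v' z"
      using lin[OF uv(1) uv'(1), of c] by auto
    have *: "Lp_le M p (\<lambda>z. U z - (c * f z + f' z)) e"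
      if "Lp_le M p (\<lambda>z. u z - f z) d" "Lp_le M p (\<lambda>z. u' z - f' z) d" and Uz: "\<And>z. z \<in> space M \<Longrightarrow> U z = c * u z + u' z"
        and "U \<in> Lp M p" "u \<in> Lp M p" "u' \<in> Lp M p" for U u u' f f'
    proof -
      have 1: "Lp_le M p (\<lambda>z. c * (u z - f z) + (u' z - f' z)) e"
        using Lp_le_add[OF Lp_le_scale[OF that(1) p0, of c] that(2) p] de by simp
      have [measurable]: "f \<in> borel_measurable M" "f' \<in> borel_measurable M" "U \<in> borel_measurable M"
        using Lp_diff_cancel[OF that(5,1) p] Lp_diff_cancel[OF that(6,2) p] that(4) by (auto simp: Lp_def)
      show ?thesis
      proof (rule Lp_le_mono_AE[OF 1 _ _ order_refl p0])
        show "(\<lambda>z. U z - (c * f z + f' z)) \<in> borel_measurable M" by measurable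
        show "AE z in M. norm (U z - (c * f z + f' z)) \<le> norm (c * (u z - f z) + (u' z - f' z))"
          by (rule AE_I2) (simp add: Uz algebra_simps)
      qed
    qed
    show "\<exists>(u, v)\<in>T. u \<in> Lp M p \<and> v \<in> Lp M p \<and>
        Lp_le M p (\<lambda>z. u z - (c * f z + f' z)) e \<and> Lp_le M p (\<lambda>z. v z - (c * g z + g' z)) e"
    proof (rule bexI[of _ "(U, V)"])
      have L': "W \<in> Lp M p" if w: "w \<in> Lp M p" and w': "w' \<in> Lp M p" and W: "\<And>z. z \<in> space M \<Longrightarrow> W z = c * w z + w' z"
        for W w w'
      proof -
        obtain C D where "Lp_le M p w C" "Lp_le M p w' D" using w w' Lp_iff_Lp_le[OF p0] by blast
        then have "Lp_le M p (\<lambda>z. c * w z + w' z) (norm c * C + D)" by (intro Lp_le_add Lp_le_scale p p0)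
        then have "(\<lambda>z. c * w z + w' z) \<in> Lp M p" by (rule Lp_le_imp_Lp)
        then show ?thesis
          unfolding Lp_def using W by (simp cong: measurable_cong Bochner_Integration.integrable_cong)
      qed
      have L: "U \<in> Lp M p" "V \<in> Lp M p" "u \<in> Lp M p" "v \<in> Lp M p" "u' \<in> Lp M p" "v' \<in> Lp M p"
        using L'[OF uv(4) uv'(4) UV(2)] L'[OF uv(5) uv'(5) UV(3)] uv(4,5) uv'(4,5) by blast+
      show "case (U, V) of (u, v) \<Rightarrow> u \<in> Lp M p \<and> v \<in> Lp M p \<and>
        Lp_le M p (\<lambda>z. u z - (c * f z + f' z)) e \<and> Lp_le M p (\<lambda>z. v z - (c * g z + g' z)) e"
        unfolding prod.case
        by (intro conjI L *[OF uv(2) uv'(2) UV(2) L(1,3,5)] *[OF uv(3) uv'(3) UV(3) L(2,4,6)])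
    qed fact
  qed
qed

lemma closed_subspaceD:
  assumes "closed_subspace M p A"
  shows "(f, g) \<in> A \<Longrightarrow> f \<in> Lp M p" "(f, g) \<in> A \<Longrightarrow> g \<in> Lp M p"
    "(f, g) \<in> A \<Longrightarrow> (f', g') \<in> A \<Longrightarrow> (\<lambda>z. c * f z + f' z, \<lambda>z. c * g z + g' z) \<in> A"
    "(\<lambda>z. 0, \<lambda>z. 0) \<in> A"
    "(\<And>e. e > 0 \<Longrightarrow> \<exists>(u, v)\<in>A. Lp_le M p (\<lambda>z. u z - f z) e \<and> Lp_le M p (\<lambda>z. v z - g z) e) \<Longrightarrow> (f, g) \<in> A"
proof -
  note a = assms[unfolded closed_subspace_def]
  show "(f, g) \<in> A \<Longrightarrow> f \<in> Lp M p" "(f, g) \<in> A \<Longrightarrow> g \<in> Lp M p"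
    using conjunct1[OF a] by blast+
  show "(f, g) \<in> A \<Longrightarrow> (f', g') \<in> A \<Longrightarrow> (\<lambda>z. c * f z + f' z, \<lambda>z. c * g z + g' z) \<in> A"
    by (rule conjunct1[OF conjunct2[OF a], rule_format])
  show "(\<lambda>z. 0, \<lambda>z. 0) \<in> A"
    by (rule conjunct1[OF conjunct2[OF conjunct2[OF a]]])
  show "(f, g) \<in> A" if "\<And>e. e > 0 \<Longrightarrow> \<exists>(u, v)\<in>A. Lp_le M p (\<lambda>z. u z - f z) e \<and> Lp_le M p (\<lambda>z. v z - g z) e"
    by (rule conjunct2[OF conjunct2[OF conjunct2[OF a]], rule_format]) (rule that)
qed

lemma closed_subspace_scale:
  assumes "closed_subspace M p A" "(f, g) \<in> A"
  shows "(\<lambda>z. c * f z, \<lambda>z. c * g z) \<in> A"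
  using closed_subspaceD(3)[OF assms closed_subspaceD(4)[OF assms(1)], of c] by simp

lemma closed_subspace_sum:
  fixes n :: nat
  assumes "closed_subspace M p A" "\<And>i. i < n \<Longrightarrow> (f i, g i) \<in> A"
  shows "(\<lambda>z. \<Sum>i<n. c i *\<^sub>R f i z, \<lambda>z. \<Sum>i<n. c i *\<^sub>R g i z) \<in> A"
  using assms(2)
proof (induction n)
  case 0
  then show ?case using closed_subspaceD(4)[OF assms(1)] by simp
next
  case (Suc n)
  have "(\<lambda>z. of_real (c n) * f n z + (\<Sum>i<n. c i *\<^sub>R f i z), \<lambda>z. of_real (c n) * g n z + (\<Sum>i<n. c i *\<^sub>R g i z)) \<in> A"
    using Suc by (intro closed_subspaceD(3)[OF assms(1)]) auto
  then show ?case unfolding sum.lessThan_Suc by (simp only: scaleR_conv_of_real add.commute)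
qed

section \<open>Riemann sums of Lipschitz curves\<close>

abbreviation half_line :: "real measure" where
  "half_line \<equiv> restrict_space lborel {0<..}"

text \<open>Only compact subintervals of the open half line count: the curves to be integrated carry
  powers of t that may blow up at 0.\<close>

definition locally_Lipschitz_Lp where
  "locally_Lipschitz_Lp M p Y \<longleftrightarrow>
     (\<forall>a b::real. 0 < a \<longrightarrow> a \<le> b \<longrightarrow>
        (\<exists>L\<ge>0. \<forall>s\<in>{a..b}. \<forall>t\<in>{a..b}. Lp_le M p (\<lambda>z. Y s z - Y t z) (L * \<bar>s - t\<bar>)))"

text \<open>\<open>n\<close> fixes the window \<open>step_range n\<close>, which exhausts the half
  line, and \<open>m\<close> the mesh 1 / m inside it. They are separate because the mesh is chosen
  after the window, according to the Lipschitz constant there. Curves are sampled at the left end of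
  each cell.\<close>

definition grid :: "nat \<Rightarrow> nat \<Rightarrow> nat \<Rightarrow> real" where
  "grid n m i = 1 / real (Suc n) + real i / real m"

definition cell :: "nat \<Rightarrow> nat \<Rightarrow> nat \<Rightarrow> real set" where
  "cell n m i = {grid n m i ..< grid n m (Suc i)}"

definition step_curve :: "(real \<Rightarrow> 'a \<Rightarrow> complex) \<Rightarrow> nat \<Rightarrow> nat \<Rightarrow> real \<Rightarrow> 'a \<Rightarrow> complex" where
  "step_curve Y n m t z = (\<Sum>i<Suc n * m. indicator (cell n m i) t *\<^sub>R Y (grid n m i) z)"

definition step_range :: "nat \<Rightarrow> real set" where
  "step_range n = {1 / real (Suc n) ..< 1 / real (Suc n) + real (Suc n)}"

text \<open>Over the window, of length n + 1, the value 1 / (n + 1)^2 integrates to 1 / (n + 1).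
  Outside it the step curve is 0, and the error is bounded by \<eta> itself.\<close>

definition step_err :: "(real \<Rightarrow> real) \<Rightarrow> nat \<Rightarrow> real \<Rightarrow> real" where
  "step_err \<eta> n t = (if t \<in> step_range n then 1 / (real (Suc n))\<^sup>2 else \<eta> t)"

abbreviation riemann_sum :: "(real \<Rightarrow> 'a \<Rightarrow> complex) \<Rightarrow> nat \<Rightarrow> nat \<Rightarrow> 'a \<Rightarrow> complex" where
  "riemann_sum Y n m z \<equiv> \<Sum>i<Suc n * m. (1 / real m) *\<^sub>R Y (grid n m i) z"

abbreviation err_mass :: "(real \<Rightarrow> real) \<Rightarrow> nat \<Rightarrow> real" where
  "err_mass \<eta> n \<equiv> enn2real (\<integral>\<^sup>+t. ennreal (step_err \<eta> n t) \<partial>half_line)"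

section \<open>Step curves and their errors\<close>

lemma grid_pos: "0 < grid n m i"
  unfolding grid_def by (intro add_pos_nonneg) auto

lemma cell_pos: "t \<in> cell n m i \<Longrightarrow> 0 < t"
  using grid_pos[of n m i] by (auto simp: cell_def)

lemma step_curve_inside:
  assumes t: "t \<in> step_range n" and m: "0 < m"
  obtains i where "grid n m i \<in> {1 / real (Suc n) .. 1 / real (Suc n) + real (Suc n)}"
    "\<bar>t - grid n m i\<bar> \<le> 1 / real m" "\<And>Y z. step_curve Y n m t z = Y (grid n m i) z"
proof -
  \<comment> \<open>The position of t in units of the mesh; its integer part is the index of the
    only cell that contains t.\<close>
  define x where "x = (t - 1 / real (Suc n)) * real m"
  define i where "i = nat \<lfloor>x\<rfloor>"
  have x: "0 \<le> x" "x < real (Suc n * m)"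
  proof -
    have "0 \<le> t - 1 / real (Suc n)" "t - 1 / real (Suc n) < real (Suc n)"
      using t by (auto simp: step_range_def simp del: of_nat_Suc)
    then show "0 \<le> x" "x < real (Suc n * m)"
      using m unfolding x_def of_nat_mult by (auto intro!: mult_strict_right_mono simp del: of_nat_Suc)
  qed
  have i: "real i \<le> x" "x < real i + 1" "i < Suc n * m"
    using x unfolding i_def by (auto simp: nat_less_iff floor_less_iff simp del: of_nat_Suc mult_Suc)
  have teq: "t = 1 / real (Suc n) + x / real m" using m by (simp add: x_def)
  have cell: "t \<in> cell n m j \<longleftrightarrow> j = i" for j
  proof -
    have "t \<in> cell n m j \<longleftrightarrow> real j \<le> x \<and> x < real j + 1"
      using m by (auto simp: cell_def grid_def teq divide_le_cancel divide_less_cancel add.commute)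
    also have "\<dots> \<longleftrightarrow> j = i" using i by auto
    finally show ?thesis .
  qed
  show thesis
  proof
    have "real i \<le> real (Suc n) * real m" using i(3) by (metis less_imp_le of_nat_le_iff of_nat_mult)
    then show "grid n m i \<in> {1 / real (Suc n) .. 1 / real (Suc n) + real (Suc n)}"
      using m by (auto simp: grid_def divide_le_eq simp del: of_nat_Suc)
    have "t - grid n m i = (x - real i) / real m" by (simp add: teq grid_def diff_divide_distrib)
    then show "\<bar>t - grid n m i\<bar> \<le> 1 / real m" using i m by (simp add: divide_right_mono)
    fix Y :: "real \<Rightarrow> 'b \<Rightarrow> complex" and z
    have "step_curve Y n m t z = (\<Sum>j<Suc n * m. if j = i then Y (grid n m j) z else 0)"
      unfolding step_curve_def by (intro sum.cong) (auto simp: cell indicator_def)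
    then show "step_curve Y n m t z = Y (grid n m i) z" using i(3) by (simp del: mult_Suc)
  qed
qed

lemma step_curve_outside:
  assumes "t \<notin> step_range n" "0 < m"
  shows "step_curve Y n m t z = 0"
proof -
  have "t \<notin> cell n m i" if "i < Suc n * m" for i
  proof
    assume "t \<in> cell n m i"
    then have "1 / real (Suc n) \<le> t" "t < 1 / real (Suc n) + real (Suc i) / real m"
      by (auto simp: cell_def grid_def simp del: of_nat_Suc intro: order_trans[rotated])
    moreover have "real (Suc i) \<le> real (Suc n) * real m"
      using that by (metis Suc_leI of_nat_le_iff of_nat_mult)
    then have "real (Suc i) / real m \<le> real (Suc n)" using assms(2) by (simp add: divide_le_eq del: of_nat_Suc)
    ultimately show False using assms(1) by (auto simp: step_range_def simp del: of_nat_Suc)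
  qed
  then show ?thesis by (simp add: step_curve_def)
qed

lemma step_curve_error:
  assumes lip: "locally_Lipschitz_Lp M p Y" and le: "\<And>t. 0 < t \<Longrightarrow> Lp_le M p (Y t) (\<eta> t)" and p: "1 \<le> p"
  obtains m0 where "0 < m0"
    "\<And>m t. m0 \<le> m \<Longrightarrow> 0 < t \<Longrightarrow> Lp_le M p (\<lambda>z. Y t z - step_curve Y n m t z) (step_err \<eta> n t)"
proof -
  obtain L where L: "0 \<le> L" "\<And>s t. s \<in> {1 / real (Suc n) .. 1 / real (Suc n) + real (Suc n)} \<Longrightarrow>
      t \<in> {1 / real (Suc n) .. 1 / real (Suc n) + real (Suc n)} \<Longrightarrow> Lp_le M p (\<lambda>z. Y s z - Y t z) (L * \<bar>s - t\<bar>)"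
    using lip[unfolded locally_Lipschitz_Lp_def, rule_format, of "1 / real (Suc n)" "1 / real (Suc n) + real (Suc n)"]
    by auto
  \<comment> \<open>Makes L / m \<le> 1 / (n + 1)^2 for all m \<ge> \<open>m0\<close>, and keeps
    \<open>m0\<close> positive even if L = 0.\<close>
  define m0 where "m0 = Suc (nat \<lceil>L * (real (Suc n))\<^sup>2\<rceil>)"
  show thesis
  proof
    show "0 < m0" by (simp add: m0_def)
    fix m :: nat and t :: real assume m: "m0 \<le> m" and t: "0 < t"
    have m': "0 < m" "L * (real (Suc n))\<^sup>2 \<le> real m" using m unfolding m0_def by linarith+
    show "Lp_le M p (\<lambda>z. Y t z - step_curve Y n m t z) (step_err \<eta> n t)"
    proof (cases "t \<in> step_range n")
      case True
      obtain i where i: "grid n m i \<in> {1 / real (Suc n) .. 1 / real (Suc n) + real (Suc n)}"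
        "\<bar>t - grid n m i\<bar> \<le> 1 / real m" "\<And>Y z. step_curve Y n m t z = Y (grid n m i) (z::'a)"
        using step_curve_inside[OF True m'(1)] by metis
      have "L * \<bar>t - grid n m i\<bar> \<le> L * (1 / real m)" using L(1) i(2) by (intro mult_left_mono)
      also have "\<dots> \<le> 1 / (real (Suc n))\<^sup>2" using m' by (simp add: field_simps del: of_nat_Suc)
      finally show ?thesis
        using Lp_le_mono[OF L(2)[of t "grid n m i"]] i True p by (auto simp: step_err_def step_range_def simp del: of_nat_Suc)
    next
      case False
      then show ?thesis using le[OF t] by (simp add: step_err_def step_curve_outside[OF False m'(1)])
    qed
  qed
qed

lemma sigma_finite_half_line: "sigma_finite_measure half_line"
  by (rule sigma_finite_measure_restrict_space) (auto simp: lborel.sigma_finite_measure_axioms)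

lemma step_range_measurable [measurable]: "step_range n \<in> sets borel"
  by (simp add: step_range_def)

lemma measurable_half_line: "f \<in> borel_measurable borel \<Longrightarrow> f \<in> borel_measurable half_line"
  by (intro measurable_restrict_space1) simp

lemma step_err_measurable: "\<eta> \<in> borel_measurable borel \<Longrightarrow> step_err \<eta> n \<in> borel_measurable half_line"
  unfolding step_err_def by (intro measurable_half_line measurable_If_set) auto

text \<open>Every t > 0 eventually lies in the window, so the part outside is handled by dominated
  convergence with majorant \<eta>; the window itself contributes at most 1 / (n + 1).\<close>

lemma step_err_tendsto:
  assumes [measurable]: "\<eta> \<in> borel_measurable borel" and fin: "(\<integral>\<^sup>+t. ennreal (\<eta> t) \<partial>half_line) < \<infinity>"
  shows "(\<lambda>n. \<integral>\<^sup>+t. ennreal (step_err \<eta> n t) \<partial>half_line) \<longlonglongrightarrow> 0"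
    and "(\<integral>\<^sup>+t. ennreal (step_err \<eta> n t) \<partial>half_line) < \<infinity>"
proof -
  define f where "f n t = ennreal (\<eta> t) * indicator (- step_range n) t" for n t
  have fm[measurable]: "f n \<in> borel_measurable half_line" for n
    unfolding f_def by (intro measurable_half_line) measurable
  have [measurable]: "(\<lambda>t. ennreal (\<eta> t)) \<in> borel_measurable half_line"
    by (intro measurable_half_line) measurable
  have lim: "(\<lambda>n. \<integral>\<^sup>+t. f n t \<partial>half_line) \<longlonglongrightarrow> (\<integral>\<^sup>+t. 0 \<partial>half_line)"
  proof (rule nn_integral_dominated_convergence[where w = "\<lambda>t. ennreal (\<eta> t)"])
    show "AE t in half_line. (\<lambda>n. f n t) \<longlonglongrightarrow> 0"
    proof (rule AE_I2)
      fix t assume "t \<in> space half_line"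
      then have t: "0 < t" by (simp add: space_restrict_space)
      have "eventually (\<lambda>n. 1 / real (Suc n) < t) sequentially"
        using order_tendstoD(2)[OF LIMSEQ_inverse_real_of_nat t] by (simp add: inverse_eq_divide)
      moreover have "eventually (\<lambda>n. t < real n) sequentially"
        using filterlim_real_sequentially by (auto simp: filterlim_at_top_dense)
      ultimately have "eventually (\<lambda>n. f n t = 0) sequentially"
      proof eventually_elim
        case (elim n)
        moreover have "0 < 1 / real (Suc n)" by simp
        ultimately have "t < 1 / real (Suc n) + real (Suc n)" by linarith
        then have "t \<in> step_range n" using elim by (auto simp: step_range_def)
        then show ?case by (simp add: f_def)
      qed
      then show "(\<lambda>n. f n t) \<longlonglongrightarrow> 0" by (rule tendsto_eventually)
    qed
  next
    show "AE t in half_line. f n t \<le> ennreal (\<eta> t)" for n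
      by (auto simp: f_def indicator_def)
  qed (use fin in measurable)
  have le: "(\<integral>\<^sup>+t. ennreal (step_err \<eta> n t) \<partial>half_line) \<le> ennreal (1 / real (Suc n)) + (\<integral>\<^sup>+t. f n t \<partial>half_line)" for n
  proof -
    have "(\<integral>\<^sup>+t. ennreal (step_err \<eta> n t) \<partial>half_line)
       = (\<integral>\<^sup>+t. ennreal (1 / (real (Suc n))\<^sup>2) * indicator (step_range n) t + f n t \<partial>half_line)"
      by (intro nn_integral_cong) (auto simp: step_err_def f_def)
    also have "\<dots> = (\<integral>\<^sup>+t. ennreal (1 / (real (Suc n))\<^sup>2) * indicator (step_range n) t \<partial>half_line) + (\<integral>\<^sup>+t. f n t \<partial>half_line)"
      by (rule nn_integral_add[OF _ fm]) (intro measurable_half_line, measurable)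
    also have "(\<integral>\<^sup>+t. ennreal (1 / (real (Suc n))\<^sup>2) * indicator (step_range n) t \<partial>half_line)
       \<le> (\<integral>\<^sup>+t. ennreal (1 / (real (Suc n))\<^sup>2) * indicator (step_range n) t \<partial>lborel)"
      by (subst nn_integral_restrict_space) (auto simp: indicator_def intro!: nn_integral_mono)
    also have "\<dots> = ennreal (1 / (real (Suc n))\<^sup>2) * ennreal (real (Suc n))"
      by (subst nn_integral_cmult_indicator) (auto simp: step_range_def)
    also have "\<dots> = ennreal (1 / real (Suc n))"
      by (simp add: ennreal_mult[symmetric] power2_eq_square del: of_nat_Suc)
    finally show ?thesis by (simp add: add_right_mono)
  qed
  have "(\<lambda>n. ennreal (1 / real (Suc n)) + (\<integral>\<^sup>+t. f n t \<partial>half_line)) \<longlonglongrightarrow> ennreal 0 + 0"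
    using lim LIMSEQ_inverse_real_of_nat
    by (intro tendsto_add tendsto_ennrealI) (auto simp: inverse_eq_divide)
  then have lim0: "(\<lambda>n. ennreal (1 / real (Suc n)) + (\<integral>\<^sup>+t. f n t \<partial>half_line)) \<longlonglongrightarrow> 0"
    by (simp only: ennreal_0 add_0)
  show "(\<lambda>n. \<integral>\<^sup>+t. ennreal (step_err \<eta> n t) \<partial>half_line) \<longlonglongrightarrow> 0"
    by (rule tendsto_sandwich[OF _ _ tendsto_const lim0])
      (simp, rule always_eventually, rule allI, rule le)
  have "(\<integral>\<^sup>+t. f n t \<partial>half_line) \<le> (\<integral>\<^sup>+t. ennreal (\<eta> t) \<partial>half_line)"
    by (intro nn_integral_mono) (auto simp: f_def indicator_def)
  also note fin
  finally show "(\<integral>\<^sup>+t. ennreal (step_err \<eta> n t) \<partial>half_line) < \<infinity>"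
    by (intro le_less_trans[OF le]) simp
qed

lemma cell_measure:
  assumes "0 < m"
  shows "cell n m i \<in> sets half_line" "emeasure half_line (cell n m i) = ennreal (1 / real m)"
proof -
  have sub: "cell n m i \<subseteq> {0<..}" using cell_pos by auto
  show "cell n m i \<in> sets half_line" using sub by (subst sets_restrict_space_iff) (auto simp: cell_def)
  have "emeasure half_line (cell n m i) = emeasure lborel (cell n m i)"
    using sub by (intro emeasure_restrict_space) auto
  also have "\<dots> = emeasure lborel {grid n m i ..< grid n m i + 1 / real m}"
    by (simp add: cell_def grid_def add_divide_distrib ac_simps)
  also have "\<dots> = ennreal (1 / real m)" by simp
  finally show "emeasure half_line (cell n m i) = ennreal (1 / real m)" .
qed

lemma step_curve_has_integral:
  assumes "0 < m"
  shows "has_bochner_integral half_line (\<lambda>t. step_curve Y n m t z) (riemann_sum Y n m z)"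
  unfolding step_curve_def
proof (intro has_bochner_integral_sum)
  fix i
  have "has_bochner_integral half_line (\<lambda>t. indicator (cell n m i) t :: real) (measure half_line (cell n m i))"
    using cell_measure[OF assms, of n i] by (intro has_bochner_integral_real_indicator) auto
  then show "has_bochner_integral half_line (\<lambda>t. indicator (cell n m i) t *\<^sub>R Y (grid n m i) z) ((1 / real m) *\<^sub>R Y (grid n m i) z)"
    using cell_measure[OF assms, of n i] by (intro has_bochner_integral_scaleR_left) (simp add: measure_def)
qed

lemma step_curve_measurable:
  assumes Y: "(\<lambda>(t, z). Y t z) \<in> borel_measurable (half_line \<Otimes>\<^sub>M M)"
  shows "(\<lambda>(t, z). step_curve Y n m t z) \<in> borel_measurable (half_line \<Otimes>\<^sub>M M)"
proof -
  have [measurable]: "Y (grid n m i) \<in> borel_measurable M" for i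
    using measurable_compose[OF measurable_Pair1' Y, of "grid n m i"] grid_pos by (simp add: space_restrict_space)
  have [measurable]: "(\<lambda>t. indicator (cell n m i) t :: real) \<in> borel_measurable half_line" for i
    by (intro measurable_half_line) (auto simp: cell_def)
  show ?thesis unfolding step_curve_def by measurable
qed

text \<open>Minkowski's integral inequality for the difference of the curve and its step curve,
  whose integral is exactly the Riemann sum. Splitting the integral of the difference needs t
  \<mapsto> Y t z integrable, which holds for almost every z.\<close>

lemma Lp_le_step_integral:
  assumes M: "sigma_finite_measure M" and p: "1 \<le> p" and m: "0 < m"
    and Y[measurable]: "(\<lambda>(t, z). Y t z) \<in> borel_measurable (half_line \<Otimes>\<^sub>M M)"
    and le: "\<And>t. 0 < t \<Longrightarrow> Lp_le M p (Y t) (\<eta> t)"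
    and \<eta>[measurable]: "\<eta> \<in> borel_measurable borel" and fin: "(\<integral>\<^sup>+t. ennreal (\<eta> t) \<partial>half_line) < \<infinity>"
    and err: "\<And>t. 0 < t \<Longrightarrow> Lp_le M p (\<lambda>z. Y t z - step_curve Y n m t z) (step_err \<eta> n t)"
  shows "Lp_le M p (\<lambda>z. riemann_sum Y n m z - (\<integral>t. Y t z \<partial>half_line)) (err_mass \<eta> n)"
proof -
  note [measurable] = step_curve_measurable[OF Y]
  have sp: "t \<in> space half_line \<longleftrightarrow> 0 < t" for t by (simp add: space_restrict_space)
  have [measurable]: "Y (grid n m i) \<in> borel_measurable M" for i
    using le[OF grid_pos] by (rule Lp_le_measurable)
  have [measurable]: "(\<lambda>(z, t). Y t z) \<in> borel_measurable (M \<Otimes>\<^sub>M half_line)"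
    using measurable_compose[OF measurable_pair_swap' Y] by (simp add: split_beta' comp_def)
  have [measurable]: "(\<lambda>z. \<integral>t. Y t z \<partial>half_line) \<in> borel_measurable M"
    using sigma_finite_measure.borel_measurable_lebesgue_integral[OF sigma_finite_half_line] by measurable
  have 1: "Lp_le M p (\<lambda>z. \<integral>t. (Y t z - step_curve Y n m t z) \<partial>half_line) (err_mass \<eta> n)"
    using step_err_tendsto(2)[OF \<eta> fin, of n]
    by (intro Lp_le_integral(2)[where \<eta> = "step_err \<eta> n", OF sigma_finite_half_line M _ _ _ _ _ p])
       (auto simp: sp intro!: err step_err_measurable)
  have 2: "AE z in M. integrable half_line (\<lambda>t. Y t z)"
    using fin by (intro Lp_le_integral(1)[where \<eta> = \<eta> and C = "enn2real (\<integral>\<^sup>+t. ennreal (\<eta> t) \<partial>half_line)", OF sigma_finite_half_line M Y _ _ _ _ p])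
       (auto simp: sp intro!: le measurable_half_line)
  have 3: "AE z in M. norm ((\<integral>t. Y t z \<partial>half_line) - riemann_sum Y n m z)
       \<le> norm (\<integral>t. (Y t z - step_curve Y n m t z) \<partial>half_line)"
    using 2
  proof eventually_elim
    case (elim z)
    have "integrable half_line (\<lambda>t. step_curve Y n m t z)"
      "(\<integral>t. step_curve Y n m t z \<partial>half_line) = riemann_sum Y n m z"
      using step_curve_has_integral[OF m, of Y n z] by (auto simp: has_bochner_integral_iff simp del: sum.lessThan_Suc mult_Suc)
    then show ?case by (simp only: Bochner_Integration.integral_diff[OF elim] order_refl)
  qed
  have "Lp_le M p (\<lambda>z. (\<integral>t. Y t z \<partial>half_line) - riemann_sum Y n m z) (err_mass \<eta> n)"
    by (rule Lp_le_mono_AE[OF 1 _ 3 order_refl]) (measurable, use p in linarith)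
  then show ?thesis by (rule Lp_le_minus_commute) (use p in simp)
qed

text \<open>Conditions under which integration in t for each z yields the L^p-valued integral: the
  Lipschitz bound serves the approximation by step curves, the integrable majorant \<eta> controls
  both ends of the half line.\<close>

definition Lp_curve where
  "Lp_curve M p Y \<eta> \<longleftrightarrow> (\<lambda>(t, z). Y t z) \<in> borel_measurable (half_line \<Otimes>\<^sub>M M) \<and>
     locally_Lipschitz_Lp M p Y \<and> (\<forall>t>0. Lp_le M p (Y t) (\<eta> t)) \<and>
     \<eta> \<in> borel_measurable borel \<and> (\<integral>\<^sup>+t. ennreal (\<eta> t) \<partial>half_line) < \<infinity>"

text \<open>The bounds hold for every sufficiently fine mesh, so that two curves can be sampled on
  one common grid.\<close>

lemma Lp_curve_steps:
  assumes M: "sigma_finite_measure M" and p: "1 \<le> p" and Y: "Lp_curve M p Y \<eta>"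
  shows "\<exists>m0>0. \<forall>m\<ge>m0.
    (\<forall>t>0. Lp_le M p (\<lambda>z. Y t z - step_curve Y n m t z) (step_err \<eta> n t)) \<and>
    Lp_le M p (\<lambda>z. riemann_sum Y n m z - (\<integral>t. Y t z \<partial>half_line)) (err_mass \<eta> n)"
proof -
  have Y': "(\<lambda>(t, z). Y t z) \<in> borel_measurable (half_line \<Otimes>\<^sub>M M)" "locally_Lipschitz_Lp M p Y"
    "\<And>t. t > 0 \<Longrightarrow> Lp_le M p (Y t) (\<eta> t)" "\<eta> \<in> borel_measurable borel" "(\<integral>\<^sup>+t. ennreal (\<eta> t) \<partial>half_line) < \<infinity>"
    using Y unfolding Lp_curve_def by auto
  obtain m0 where m0: "0 < m0"
    "\<And>m t. m0 \<le> m \<Longrightarrow> 0 < t \<Longrightarrow> Lp_le M p (\<lambda>z. Y t z - step_curve Y n m t z) (step_err \<eta> n t)"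
    using step_curve_error[OF Y'(2,3) p, of n] by blast
  show ?thesis
  proof (intro exI[of _ m0] conjI allI impI m0)
    fix m assume m: "m0 \<le> m"
    show "Lp_le M p (\<lambda>z. riemann_sum Y n m z - (\<integral>t. Y t z \<partial>half_line)) (err_mass \<eta> n)"
    proof (rule Lp_le_step_integral[OF M p _ Y'(1,3,4,5)])
      show "0 < m" using m0(1) m by simp
      show "Lp_le M p (\<lambda>z. Y t z - step_curve Y n m t z) (step_err \<eta> n t)" if "0 < t" for t
        using m0(2)[OF m that] .
    qed
  qed
qed

lemma Lp_curve_err_tendsto:
  assumes "Lp_curve M p Y \<eta>"
  shows "(\<lambda>n. err_mass \<eta> n) \<longlonglongrightarrow> 0"
proof -
  have \<eta>: "\<eta> \<in> borel_measurable borel" "(\<integral>\<^sup>+t. ennreal (\<eta> t) \<partial>half_line) < \<infinity>"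
    using assms by (auto simp: Lp_curve_def)
  show ?thesis by (rule tendsto_enn2real) (use step_err_tendsto(1)[OF \<eta>] in \<open>simp_all add: ennreal_0\<close>)
qed

text \<open>A closed operator passes under the integral sign: Riemann sums of both curves on the
  same grid form pairs in \<open>A\<close>, and they approximate the two integrals
  simultaneously.\<close>

lemma closed_subspace_integral:
  assumes M: "sigma_finite_measure M" and p: "1 \<le> p" and A: "closed_subspace M p A"
    and Y: "Lp_curve M p Y \<eta>" and Z: "Lp_curve M p Z \<zeta>"
    and YZ: "\<And>t. 0 < t \<Longrightarrow> (Y t, Z t) \<in> A"
  shows "(\<lambda>z. \<integral>t. Y t z \<partial>half_line, \<lambda>z. \<integral>t. Z t z \<partial>half_line) \<in> A"
proof (rule closed_subspaceD(5)[OF A])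
  fix e :: real assume e: "e > 0"
  have "eventually (\<lambda>n. err_mass \<eta> n < e \<and>
      err_mass \<zeta> n < e) sequentially"
    using order_tendstoD(2)[OF Lp_curve_err_tendsto[OF Y] e] order_tendstoD(2)[OF Lp_curve_err_tendsto[OF Z] e]
    by eventually_elim auto
  then obtain n where n: "err_mass \<eta> n < e"
      "err_mass \<zeta> n < e"
    by (auto simp: eventually_sequentially)
  obtain m1 where m1: "\<And>m. m1 \<le> m \<Longrightarrow> Lp_le M p (\<lambda>z. riemann_sum Y n m z - (\<integral>t. Y t z \<partial>half_line)) (err_mass \<eta> n)"
    using Lp_curve_steps[OF M p Y, of n] by blast
  obtain m2 where m2: "\<And>m. m2 \<le> m \<Longrightarrow> Lp_le M p (\<lambda>z. riemann_sum Z n m z - (\<integral>t. Z t z \<partial>half_line)) (err_mass \<zeta> n)"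
    using Lp_curve_steps[OF M p Z, of n] by blast
  define m where "m = max m1 m2"
  let ?y = "\<lambda>z. \<Sum>i<Suc n * m. (1 / real m) *\<^sub>R Y (grid n m i) z"
  let ?z = "\<lambda>z. \<Sum>i<Suc n * m. (1 / real m) *\<^sub>R Z (grid n m i) z"
  have "(?y, ?z) \<in> A"
    by (rule closed_subspace_sum[OF A]) (rule YZ[OF grid_pos])
  moreover have "Lp_le M p (\<lambda>z. ?y z - (\<integral>t. Y t z \<partial>half_line)) e"
    by (rule Lp_le_mono[OF m1 less_imp_le[OF n(1)]]) (use p in \<open>simp_all add: m_def\<close>)
  moreover have "Lp_le M p (\<lambda>z. ?z z - (\<integral>t. Z t z \<partial>half_line)) e"
    by (rule Lp_le_mono[OF m2 less_imp_le[OF n(2)]]) (use p in \<open>simp_all add: m_def\<close>)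
  ultimately show "\<exists>(u, v)\<in>A. Lp_le M p (\<lambda>z. u z - (\<integral>t. Y t z \<partial>half_line)) e \<and> Lp_le M p (\<lambda>z. v z - (\<integral>t. Z t z \<partial>half_line)) e"
    by (intro bexI[of _ "(?y, ?z)"]) (simp_all only: prod.case simp_thms)
qed

text \<open>The simple functions asked for are the step curves, with a mesh picked for each window.
  Joint measurability of \<open>Y\<close> makes the norms of the errors measurable in t.\<close>

lemma Lp_curve_has_Lp_integral:
  assumes M: "sigma_finite_measure M" and p: "1 \<le> p" and Y: "Lp_curve M p Y \<eta>"
  shows "has_Lp_integral half_line M p Y (\<lambda>z. \<integral>t. Y t z \<partial>half_line)"
proof -
  have Y': "(\<lambda>(t, z). Y t z) \<in> borel_measurable (half_line \<Otimes>\<^sub>M M)" "locally_Lipschitz_Lp M p Y"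
    "\<And>t. t > 0 \<Longrightarrow> Lp_le M p (Y t) (\<eta> t)" "\<eta> \<in> borel_measurable borel" "(\<integral>\<^sup>+t. ennreal (\<eta> t) \<partial>half_line) < \<infinity>"
    using Y unfolding Lp_curve_def by auto
  note [measurable] = Y'(1)
  have p0: "0 < p" using p by simp
  have "\<exists>m>0. (\<forall>t>0. Lp_le M p (\<lambda>z. Y t z - step_curve Y n m t z) (step_err \<eta> n t)) \<and>
    Lp_le M p (\<lambda>z. riemann_sum Y n m z - (\<integral>t. Y t z \<partial>half_line)) (err_mass \<eta> n)" (is "\<exists>m>0. ?P n m") for n
    using Lp_curve_steps[OF M p Y, of n] by blast
  then have "\<exists>m. \<forall>n. 0 < m n \<and> ?P n (m n)" by (intro choice allI) blast
  then obtain m where m: "\<And>n. 0 < m n" "\<And>n t. 0 < t \<Longrightarrow> Lp_le M p (\<lambda>z. Y t z - step_curve Y n (m n) t z) (step_err \<eta> n t)"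
    "\<And>n. Lp_le M p (\<lambda>z. riemann_sum Y n (m n) z - (\<integral>t. Y t z \<partial>half_line)) (err_mass \<eta> n)"
    by blast
  have YL: "Y t \<in> Lp M p" if "0 < t" for t using Y'(3)[OF that] by (rule Lp_le_imp_Lp)
  define E where "E = (\<lambda>n. cell n (m n))"
  define y where "y = (\<lambda>n i. Y (grid n (m n) i))"
  define k where "k = (\<lambda>n. Suc n * m n)"
  have sc: "step_curve Y n (m n) t z = (\<Sum>i<k n. indicator (E n i) t *\<^sub>R y n i z)" for n t z
    by (simp add: step_curve_def E_def y_def k_def)
  have ms: "measure half_line (E n i) = 1 / real (m n)" for n i
    using cell_measure(2)[OF m(1)[of n], of n i] by (simp add: E_def measure_def)
  have R1: "(\<lambda>n. \<integral>\<^sup>+t. ennreal (Lp_norm M p (\<lambda>z. Y t z - step_curve Y n (m n) t z)) \<partial>half_line) \<longlonglongrightarrow> 0"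
  proof (rule tendsto_sandwich[OF _ _ tendsto_const step_err_tendsto(1)[OF Y'(4,5)]])
    show "\<forall>\<^sub>F n in sequentially. (\<integral>\<^sup>+t. ennreal (Lp_norm M p (\<lambda>z. Y t z - step_curve Y n (m n) t z)) \<partial>half_line)
       \<le> (\<integral>\<^sup>+t. ennreal (step_err \<eta> n t) \<partial>half_line)"
      using m(2) p0
      by (intro always_eventually allI nn_integral_mono ennreal_leI Lp_norm_le) (auto simp: space_restrict_space)
  qed simp
  have R2: "(\<lambda>t. Lp_norm M p (\<lambda>z. Y t z - step_curve Y n (m n) t z)) \<in> borel_measurable half_line" for n
  proof -
    note [measurable] = step_curve_measurable[OF Y'(1)]
    have "(\<lambda>t. \<integral>z. norm (Y t z - step_curve Y n (m n) t z) powr p \<partial>M) \<in> borel_measurable half_line"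
      by (rule sigma_finite_measure.borel_measurable_lebesgue_integral[OF M]) measurable
    then show ?thesis unfolding Lp_norm_def by measurable
  qed
  have R3: "Lp_tendsto M p (\<lambda>n z. \<Sum>i<k n. measure half_line (E n i) *\<^sub>R y n i z) (\<lambda>z. \<integral>t. Y t z \<partial>half_line)"
    unfolding Lp_tendsto_def
  proof (intro conjI allI)
    have sumL: "(\<lambda>z. \<Sum>i<j. measure half_line (E n i) *\<^sub>R y n i z) \<in> Lp M p" for n j
    proof (induction j)
      case 0
      then show ?case using Lp_le_imp_Lp[OF Lp_le_zero] by simp
    next
      case (Suc j)
      obtain C where "Lp_le M p (\<lambda>z. \<Sum>i<j. measure half_line (E n i) *\<^sub>R y n i z) C" using Suc p0 Lp_iff_Lp_le by blast
      from Lp_le_imp_Lp[OF Lp_le_add[OF this Lp_le_scaleR[OF Y'(3)[OF grid_pos] p0, of "measure half_line (E n j)" n "m n" j] p]]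
      show ?case by (simp add: y_def)
    qed
    then show "(\<lambda>z. \<Sum>i<k n. measure half_line (E n i) *\<^sub>R y n i z) \<in> Lp M p" for n .
    have m3: "Lp_le M p (\<lambda>z. (\<Sum>i<k n. measure half_line (E n i) *\<^sub>R y n i z) - (\<integral>t. Y t z \<partial>half_line)) (err_mass \<eta> n)" for n
      using m(3)[of n] by (simp add: ms k_def y_def del: mult_Suc)
    show "(\<lambda>z. \<integral>t. Y t z \<partial>half_line) \<in> Lp M p"
      using Lp_diff_cancel[OF sumL m3 p] .
    show "(\<lambda>n. Lp_norm M p (\<lambda>z. (\<Sum>i<k n. measure half_line (E n i) *\<^sub>R y n i z) - (\<integral>t. Y t z \<partial>half_line))) \<longlonglongrightarrow> 0"
      using Lp_norm_le[OF m3 p0]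
      by (intro tendsto_sandwich[OF _ _ tendsto_const Lp_curve_err_tendsto[OF Y]]) (auto simp: Lp_norm_nonneg)
  qed
  show ?thesis
    unfolding has_Lp_integral_def Let_def
  proof (intro conjI exI[of _ k] exI[of _ E] exI[of _ y] allI impI ballI)
    show "Y t \<in> Lp M p" if "t \<in> space half_line" for t
      using that by (intro YL) (simp add: space_restrict_space)
    show "E n i \<in> sets half_line" "emeasure half_line (E n i) < \<infinity>" "y n i \<in> Lp M p" for n i
      using cell_measure[OF m(1)[of n], of n i] YL[OF grid_pos] by (auto simp: E_def y_def)
    show "(\<lambda>t. Lp_norm M p (\<lambda>z. Y t z - (\<Sum>i<k n. indicator (E n i) t *\<^sub>R y n i z))) \<in> borel_measurable half_line" for n
      using R2[of n] unfolding sc .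
    show "(\<lambda>n. \<integral>\<^sup>+t. ennreal (Lp_norm M p (\<lambda>z. Y t z - (\<Sum>i<k n. indicator (E n i) t *\<^sub>R y n i z))) \<partial>half_line) \<longlonglongrightarrow> 0"
      using R1 unfolding sc .
  qed (rule R3)
qed

section \<open>Smooth functions\<close>

lemma times_cont_diff_on_cong:
  assumes "open S" "\<And>z. z \<in> S \<Longrightarrow> f z = g z" "times_cont_diff_on n S f"
  shows "times_cont_diff_on n S g"
  using assms(2,3)
proof (induction n arbitrary: f g)
  case 0
  then show ?case by (simp cong: continuous_on_cong)
next
  case (Suc n)
  have d: "g differentiable (at z)" "frechet_derivative f (at z) = frechet_derivative g (at z)" if z: "z \<in> S" for z
  proof -
    have fd: "f differentiable (at z)" using Suc.prems(2) z by simp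
    then obtain D where "(f has_derivative D) (at z)" by (auto simp: differentiable_def)
    then have "(g has_derivative D) (at z)"
      by (rule has_derivative_transform_within_open[OF _ assms(1) z]) (simp add: Suc.prems(1))
    then show "g differentiable (at z)" by (auto simp: differentiable_def)
    show "frechet_derivative f (at z) = frechet_derivative g (at z)"
      by (rule frechet_derivative_transform_within_open[OF fd assms(1) z]) (rule Suc.prems(1))
  qed
  have "times_cont_diff_on n S (\<lambda>z. frechet_derivative g (at z) v)" for v
    by (rule Suc.IH[of "\<lambda>z. frechet_derivative f (at z) v"]) (use d Suc.prems(2) in auto)
  then show ?case using d(1) by simp
qed

lemma times_cont_diff_on_SucI:
  assumes S: "open S" and f: "\<And>z. z \<in> S \<Longrightarrow> (f has_derivative f' z) (at z)"
    and f': "\<And>v. times_cont_diff_on n S (\<lambda>z. f' z v)"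
  shows "times_cont_diff_on (Suc n) S f"
proof -
  have "frechet_derivative f (at z) = f' z" if "z \<in> S" for z
    using frechet_derivative_at[OF f[OF that]] by simp
  then have "times_cont_diff_on n S (\<lambda>z. frechet_derivative f (at z) v)" for v
    by (intro times_cont_diff_on_cong[OF S _ f'[of v]]) simp
  then show ?thesis using f by (auto simp: differentiable_def)
qed

lemma times_cont_diff_on_has_derivative:
  "times_cont_diff_on (Suc n) S f \<Longrightarrow> z \<in> S \<Longrightarrow> (f has_derivative frechet_derivative f (at z)) (at z)"
  by (simp add: frechet_derivative_works[symmetric])

lemma times_cont_diff_on_SucD: "times_cont_diff_on (Suc n) S f \<Longrightarrow> times_cont_diff_on n S f"
proof (induction n arbitrary: f)
  case 0
  then show ?case
    by (auto intro!: continuous_at_imp_continuous_on differentiable_imp_continuous_within)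
next
  case (Suc n)
  have "times_cont_diff_on n S (\<lambda>z. frechet_derivative f (at z) v)" for v
    by (rule Suc.IH) (use Suc.prems in simp)
  then show ?case using Suc.prems by simp
qed

lemma times_cont_diff_on_const: "times_cont_diff_on n S (\<lambda>z. c)"
  by (induction n arbitrary: c) simp_all

lemma times_cont_diff_on_add:
  assumes S: "open S"
  shows "times_cont_diff_on n S f \<Longrightarrow> times_cont_diff_on n S g \<Longrightarrow> times_cont_diff_on n S (\<lambda>z. f z + g z)"
proof (induction n arbitrary: f g)
  case 0
  then show ?case by (auto intro: continuous_intros)
next
  case (Suc n)
  show ?case
    by (rule times_cont_diff_on_SucI[OF S has_derivative_add[OF times_cont_diff_on_has_derivative[OF Suc.prems(1)]
       times_cont_diff_on_has_derivative[OF Suc.prems(2)]]]) (use Suc in auto)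
qed

lemma times_cont_diff_on_mult:
  fixes f g :: "'a::real_normed_vector \<Rightarrow> 'b::real_normed_algebra"
  assumes S: "open S"
  shows "times_cont_diff_on n S f \<Longrightarrow> times_cont_diff_on n S g \<Longrightarrow> times_cont_diff_on n S (\<lambda>z. f z * g z)"
proof (induction n arbitrary: f g)
  case 0
  then show ?case by (auto intro: continuous_intros)
next
  case (Suc n)
  have d: "times_cont_diff_on n S (\<lambda>z. frechet_derivative f (at z) v)" "times_cont_diff_on n S (\<lambda>z. frechet_derivative g (at z) v)" for v
    using Suc.prems by simp_all
  note f = Suc.prems(1) and g = Suc.prems(2)
  show ?case
    by (rule times_cont_diff_on_SucI[OF S has_derivative_mult[OF times_cont_diff_on_has_derivative[OF f]
       times_cont_diff_on_has_derivative[OF g]]])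
      (assumption | rule times_cont_diff_on_add[OF S] Suc.IH times_cont_diff_on_SucD[OF f] times_cont_diff_on_SucD[OF g] d)+
qed

text \<open>If each member is the derivative of its predecessor up to a factor that depends on the
  direction only, all members are smooth: the induction on the order runs over the whole family at
  once.\<close>

lemma times_cont_diff_on_family:
  fixes F :: "nat \<Rightarrow> 'a::real_normed_vector \<Rightarrow> complex"
  assumes S: "open S" and F: "\<And>j z. z \<in> S \<Longrightarrow> (F j has_derivative (\<lambda>v. m v * F (Suc j) z)) (at z)"
  shows "times_cont_diff_on n S (F j)"
proof (induction n arbitrary: j)
  case 0
  then show ?case
    using F by (auto intro!: continuous_at_imp_continuous_on has_derivative_continuous)
next
  case (Suc n)
  show ?case
    by (rule times_cont_diff_on_SucI[OF S F]) (auto intro!: times_cont_diff_on_mult[OF S] times_cont_diff_on_const Suc)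
qed

section \<open>A smooth switch built from exp (- 1 / x)\<close>

lemma poly_le_exp:
  fixes q :: "real poly"
  assumes "0 < c"
  shows "\<exists>C>0. \<forall>u\<ge>0. \<bar>poly q u\<bar> \<le> C * exp (c * u)"
  using assms
proof (induction q arbitrary: c)
  case 0
  then show ?case by (auto intro!: exI[of _ 1])
next
  case (pCons a q)
  obtain C where C: "0 < C" "\<And>u. 0 \<le> u \<Longrightarrow> \<bar>poly q u\<bar> \<le> C * exp (c / 2 * u)"
    using pCons.IH[of "c/2"] pCons.prems by auto
  have "\<bar>poly (pCons a q) u\<bar> \<le> (\<bar>a\<bar> + 2 / c * C) * exp (c * u)" if u: "0 \<le> u" for u
  proof -
    \<comment> \<open>Half of the exponent pays for the factor u, the other half for the remaining
      polynomial.\<close>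
    have "c / 2 * u \<le> exp (c / 2 * u)" using exp_ge_add_one_self[of "c / 2 * u"] by linarith
    then have "u \<le> 2 / c * exp (c / 2 * u)" using pCons.prems by (simp add: field_simps)
    then have "u * \<bar>poly q u\<bar> \<le> (2 / c * exp (c / 2 * u)) * (C * exp (c / 2 * u))"
      using u C pCons.prems by (intro mult_mono) auto
    also have "\<dots> = 2 / c * C * exp (c * u)" by (simp add: exp_add[symmetric])
    finally have 1: "u * \<bar>poly q u\<bar> \<le> 2 / c * C * exp (c * u)" .
    have "\<bar>a\<bar> * 1 \<le> \<bar>a\<bar> * exp (c * u)" using u pCons.prems by (intro mult_left_mono) auto
    moreover have "\<bar>poly (pCons a q) u\<bar> \<le> \<bar>a\<bar> + u * \<bar>poly q u\<bar>"
      using u abs_triangle_ineq[of a "u * poly q u"] by (simp add: abs_mult)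
    ultimately show ?thesis using 1 by (simp add: algebra_simps)
  qed
  moreover have "0 < \<bar>a\<bar> + 2 / c * C" using C pCons.prems by (intro add_nonneg_pos) auto
  ultimately show ?case by blast
qed

definition flat :: "real poly \<Rightarrow> real \<Rightarrow> real" where
  "flat q x = (if 0 < x then poly q (1 / x) * exp (- 1 / x) else 0)"

lemma flat_bounded: "\<exists>C>0. \<forall>x. \<bar>flat q x\<bar> \<le> C"
proof -
  obtain C where C: "0 < C" "\<And>u. 0 \<le> u \<Longrightarrow> \<bar>poly q u\<bar> \<le> C * exp (1 * u)"
    using poly_le_exp[of 1 q] by auto
  have "\<bar>flat q x\<bar> \<le> C" for x
  proof (cases "0 < x")
    case True
    then have "\<bar>poly q (1 / x)\<bar> * exp (- 1 / x) \<le> C * exp (1 * (1 / x)) * exp (- 1 / x)"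
      using C by (intro mult_right_mono) auto
    also have "\<dots> = C" by (simp add: exp_add[symmetric] exp_minus)
    finally show ?thesis using True by (simp add: flat_def abs_mult)
  qed (use C in \<open>simp add: flat_def\<close>)
  with C show ?thesis by blast
qed

lemma flat_tendsto_0: "(flat q \<longlongrightarrow> 0) (at 0)"
proof -
  obtain C where C: "\<And>x. \<bar>flat ([:0, 1:] * q) x\<bar> \<le> C" using flat_bounded by blast
  have b: "norm (flat q x) \<le> C * \<bar>x\<bar>" for x
  proof (cases "0 < x")
    case True
    then have "flat q x = x * flat ([:0, 1:] * q) x" by (simp add: flat_def)
    then show ?thesis using C[of x] True by (simp add: abs_mult mult.commute mult_left_mono)
  next
    case False
    moreover have "0 \<le> C * \<bar>x\<bar>" using C[of x] by (intro mult_nonneg_nonneg) auto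
    ultimately show ?thesis by (simp add: flat_def)
  qed
  have lim: "((\<lambda>x::real. C * \<bar>x\<bar>) \<longlongrightarrow> 0) (at 0)" by (auto intro!: tendsto_eq_intros)
  show ?thesis by (rule Lim_null_comparison[OF always_eventually lim]) (rule allI, rule b)
qed

text \<open>With u = 1 / x, hence du / dx = - u^2, the derivative of q(u) exp (- u) is u^2 (q -
  q')(u) exp (- u).\<close>

definition flat_deriv :: "real poly \<Rightarrow> real poly" where
  "flat_deriv q = [:0, 0, 1:] * (q - pderiv q)"

lemma flat_has_derivative: "(flat q has_real_derivative flat (flat_deriv q) x) (at x)"
proof -
  consider "x < 0" | "x = 0" | "0 < x" by linarith
  then show ?thesis
  proof cases
    case 1
    have "(flat q has_real_derivative 0) (at x)"
      by (rule has_field_derivative_transform_within_open[of "\<lambda>x. 0" _ _ "{..<0}"]) (use 1 in \<open>auto simp: flat_def\<close>)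
    then show ?thesis using 1 by (simp add: flat_def)
  next
    case 2
    \<comment> \<open>The difference quotient at 0 is again a flat function, with one more factor 1
      / h.\<close>
    have "((\<lambda>h. flat ([:0, 1:] * q) h) \<longlongrightarrow> 0) (at 0)" by (rule flat_tendsto_0)
    then have "((\<lambda>h. (flat q (0 + h) - flat q 0) / h) \<longlongrightarrow> 0) (at 0)"
      by (rule Lim_transform_eventually) (auto simp: flat_def intro!: always_eventually)
    then show ?thesis using 2 by (simp add: DERIV_def flat_def)
  next
    case 3
    have "((\<lambda>x. poly q (1 / x) * exp (- 1 / x)) has_real_derivative
       (poly (pderiv q) (1 / x) * (- 1 / x\<^sup>2)) * exp (- 1 / x) + poly q (1 / x) * (exp (- 1 / x) * (1 / x\<^sup>2))) (at x)"
      using 3 by (auto intro!: derivative_eq_intros DERIV_chain2[OF poly_DERIV] simp: power2_eq_square)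
    then have "(flat q has_real_derivative
       (poly (pderiv q) (1 / x) * (- 1 / x\<^sup>2)) * exp (- 1 / x) + poly q (1 / x) * (exp (- 1 / x) * (1 / x\<^sup>2))) (at x)"
      by (rule has_field_derivative_transform_within_open[of _ _ _ "{0<..}"]) (use 3 in \<open>auto simp: flat_def\<close>)
    then show ?thesis using 3 by (simp add: flat_def flat_deriv_def power2_eq_square field_simps)
  qed
qed

text \<open>\<open>bump j\<close> is the j-th derivative of \<open>bump 0\<close>, a switch that is
  0 on the left and tends to 1 at infinity without reaching it. The cutoffs made from it converge to
  1 pointwise, which is enough for dominated convergence.\<close>

definition bump :: "nat \<Rightarrow> real \<Rightarrow> real" where
  "bump j = flat ((flat_deriv ^^ j) 1)"

lemma bump_has_derivative: "(bump j has_real_derivative bump (Suc j) x) (at x)"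
  unfolding bump_def using flat_has_derivative by simp

lemma bump_nonpos: "x \<le> 0 \<Longrightarrow> bump j x = 0"
  by (simp add: bump_def flat_def)

lemma bump_0: "0 \<le> bump 0 x" "bump 0 x \<le> 1"
  by (auto simp: bump_def flat_def)

text \<open>For x > 0 and u = 1 / x the derivatives are u^2 exp (- u) and (u^4 - 2 u^3) exp (- u).
  Since (1 + x) u = 1 + u, the weights turn them into flat functions with the polynomials (1 + u)^2
  and (1 + u)^3 (u - 2), and these are bounded.\<close>

lemma bump_decay: "\<exists>C>0. \<forall>x. (1 + \<bar>x\<bar>)\<^sup>2 * \<bar>bump 1 x\<bar> \<le> C \<and> (1 + \<bar>x\<bar>) ^ 3 * \<bar>bump 2 x\<bar> \<le> C"
proof -
  have b1: "(flat_deriv ^^ 1) 1 = [:0, 0, 1:]" by (simp add: flat_deriv_def)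
  have b2: "(flat_deriv ^^ 2) 1 = [:0, 0, 0, -2, 1:]" 
    by (simp add: flat_deriv_def numeral_2_eq_2 pderiv_pCons)
  obtain C1 where C1: "C1 > 0" "\<And>x. \<bar>flat ([:1, 1:]\<^sup>2) x\<bar> \<le> C1" using flat_bounded by blast
  obtain C2 where C2: "C2 > 0" "\<And>x. \<bar>flat ([:1, 1:] ^ 3 * [:-2, 1:]) x\<bar> \<le> C2" using flat_bounded by blast
  have "(1 + \<bar>x\<bar>)\<^sup>2 * \<bar>bump 1 x\<bar> \<le> C1" for x
  proof (cases "0 < x")
    case True
    then have "(1 + \<bar>x\<bar>)\<^sup>2 * bump 1 x = flat ([:1, 1:]\<^sup>2) x"
      unfolding bump_def b1 flat_def by (simp add: field_simps power2_eq_square)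
    then have "\<bar>(1 + \<bar>x\<bar>)\<^sup>2 * bump 1 x\<bar> = \<bar>flat ([:1, 1:]\<^sup>2) x\<bar>" by (rule arg_cong)
    then have "(1 + \<bar>x\<bar>)\<^sup>2 * \<bar>bump 1 x\<bar> = \<bar>flat ([:1, 1:]\<^sup>2) x\<bar>" by (simp add: abs_mult)
    then show ?thesis using C1 by simp
  qed (use C1 in \<open>simp add: bump_nonpos\<close>)
  moreover have "(1 + \<bar>x\<bar>) ^ 3 * \<bar>bump 2 x\<bar> \<le> C2" for x
  proof (cases "0 < x")
    case True
    then have "(1 + \<bar>x\<bar>) ^ 3 * bump 2 x = flat ([:1, 1:] ^ 3 * [:-2, 1:]) x"
      unfolding bump_def b2 flat_def by (simp add: field_simps power3_eq_cube)
    then have "\<bar>(1 + \<bar>x\<bar>) ^ 3 * bump 2 x\<bar> = \<bar>flat ([:1, 1:] ^ 3 * [:-2, 1:]) x\<bar>" by (rule arg_cong)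
    then have "(1 + \<bar>x\<bar>) ^ 3 * \<bar>bump 2 x\<bar> = \<bar>flat ([:1, 1:] ^ 3 * [:-2, 1:]) x\<bar>" by (simp add: abs_mult)
    then show ?thesis using C2 by simp
  qed (use C2 in \<open>simp add: bump_nonpos\<close>)
  ultimately have "\<forall>x. (1 + \<bar>x\<bar>)\<^sup>2 * \<bar>bump 1 x\<bar> \<le> max C1 C2 \<and> (1 + \<bar>x\<bar>) ^ 3 * \<bar>bump 2 x\<bar> \<le> max C1 C2"
    by (simp add: max.coboundedI1 max.coboundedI2)
  moreover have "0 < max C1 C2" using C1(1) by (rule less_le_trans) simp
  ultimately show ?thesis by blast
qed

lemma bump_at_top: "(bump 0 \<longlongrightarrow> 1) at_top" "(bump 1 \<longlongrightarrow> 0) at_top" "(bump 2 \<longlongrightarrow> 0) at_top"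
proof -
  have "((\<lambda>x::real. exp (- 1 / x)) \<longlongrightarrow> exp 0) at_top"
    by (intro tendsto_intros tendsto_divide_0[OF tendsto_const] filterlim_at_top_imp_at_infinity filterlim_ident)
  moreover have "eventually (\<lambda>x. exp (- 1 / x) = bump 0 x) at_top"
    using eventually_gt_at_top[of 0] by eventually_elim (simp add: bump_def flat_def)
  ultimately show "(bump 0 \<longlongrightarrow> 1) at_top" using Lim_transform_eventually by fastforce
  obtain C where C: "C > 0" "\<And>x. (1 + \<bar>x\<bar>)\<^sup>2 * \<bar>bump 1 x\<bar> \<le> C" "\<And>x. (1 + \<bar>x\<bar>) ^ 3 * \<bar>bump 2 x\<bar> \<le> C"
    using bump_decay by blast
  have lim: "((\<lambda>x::real. C / x) \<longlongrightarrow> 0) at_top"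
    by (intro tendsto_divide_0[OF tendsto_const] filterlim_at_top_imp_at_infinity filterlim_ident)
  have *: "\<bar>y\<bar> \<le> C / x" if "(1 + \<bar>x\<bar>) ^ k * \<bar>y\<bar> \<le> C" "0 < x" "0 < k" for x y :: real and k
  proof -
    have "x \<le> (1 + \<bar>x\<bar>) ^ 1" using that by simp
    also have "\<dots> \<le> (1 + \<bar>x\<bar>) ^ k" using that by (intro power_increasing) auto
    finally have "x * \<bar>y\<bar> \<le> (1 + \<bar>x\<bar>) ^ k * \<bar>y\<bar>" by (rule mult_right_mono) simp
    then have "x * \<bar>y\<bar> \<le> C" using that by simp
    then show ?thesis using that by (simp add: field_simps)
  qed
  show "(bump 1 \<longlongrightarrow> 0) at_top"
    by (rule Lim_null_comparison[OF _ lim], rule eventually_mono[OF eventually_gt_at_top[of 0]])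
      (use *[OF C(2)] in auto)
  show "(bump 2 \<longlongrightarrow> 0) at_top"
    by (rule Lim_null_comparison[OF _ lim], rule eventually_mono[OF eventually_gt_at_top[of 0]])
      (use *[OF C(3)] in auto)
qed

section \<open>The holomorphic generator and its envelope\<close>

definition power_profile :: "real \<Rightarrow> real \<Rightarrow> real \<Rightarrow> real" where
  "power_profile a e t = (if t \<le> 1 then t powr a else t powr e)"

lemma power_profile_measurable [measurable]: "power_profile a e \<in> borel_measurable borel"
  unfolding power_profile_def by measurable

lemma power_profile_nonneg: "0 \<le> power_profile a e t"
  by (simp add: power_profile_def)

lemma power_profile_integral:
  assumes "- 1 < a" "e < - 1"
  shows "(\<integral>\<^sup>+t. ennreal (power_profile a e t) \<partial>restrict_space lborel {0<..}) < \<infinity>"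
proof -
  have 1: "(power_profile a e has_integral (1 powr (a+1) / (a+1))) {0..1}"
    by (rule has_integral_eq[OF _ has_integral_powr_from_0]) (use assms in \<open>auto simp: power_profile_def\<close>)
  have 2: "(power_profile a e has_integral (- (1 powr (e+1)) / (e+1))) {1..}"
    by (rule has_integral_eq[OF _ has_integral_powr_to_inf]) (use assms in \<open>auto simp: power_profile_def\<close>)
  have "{0..1} \<inter> {1..} = {1::real}" by auto
  then have "(power_profile a e has_integral (1 powr (a+1) / (a+1) + - (1 powr (e+1)) / (e+1))) ({0..1} \<union> {1..})"
    by (intro has_integral_Un[OF 1 2]) simp
  moreover have "{0..1} \<union> {1..} = {0::real..}" by auto
  ultimately obtain I where I: "(power_profile a e has_integral I) {0..}" by auto
  have "(\<integral>\<^sup>+t. ennreal (power_profile a e t) \<partial>restrict_space lborel {0<..})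
     \<le> (\<integral>\<^sup>+t. ennreal (if t \<in> {0..} then power_profile a e t else 0) \<partial>lborel)"
    by (subst nn_integral_restrict_space) (auto intro!: nn_integral_mono simp: indicator_def)
  also have "\<dots> = ennreal I"
    by (rule nn_integral_has_integral_lborel) (use I in \<open>auto simp: power_profile_nonneg has_integral_restrict_UNIV simp del: atLeast_iff\<close>)
  also have "\<dots> < \<infinity>" by simp
  finally show ?thesis .
qed

lemma power_profile_integral_abs:
  assumes "- 1 < a" "e < - 1"
  shows "(\<integral>\<^sup>+t. ennreal (power_profile a e \<bar>t\<bar>) \<partial>lborel) < \<infinity>"
proof -
  define P where "P = (\<integral>\<^sup>+t. ennreal (power_profile a e t) * indicator {0<..} t \<partial>lborel)"
  have P: "P < \<infinity>"
    using power_profile_integral[OF assms] by (subst (asm) nn_integral_restrict_space) (auto simp: P_def)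
  have neg: "(\<integral>\<^sup>+t. ennreal (power_profile a e (- t)) * indicator {..<0} t \<partial>lborel) = P"
    unfolding P_def
    by (subst nn_integral_real_affine[of _ "-1" 0]) (auto intro!: nn_integral_cong simp: indicator_def)
  have "AE t in lborel. t \<noteq> (0::real)" by (rule AE_lborel_singleton)
  then have "(\<integral>\<^sup>+t. ennreal (power_profile a e \<bar>t\<bar>) \<partial>lborel)
    \<le> (\<integral>\<^sup>+t. ennreal (power_profile a e t) * indicator {0<..} t + ennreal (power_profile a e (- t)) * indicator {..<0} t \<partial>lborel)"
    by (intro nn_integral_mono_AE) (auto elim!: eventually_mono simp: indicator_def)
  also have "\<dots> = P + P" unfolding neg[symmetric]
    by (subst nn_integral_add) (auto simp: neg P_def)
  finally show ?thesis using P by (auto simp: less_top[symmetric] top_unique)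
qed

section \<open>The right Haar measure on the half plane\<close>

lemma carrier_axb: "carrier axb = {z. 0 < snd z}"
  by (auto simp: axb_def)

lemma carrier_axb_borel: "{z::real \<times> real. 0 < snd z} \<in> sets borel"
  by (intro borel_open open_Collect_less continuous_intros)

lemma space_rho: "space rho = {z. 0 < snd z}"
  by (simp add: rho_def space_restrict_space carrier_axb)

lemma measurable_rho: "f \<in> borel_measurable borel \<Longrightarrow> f \<in> borel_measurable rho"
  unfolding rho_def by (simp add: measurable_restrict_space1)

lemma nn_integral_rho:
  assumes [measurable]: "f \<in> borel_measurable borel"
  shows "(\<integral>\<^sup>+z. f z \<partial>rho) = (\<integral>\<^sup>+x. \<integral>\<^sup>+a. f (x, a) * ennreal (1 / a) * indicator {0<..} a \<partial>lborel \<partial>lborel)"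
proof -
  have m[measurable]: "(\<lambda>(x::real, a::real). ennreal (1 / a)) \<in> borel_measurable borel"
    unfolding borel_prod[symmetric] by measurable
  have "(\<integral>\<^sup>+z. f z \<partial>rho) = (\<integral>\<^sup>+z. (case z of (x, a) \<Rightarrow> ennreal (1 / a)) * f z \<partial>restrict_space lborel (carrier axb))"
    unfolding rho_def using m assms
    by (intro nn_integral_density measurable_restrict_space1) auto
  also have "\<dots> = (\<integral>\<^sup>+z. ((case z of (x, a) \<Rightarrow> ennreal (1 / a)) * f z) * indicator {z. 0 < snd z} z \<partial>lborel)"
    using carrier_axb_borel by (subst nn_integral_restrict_space) (auto simp: carrier_axb)
  also have "\<dots> = (\<integral>\<^sup>+z. (case z of (x, a) \<Rightarrow> f (x, a) * ennreal (1 / a) * indicator {0<..} a) \<partial>(lborel \<Otimes>\<^sub>M lborel))"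
    unfolding lborel_prod by (intro nn_integral_cong) (auto simp: indicator_def mult.commute)
  also have "\<dots> = (\<integral>\<^sup>+x. \<integral>\<^sup>+a. f (x, a) * ennreal (1 / a) * indicator {0<..} a \<partial>lborel \<partial>lborel)"
    using assms unfolding borel_prod[symmetric] by (subst lborel.nn_integral_fst[symmetric]) (auto simp: split_beta')
  finally show ?thesis .
qed

lemma sigma_finite_rho: "sigma_finite_measure rho"
  unfolding rho_def
proof (rule sigma_finite_measure.sigma_finite_iff_density_finite[THEN iffD2])
  show "sigma_finite_measure (restrict_space lborel (carrier axb))"
    using carrier_axb_borel
    by (intro sigma_finite_measure_restrict_space lborel.sigma_finite_measure_axioms) (auto simp: carrier_axb)
  show "(\<lambda>(x, a). ennreal (1 / a)) \<in> borel_measurable (restrict_space lborel (carrier axb))"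
    by (intro measurable_restrict_space1) (simp add: borel_prod[symmetric])
qed auto

section \<open>The generator and Cauchy's inequality for its derivatives\<close>

definition beta :: "real \<Rightarrow> real" where
  "beta p = 1 + 1 / (2 * p)"

text \<open>The branch cut of the power and the pole - \<i> both lie outside the open upper half
  plane. Four of the six powers of \<zeta> + \<i> give integrability at infinity; the other two are
  kept to pay for a factor (1 + Im \<zeta>)^2 that the cutoffs cost.\<close>

definition gen :: "real \<Rightarrow> complex \<Rightarrow> complex" where
  "gen p \<zeta> = \<zeta> powr (- of_real (beta p)) / (\<zeta> + \<i>) ^ 6"

definition gen_deriv :: "real \<Rightarrow> nat \<Rightarrow> complex \<Rightarrow> complex" where
  "gen_deriv p j = (deriv ^^ j) (gen p)"

definition upper :: "complex set" where
  "upper = {\<zeta>. 0 < Im \<zeta>}"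

lemma open_upper: "open upper"
  unfolding upper_def by (intro open_Collect_less continuous_intros)

lemma upper_nonzero: "\<zeta> \<in> upper \<Longrightarrow> \<zeta> \<noteq> 0" "\<zeta> \<in> upper \<Longrightarrow> \<zeta> + \<i> \<noteq> 0"
  by (auto simp: upper_def complex_eq_iff)

lemma gen_holomorphic: "gen p holomorphic_on upper"
  unfolding gen_def
  by (intro holomorphic_intros) (auto simp: upper_nonzero complex_nonpos_Reals_iff upper_def)

lemma gen_deriv_holomorphic: "gen_deriv p j holomorphic_on upper"
  unfolding gen_deriv_def by (intro holomorphic_higher_deriv gen_holomorphic open_upper)

lemma gen_deriv_has_derivative:
  "0 < Im \<zeta> \<Longrightarrow> (gen_deriv p j has_field_derivative gen_deriv p (Suc j) \<zeta>) (at \<zeta>)"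
  using holomorphic_derivI[OF gen_deriv_holomorphic[of p j] open_upper, of \<zeta>]
  by (simp add: gen_deriv_def upper_def)

lemma norm_gen: "norm (gen p \<zeta>) = norm \<zeta> powr (- beta p) / norm (\<zeta> + \<i>) ^ 6"
  by (simp add: gen_def norm_divide norm_power norm_powr_real_powr')

lemma norm_upper:
  assumes "0 < Im \<zeta>"
  shows "Im \<zeta> \<le> norm \<zeta>" "1 + Im \<zeta> \<le> norm (\<zeta> + \<i>)" "1 + (Re \<zeta>)\<^sup>2 \<le> (norm (\<zeta> + \<i>))\<^sup>2"
proof -
  show "Im \<zeta> \<le> norm \<zeta>" using abs_Im_le_cmod[of \<zeta>] by linarith
  show "1 + Im \<zeta> \<le> norm (\<zeta> + \<i>)" using abs_Im_le_cmod[of "\<zeta> + \<i>"] by simp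
  have "1 \<le> (Im \<zeta> + 1)\<^sup>2" using assms by (simp add: one_le_power)
  then show "1 + (Re \<zeta>)\<^sup>2 \<le> (norm (\<zeta> + \<i>))\<^sup>2" by (simp add: cmod_power2)
qed

text \<open>On the closed disc of radius Im \<zeta> / 2 about \<zeta>, both |w| and |w + \<i>| are
  at least half of their values at the centre. So \<open>gen\<close> exceeds its value at \<zeta>
  there by at most the factor 2^\<beta> 2^6, and Cauchy's inequality adds j! 2^j.\<close>

lemma gen_deriv_bound:
  assumes p: "0 < p"
  shows "\<exists>K>0. \<forall>\<zeta>. 0 < Im \<zeta> \<longrightarrow>
     Im \<zeta> ^ j * norm (gen_deriv p j \<zeta>) \<le> K * (norm \<zeta> powr (- beta p) / norm (\<zeta> + \<i>) ^ 6)"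
proof -
  have b: "0 < beta p" using p by (simp add: beta_def add_pos_pos)
  define K where "K = fact j * 2 ^ j * 2 powr beta p * 2 ^ 6"
  have "Im \<zeta> ^ j * norm (gen_deriv p j \<zeta>) \<le> K * (norm \<zeta> powr (- beta p) / norm (\<zeta> + \<i>) ^ 6)"
    if \<zeta>: "0 < Im \<zeta>" for \<zeta>
  proof -
    define r where "r = Im \<zeta> / 2"
    have r: "0 < r" "r \<le> norm \<zeta> / 2" "r \<le> norm (\<zeta> + \<i>) / 2"
      using norm_upper[OF \<zeta>] \<zeta> by (auto simp: r_def)
    have sub: "cball \<zeta> r \<subseteq> upper"
    proof
      fix w assume "w \<in> cball \<zeta> r"
      then have "\<bar>Im \<zeta> - Im w\<bar> \<le> r" using abs_Im_le_cmod[of "\<zeta> - w"] by (auto simp: dist_norm)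
      then have "0 < Im w" using \<zeta> unfolding r_def by linarith
      then show "w \<in> upper" by (simp add: upper_def)
    qed
    have B: "norm (gen p w) \<le> 2 powr beta p * norm \<zeta> powr (- beta p) * (2 ^ 6 / norm (\<zeta> + \<i>) ^ 6)"
      if w: "norm (\<zeta> - w) = r" for w
    proof -
      have 1: "norm \<zeta> / 2 \<le> norm w" using norm_triangle_ineq2[of \<zeta> w] w r by linarith
      have 2: "norm (\<zeta> + \<i>) / 2 \<le> norm (w + \<i>)"
        using norm_triangle_ineq2[of "\<zeta> + \<i>" "w + \<i>"] w r by (simp add: algebra_simps)
      have "norm w powr (- beta p) \<le> (norm \<zeta> / 2) powr (- beta p)"
        using b 1 r by (intro powr_mono2') auto
      also have "\<dots> = 2 powr beta p * norm \<zeta> powr (- beta p)"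
        by (simp add: powr_divide powr_minus field_simps)
      finally have 3: "norm w powr (- beta p) \<le> 2 powr beta p * norm \<zeta> powr (- beta p)" .
      have "1 / norm (w + \<i>) ^ 6 \<le> 1 / (norm (\<zeta> + \<i>) / 2) ^ 6"
        using 2 r by (intro divide_left_mono power_mono mult_pos_pos zero_less_power) auto
      also have "\<dots> = 2 ^ 6 / norm (\<zeta> + \<i>) ^ 6" by (simp add: power_divide)
      finally have 4: "1 / norm (w + \<i>) ^ 6 \<le> 2 ^ 6 / norm (\<zeta> + \<i>) ^ 6" .
      have "norm (gen p w) = norm w powr (- beta p) * (1 / norm (w + \<i>) ^ 6)" by (simp add: norm_gen)
      also have "\<dots> \<le> 2 powr beta p * norm \<zeta> powr (- beta p) * (2 ^ 6 / norm (\<zeta> + \<i>) ^ 6)"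
        by (intro mult_mono 3 4) auto
      finally show ?thesis .
    qed
    have "norm (gen_deriv p j \<zeta>) \<le> fact j * (2 powr beta p * norm \<zeta> powr (- beta p) * (2 ^ 6 / norm (\<zeta> + \<i>) ^ 6)) / r ^ j"
      unfolding gen_deriv_def
    proof (rule Cauchy_inequality[OF _ _ r(1) B])
      show "gen p holomorphic_on ball \<zeta> r"
        by (rule holomorphic_on_subset[OF gen_holomorphic]) (use sub in auto)
      show "continuous_on (cball \<zeta> r) (gen p)"
        by (rule continuous_on_subset[OF holomorphic_on_imp_continuous_on[OF gen_holomorphic] sub])
    qed
    then have "Im \<zeta> ^ j * norm (gen_deriv p j \<zeta>) \<le> Im \<zeta> ^ j * (fact j * (2 powr beta p * norm \<zeta> powr (- beta p) * (2 ^ 6 / norm (\<zeta> + \<i>) ^ 6)) / r ^ j)"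
      using \<zeta> by (intro mult_left_mono) auto
    also have "\<dots> = K * (norm \<zeta> powr (- beta p) / norm (\<zeta> + \<i>) ^ 6)"
      using \<zeta> by (simp add: K_def r_def power_divide field_simps)
    finally show ?thesis .
  qed
  moreover have "0 < K" by (simp add: K_def)
  ultimately show ?thesis by blast
qed

section \<open>The envelope and its norms, uniform in the scale\<close>

definition env :: "real \<Rightarrow> complex \<Rightarrow> real" where
  "env p \<zeta> = Im \<zeta> * norm \<zeta> powr (- beta p) / norm (\<zeta> + \<i>) ^ 4"

lemma env_nonneg: "0 < Im \<zeta> \<Longrightarrow> 0 \<le> env p \<zeta>"
  by (simp add: env_def)

text \<open>Two of the six powers of |\<zeta> + \<i>| \<ge> 1 + Im \<zeta> are exchanged for the
  factor (1 + Im \<zeta>)^2; four remain in \<open>env\<close>. The power of Im \<zeta> exceeds the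
  order of the derivative by one, and this surplus makes da / a integrable at 0.\<close>

lemma gen_deriv_env:
  assumes "0 < p"
  shows "\<exists>K>0. \<forall>\<zeta>. 0 < Im \<zeta> \<longrightarrow>
     (1 + Im \<zeta>)\<^sup>2 * (Im \<zeta> ^ Suc j * norm (gen_deriv p j \<zeta>)) \<le> K * env p \<zeta>"
proof -
  obtain K where K: "0 < K" "\<And>\<zeta>. 0 < Im \<zeta> \<Longrightarrow>
     Im \<zeta> ^ j * norm (gen_deriv p j \<zeta>) \<le> K * (norm \<zeta> powr (- beta p) / norm (\<zeta> + \<i>) ^ 6)"
    using gen_deriv_bound[OF assms, of j] by blast
  have "(1 + Im \<zeta>)\<^sup>2 * (Im \<zeta> ^ Suc j * norm (gen_deriv p j \<zeta>)) \<le> K * env p \<zeta>" if \<zeta>: "0 < Im \<zeta>" for \<zeta>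
  proof -
    have "(1 + Im \<zeta>)\<^sup>2 * (Im \<zeta> ^ Suc j * norm (gen_deriv p j \<zeta>))
       = ((1 + Im \<zeta>)\<^sup>2 * Im \<zeta>) * (Im \<zeta> ^ j * norm (gen_deriv p j \<zeta>))" by simp
    also have "\<dots> \<le> ((norm (\<zeta> + \<i>))\<^sup>2 * Im \<zeta>) * (K * (norm \<zeta> powr (- beta p) / norm (\<zeta> + \<i>) ^ 6))"
      using \<zeta> norm_upper[OF \<zeta>] K by (intro mult_mono K power_mono) auto
    also have "\<dots> = K * env p \<zeta>"
      using upper_nonzero(2)[of \<zeta>] \<zeta> by (simp add: env_def upper_def field_simps flip: power_add)
    finally show ?thesis .
  qed
  with K show ?thesis by blast
qed

text \<open>Since \<beta> p = p + 1/2, the singular factor |\<zeta>|^(- \<beta> p) splits into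
  |\<zeta>|^(1/4 - p) \<le> b^(1/4 - p) and |\<zeta>|^(- 3/4) \<le> |x|^(- 3/4). With b^p from the
  numerator this leaves b^(1/4) = b b^(- 3/4): the factor b cancels against the Haar measure, and
  both exponents - 3/4 are integrable at 0. At infinity |\<zeta> + \<i>|^(4 p) \<ge> (1 + b)^2 (1 +
  x^2) gives the exponents - 2.\<close>

lemma env_powr_bound:
  assumes p: "1 < p" and b: "0 < b" and x: "x \<noteq> 0"
  shows "env p (Complex x b) powr p \<le> b * power_profile (- 3/4) (- 2) b * power_profile (- 3/4) (- 2) \<bar>x\<bar>"
proof -
  define \<zeta> where "\<zeta> = Complex x b"
  have \<zeta>: "0 < Im \<zeta>" "Im \<zeta> = b" "Re \<zeta> = x" using b by (auto simp: \<zeta>_def)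
  note n = norm_upper[OF \<zeta>(1), unfolded \<zeta>(2,3)]
  have bp: "beta p * p = (p - 1/4) + 3/4" using p by (simp add: beta_def field_simps)
  have n0: "0 < norm \<zeta>" "\<bar>x\<bar> \<le> norm \<zeta>" using n b abs_Re_le_cmod[of \<zeta>] \<zeta> by auto
  have n1: "1 \<le> norm (\<zeta> + \<i>)" using n b by linarith
  have A: "norm \<zeta> powr (- (beta p * p)) \<le> b powr (1/4 - p) * \<bar>x\<bar> powr (- 3/4)"
  proof -
    have "norm \<zeta> powr (- (beta p * p)) = norm \<zeta> powr (1/4 - p) * norm \<zeta> powr (- 3/4)"
      unfolding bp by (simp add: powr_add[symmetric])
    also have "\<dots> \<le> b powr (1/4 - p) * \<bar>x\<bar> powr (- 3/4)"
      using p b n n0 x by (intro mult_mono powr_mono2') auto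
    finally show ?thesis .
  qed
  have B: "1 / norm (\<zeta> + \<i>) powr (4 * p) \<le> 1 / ((1 + b)\<^sup>2 * (1 + x\<^sup>2))"
  proof (rule divide_left_mono)
    have "(1 + b)\<^sup>2 * (1 + x\<^sup>2) \<le> (norm (\<zeta> + \<i>))\<^sup>2 * (norm (\<zeta> + \<i>))\<^sup>2"
      using n b by (intro mult_mono power_mono) auto
    also have "\<dots> = norm (\<zeta> + \<i>) powr 4" using n1 by (simp add: powr_numeral flip: power_add)
    also have "\<dots> \<le> norm (\<zeta> + \<i>) powr (4 * p)" using n1 p by (intro powr_mono) auto
    finally show "(1 + b)\<^sup>2 * (1 + x\<^sup>2) \<le> norm (\<zeta> + \<i>) powr (4 * p)" .
  qed (use b n1 in \<open>auto intro!: mult_pos_pos add_pos_nonneg\<close>)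
  have "env p \<zeta> powr p = b powr p * norm \<zeta> powr (- (beta p * p)) * (1 / norm (\<zeta> + \<i>) powr (4 * p))"
  proof -
    have "(norm (\<zeta> + \<i>) ^ 4) powr p = norm (\<zeta> + \<i>) powr (4 * p)"
      using n1 by (simp add: powr_powr[symmetric] powr_numeral)
    then show ?thesis using b n1 n0
      by (simp add: env_def \<zeta>(2) powr_mult powr_divide powr_powr)
  qed
  also have "\<dots> \<le> b powr p * (b powr (1/4 - p) * \<bar>x\<bar> powr (- 3/4)) * (1 / ((1 + b)\<^sup>2 * (1 + x\<^sup>2)))"
    by (intro mult_mono A B order_refl) auto
  also have "\<dots> = (b powr (1/4) / (1 + b)\<^sup>2) * (\<bar>x\<bar> powr (- 3/4) / (1 + x\<^sup>2))"
    using b by (simp add: powr_add[symmetric] flip: mult.assoc)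
  also have "b powr (1/4) / (1 + b)\<^sup>2 = b * (b powr (- 3/4) / (1 + b)\<^sup>2)"
    using b powr_add[of b 1 "- 3/4"] by simp
  also have "b * (b powr (- 3/4) / (1 + b)\<^sup>2) * (\<bar>x\<bar> powr (- 3/4) / (1 + x\<^sup>2))
     \<le> b * power_profile (- 3/4) (- 2) b * power_profile (- 3/4) (- 2) \<bar>x\<bar>"
  proof (intro mult_mono mult_left_mono)
    have *: "t powr (- 3/4) / s \<le> power_profile (- 3/4) (- 2) t" if "0 < t" "1 \<le> s" "t\<^sup>2 \<le> s" for t s :: real
    proof (cases "t \<le> 1")
      case True
      then show ?thesis using that by (simp add: power_profile_def divide_le_eq mult_le_cancel_left1)
    next
      case False
      have "t powr (- 3/4) / s \<le> 1 / t\<^sup>2"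
        using that False by (intro frac_le) (auto simp: powr_le_one_le powr_minus inverse_le_1_iff ge_one_powr_ge_zero)
      then show ?thesis using False that by (simp add: power_profile_def powr_minus powr_numeral inverse_eq_divide)
    qed
    show "b powr (- 3/4) / (1 + b)\<^sup>2 \<le> power_profile (- 3/4) (- 2) b"
      using b by (intro *) (auto simp: power2_eq_square algebra_simps)
    show "\<bar>x\<bar> powr (- 3/4) / (1 + x\<^sup>2) \<le> power_profile (- 3/4) (- 2) \<bar>x\<bar>"
      using x by (intro *) auto
  qed (use b in \<open>auto simp: power_profile_nonneg\<close>)
  finally show ?thesis by (simp add: \<zeta>_def)
qed

definition axb_env :: "real \<Rightarrow> real \<Rightarrow> real \<times> real \<Rightarrow> real" where
  "axb_env p C z = (if 0 < snd z then env p (Complex (fst z) (C * snd z)) else 0)"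

lemma axb_env_measurable [measurable]: "axb_env p C \<in> borel_measurable borel"
proof -
  have "continuous_on UNIV (\<lambda>z::real \<times> real. Complex (fst z) (C * snd z))"
    unfolding Complex_eq by (intro continuous_intros)
  then have [measurable]: "(\<lambda>z::real \<times> real. Complex (fst z) (C * snd z)) \<in> borel_measurable borel"
    by (rule borel_measurable_continuous_onI)
  have [measurable]: "env p \<in> borel_measurable borel"
    unfolding env_def by measurable
  have "(\<lambda>z. env p (Complex (fst z) (C * snd z))) \<in> borel_measurable borel" by measurable
  then show ?thesis
    unfolding axb_env_def using carrier_axb_borel by (intro measurable_If) auto
qed

lemma axb_env_nonneg: "0 < C \<Longrightarrow> 0 \<le> axb_env p C z"
  by (auto simp: axb_env_def intro!: env_nonneg)

text \<open>The substitution b = C a leaves da / a unchanged, so the bound on the integral in a does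
  not see C, and a single \<open>K\<close> serves all scales.\<close>

lemma axb_env_Lp:
  assumes p: "1 < p"
  shows "\<exists>K\<ge>0. \<forall>C>0. Lp_le rho p (\<lambda>z. of_real (axb_env p C z)) K"
proof -
  define q where "q = power_profile (- 3/4) (- 2)"
  define P where "P = (\<integral>\<^sup>+t. ennreal (q t) \<partial>restrict_space lborel {0<..})"
  define Q where "Q = (\<integral>\<^sup>+t. ennreal (q \<bar>t\<bar>) \<partial>lborel)"
  have PQ: "P < \<infinity>" "Q < \<infinity>"
    using power_profile_integral[of "- 3/4" "- 2"] power_profile_integral_abs[of "- 3/4" "- 2"] by (auto simp: P_def Q_def q_def)
  have [measurable]: "q \<in> borel_measurable borel" by (simp add: q_def)
  define K where "K = (enn2real P * enn2real Q) powr (1 / p)"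
  have "Lp_le rho p (\<lambda>z. of_real (axb_env p C z)) K" if C: "0 < C" for C
  proof (rule Lp_leI)
    show "(\<lambda>z. complex_of_real (axb_env p C z)) \<in> borel_measurable rho"
      by (intro measurable_rho) measurable
    show "0 \<le> K" by (simp add: K_def)
    have inner: "(\<integral>\<^sup>+a. ennreal (C * q (C * a)) * indicator {0<..} a \<partial>lborel) = P"
    proof -
      have "P = (\<integral>\<^sup>+a. ennreal (q a) * indicator {0<..} a \<partial>lborel)"
        unfolding P_def by (subst nn_integral_restrict_space) auto
      also have "\<dots> = ennreal \<bar>C\<bar> * (\<integral>\<^sup>+a. ennreal (q (0 + C * a)) * indicator {0<..} (0 + C * a) \<partial>lborel)"
        using C by (intro nn_integral_real_affine) auto
      also have "\<dots> = (\<integral>\<^sup>+a. ennreal \<bar>C\<bar> * (ennreal (q (0 + C * a)) * indicator {0<..} (0 + C * a)) \<partial>lborel)"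
        by (intro nn_integral_cmult[symmetric]) measurable
      also have "\<dots> = (\<integral>\<^sup>+a. ennreal (C * q (C * a)) * indicator {0<..} a \<partial>lborel)"
        using C by (intro nn_integral_cong) (auto simp: indicator_def ennreal_mult q_def power_profile_nonneg zero_less_mult_iff)
      finally show ?thesis ..
    qed
    have "(\<integral>\<^sup>+z. ennreal (norm (complex_of_real (axb_env p C z)) powr p) \<partial>rho)
      = (\<integral>\<^sup>+x. \<integral>\<^sup>+a. ennreal (axb_env p C (x, a) powr p) * ennreal (1 / a) * indicator {0<..} a \<partial>lborel \<partial>lborel)"
      using C by (subst nn_integral_rho) (auto simp: axb_env_nonneg)
    also have "\<dots> \<le> (\<integral>\<^sup>+x. ennreal (q \<bar>x\<bar>) * P \<partial>lborel)"
    proof (rule nn_integral_mono_AE, rule eventually_mono[OF AE_lborel_singleton[of 0]])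
      fix x :: real assume x: "x \<noteq> 0"
      have "(\<integral>\<^sup>+a. ennreal (axb_env p C (x, a) powr p) * ennreal (1 / a) * indicator {0<..} a \<partial>lborel)
        \<le> (\<integral>\<^sup>+a. ennreal (q \<bar>x\<bar>) * (ennreal (C * q (C * a)) * indicator {0<..} a) \<partial>lborel)"
      proof (rule nn_integral_mono)
        fix a :: real
        show "ennreal (axb_env p C (x, a) powr p) * ennreal (1 / a) * indicator {0<..} a
          \<le> ennreal (q \<bar>x\<bar>) * (ennreal (C * q (C * a)) * indicator {0<..} a)"
        proof (cases "0 < a")
          case True
          have "env p (Complex x (C * a)) powr p \<le> (C * a) * q (C * a) * q \<bar>x\<bar>"
            using True C x unfolding q_def by (intro env_powr_bound p) auto
          then have "env p (Complex x (C * a)) powr p * (1 / a) \<le> (C * a) * q (C * a) * q \<bar>x\<bar> * (1 / a)"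
            using True by (intro mult_right_mono) auto
          also have "\<dots> = q \<bar>x\<bar> * (C * q (C * a))" using True by simp
          finally show ?thesis
            using True C by (simp add: axb_env_def ennreal_mult[symmetric] q_def power_profile_nonneg ennreal_leI)
        qed simp
      qed
      also have "\<dots> = ennreal (q \<bar>x\<bar>) * P"
        by (subst nn_integral_cmult) (auto simp: inner)
      finally show "(\<integral>\<^sup>+a. ennreal (axb_env p C (x, a) powr p) * ennreal (1 / a) * indicator {0<..} a \<partial>lborel) \<le> ennreal (q \<bar>x\<bar>) * P" .
    qed
    also have "\<dots> = Q * P" unfolding Q_def by (intro nn_integral_multc) measurable
    also have "\<dots> = ennreal (enn2real Q) * ennreal (enn2real P)"
      using PQ by simp
    also have "\<dots> = ennreal (K powr p)"
      using p by (simp add: K_def powr_powr ennreal_mult[symmetric] mult.commute)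
    finally show "(\<integral>\<^sup>+z. ennreal (norm (complex_of_real (axb_env p C z)) powr p) \<partial>rho) \<le> ennreal (K powr p)" .
  qed
  moreover have "0 \<le> K" by (simp add: K_def)
  ultimately show ?thesis by blast
qed

definition env_norm :: "real \<Rightarrow> real" where
  "env_norm p = (SOME K. 0 \<le> K \<and> (\<forall>C>0. Lp_le rho p (\<lambda>z. of_real (axb_env p C z)) K))"

lemma env_norm:
  assumes "1 < p"
  shows "0 \<le> env_norm p" "0 < C \<Longrightarrow> Lp_le rho p (\<lambda>z. of_real (axb_env p C z)) (env_norm p)"
  using someI_ex[OF axb_env_Lp[OF assms, unfolded Bex_def]] unfolding env_norm_def by blast+

lemma Lp_le_env:
  assumes "1 < p" "0 < C" "f \<in> borel_measurable rho" "0 \<le> K"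
    "\<And>z. 0 < snd z \<Longrightarrow> norm (f z) \<le> K * axb_env p C z"
  shows "Lp_le rho p f (K * env_norm p)"
proof -
  have 1: "Lp_le rho p (\<lambda>z. of_real K * of_real (axb_env p C z)) (K * env_norm p)"
    using Lp_le_scale[OF env_norm(2)[OF assms(1,2)], of "of_real K"] assms by simp
  show ?thesis
  proof (rule Lp_le_mono_AE[OF 1 assms(3) _ order_refl])
    show "AE z in rho. norm (f z) \<le> norm (complex_of_real K * complex_of_real (axb_env p C z))"
      by (rule AE_I2) (use assms in \<open>auto simp: space_rho norm_mult axb_env_nonneg\<close>)
  qed (use assms in simp)
qed

text \<open>Dominated convergence with the envelope as majorant; this is how the cutoffs are
  removed.\<close>

lemma Lp_le_env_dominated:
  assumes p: "1 < p" and C: "0 < C" and f[measurable]: "\<And>n. f n \<in> borel_measurable rho" and K: "0 \<le> K"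
    and le: "\<And>n z. 0 < snd z \<Longrightarrow> norm (f n z) \<le> K * axb_env p C z"
    and lim: "\<And>z. 0 < snd z \<Longrightarrow> (\<lambda>n. f n z) \<longlonglongrightarrow> 0" and e: "0 < e"
  shows "eventually (\<lambda>n. Lp_le rho p (f n) e) sequentially"
proof -
  have 1: "Lp_le rho p (\<lambda>z. of_real (K * axb_env p C z)) (K * env_norm p)"
    using Lp_le_scale[OF env_norm(2)[OF p C], of "of_real K"] p K by simp
  have "(\<lambda>n. \<integral>\<^sup>+z. ennreal (norm (f n z) powr p) \<partial>rho) \<longlonglongrightarrow> (\<integral>\<^sup>+z. 0 \<partial>rho)"
  proof (rule nn_integral_dominated_convergence[where w = "\<lambda>z. ennreal (norm (complex_of_real (K * axb_env p C z)) powr p)"])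
    show "(\<lambda>z. ennreal (norm (complex_of_real (K * axb_env p C z)) powr p)) \<in> borel_measurable rho"
      by (intro measurable_rho) measurable
    show "(\<integral>\<^sup>+z. ennreal (norm (complex_of_real (K * axb_env p C z)) powr p) \<partial>rho) < \<infinity>"
      using 1 unfolding Lp_le_def by (auto intro: le_less_trans)
    show "AE z in rho. ennreal (norm (f n z) powr p) \<le> ennreal (norm (complex_of_real (K * axb_env p C z)) powr p)" for n
    proof (rule AE_I2)
      fix z assume "z \<in> space rho"
      then have "norm (f n z) \<le> norm (complex_of_real (K * axb_env p C z))"
        using le[of z n] K axb_env_nonneg[OF C, of p z] by (simp add: space_rho norm_mult)
      then show "ennreal (norm (f n z) powr p) \<le> ennreal (norm (complex_of_real (K * axb_env p C z)) powr p)"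
        using p by (intro ennreal_leI powr_mono2) auto
    qed
    show "AE z in rho. (\<lambda>n. ennreal (norm (f n z) powr p)) \<longlonglongrightarrow> 0"
    proof (rule AE_I2)
      fix z assume "z \<in> space rho"
      then have "(\<lambda>n. norm (f n z)) \<longlonglongrightarrow> 0" using lim[of z] tendsto_norm_zero by (auto simp: space_rho)
      then have "(\<lambda>n. norm (f n z) powr p) \<longlonglongrightarrow> 0 powr p"
        using p by (intro tendsto_powr' tendsto_const) auto
      then show "(\<lambda>n. ennreal (norm (f n z) powr p)) \<longlonglongrightarrow> 0" using tendsto_ennrealI by fastforce
    qed
  qed measurable
  then have "(\<lambda>n. \<integral>\<^sup>+z. ennreal (norm (f n z) powr p) \<partial>rho) \<longlonglongrightarrow> 0" by simp
  moreover have "0 < ennreal (e powr p)" using e by simp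
  ultimately have "eventually (\<lambda>n. (\<integral>\<^sup>+z. ennreal (norm (f n z) powr p) \<partial>rho) < ennreal (e powr p)) sequentially"
    by (rule order_tendstoD(2))
  then show ?thesis
    by (rule eventually_mono) (use e in \<open>auto intro!: Lp_leI less_imp_le\<close>)
qed

section \<open>Cutoffs and the domain of the Laplacian\<close>

definition zeta :: "real \<Rightarrow> real \<times> real \<Rightarrow> complex" where
  "zeta C z = Complex (fst z) (C * snd z)"

lemma zeta_bounded_linear: "bounded_linear (zeta C)"
proof -
  have "zeta C = (\<lambda>z. fst z *\<^sub>R 1 + snd z *\<^sub>R (\<i> * C))"
    by (auto simp: zeta_def complex_eq_iff)
  moreover have "bounded_linear (\<lambda>z::real \<times> real. fst z *\<^sub>R 1 + snd z *\<^sub>R (\<i> * C))"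
    by (intro bounded_linear_intros)
  ultimately show ?thesis by simp
qed

lemma Im_zeta: "Im (zeta C z) = C * snd z" and Re_zeta: "Re (zeta C z) = fst z"
  by (simp_all add: zeta_def)

lemma gen_deriv_zeta_has_derivative:
  assumes "0 < C * snd z"
  shows "((\<lambda>z. gen_deriv p j (zeta C z)) has_derivative (\<lambda>v. zeta C v * gen_deriv p (Suc j) (zeta C z))) (at z)"
proof -
  have "(zeta C has_derivative zeta C) (at z)"
    by (rule bounded_linear_imp_has_derivative[OF zeta_bounded_linear])
  moreover have "(gen_deriv p j has_derivative (\<lambda>h. gen_deriv p (Suc j) (zeta C z) * h)) (at (zeta C z))"
    using gen_deriv_has_derivative[of "zeta C z" p j] assms by (simp add: Im_zeta has_field_derivative_def)
  ultimately show ?thesis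
    using has_derivative_compose[of "zeta C" "zeta C" z UNIV "gen_deriv p j"] by (simp add: mult.commute)
qed

text \<open>A form that both vector fields reproduce: each of them turns one such term into two, by
  differentiating a factor A or B or by raising the order of the derivative of
  \<open>gen\<close>.\<close>

definition wave_term :: "real \<Rightarrow> real \<Rightarrow> (real \<Rightarrow> real) \<Rightarrow> (real \<Rightarrow> real) \<Rightarrow> nat \<Rightarrow> real \<times> real \<Rightarrow> complex" where
  "wave_term p C A B j z = of_real (A (snd z) * B (fst z)) * gen_deriv p j (zeta C z)"

lemma wave_term_has_derivative:
  assumes z: "0 < snd z" and C: "0 < C"
    and A: "(A has_real_derivative A') (at (snd z))" and B: "(B has_real_derivative B') (at (fst z))"
  shows "(wave_term p C A B j has_derivative (\<lambda>v.
     of_real (A (snd z) * B (fst z)) * (zeta C v * gen_deriv p (Suc j) (zeta C z)) +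
     of_real (A (snd z) * (fst v * B') + snd v * A' * B (fst z)) * gen_deriv p j (zeta C z))) (at z)"
proof -
  have 1: "((\<lambda>z. A (snd z)) has_derivative (\<lambda>v. snd v * A')) (at z)"
    using has_derivative_compose[OF has_derivative_snd[OF has_derivative_ident], of A "(*) A'" z UNIV] A
    by (simp add: has_field_derivative_def mult.commute)
  have 2: "((\<lambda>z. B (fst z)) has_derivative (\<lambda>v. fst v * B')) (at z)"
    using has_derivative_compose[OF has_derivative_fst[OF has_derivative_ident], of B "(*) B'" z UNIV] B
    by (simp add: has_field_derivative_def mult.commute)
  show ?thesis
    unfolding wave_term_def
    by (rule has_derivative_mult[OF has_derivative_of_real[OF has_derivative_mult[OF 1 2]] gen_deriv_zeta_has_derivative])
      (use z C in simp)
qed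

lemma open_half_plane: "open {z::real \<times> real. 0 < snd z}"
  by (intro open_Collect_less continuous_intros)

lemma frechet_derivative_half_plane:
  fixes z :: "real \<times> real"
  assumes "(h has_derivative D) (at z)" "\<And>w. 0 < snd w \<Longrightarrow> f w = h w" "0 < snd z"
  shows "frechet_derivative f (at z) = D"
proof -
  have "(f has_derivative D) (at z)"
    by (rule has_derivative_transform_within_open[OF assms(1) open_half_plane]) (use assms in auto)
  then show ?thesis by (metis frechet_derivative_at)
qed

text \<open>Two summands are enough for the whole Laplacian: the first application of a field turns
  one term into two, and the second is applied to these. The hypothesis on \<open>f\<close> is
  restricted to the half plane because this is where the first application has been
  computed.\<close>

lemma X0_wave_terms:
  assumes f: "\<forall>w. 0 < snd w \<longrightarrow> f w = c1 * wave_term p C A1 B1 j1 w + c2 * wave_term p C A2 B2 j2 w"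
    and z: "0 < snd z" and C: "0 < C"
    and A1: "\<And>a. (A1 has_real_derivative A1' a) (at a)" and B1: "\<And>x. (B1 has_real_derivative B1' x) (at x)"
    and A2: "\<And>a. (A2 has_real_derivative A2' a) (at a)" and B2: "\<And>x. (B2 has_real_derivative B2' x) (at x)"
  shows "X0 f z = c1 * wave_term p C (\<lambda>a. a * A1' a) B1 j1 z + c1 * (\<i> * C) * wave_term p C (\<lambda>a. a * A1 a) B1 (Suc j1) z
       + c2 * wave_term p C (\<lambda>a. a * A2' a) B2 j2 z + c2 * (\<i> * C) * wave_term p C (\<lambda>a. a * A2 a) B2 (Suc j2) z"
    and "X1 f z = c1 * wave_term p C (\<lambda>a. a * A1 a) B1' j1 z + c1 * wave_term p C (\<lambda>a. a * A1 a) B1 (Suc j1) z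
       + c2 * wave_term p C (\<lambda>a. a * A2 a) B2' j2 z + c2 * wave_term p C (\<lambda>a. a * A2 a) B2 (Suc j2) z"
proof -
  let ?D = "\<lambda>A B A' B' j v. of_real (A (snd z) * B (fst z)) * (zeta C v * gen_deriv p (Suc j) (zeta C z)) +
     of_real (A (snd z) * (fst v * B' (fst z)) + snd v * A' (snd z) * B (fst z)) * gen_deriv p j (zeta C z)"
  have d: "((\<lambda>w. c1 * wave_term p C A1 B1 j1 w + c2 * wave_term p C A2 B2 j2 w) has_derivative
     (\<lambda>v. c1 * ?D A1 B1 A1' B1' j1 v + c2 * ?D A2 B2 A2' B2' j2 v)) (at z)"
    by (intro has_derivative_add has_derivative_mult_right wave_term_has_derivative z C A1 B1 A2 B2)
  have D: "frechet_derivative f (at z) = (\<lambda>v. c1 * ?D A1 B1 A1' B1' j1 v + c2 * ?D A2 B2 A2' B2' j2 v)"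
    by (rule frechet_derivative_half_plane[OF d _ z]) (use f in blast)
  have zv: "zeta C (0, 1) = \<i> * C" "zeta C (1, 0) = 1" by (auto simp: zeta_def complex_eq_iff)
  show "X0 f z = c1 * wave_term p C (\<lambda>a. a * A1' a) B1 j1 z + c1 * (\<i> * C) * wave_term p C (\<lambda>a. a * A1 a) B1 (Suc j1) z
       + c2 * wave_term p C (\<lambda>a. a * A2' a) B2 j2 z + c2 * (\<i> * C) * wave_term p C (\<lambda>a. a * A2 a) B2 (Suc j2) z"
    unfolding X0_def D wave_term_def scaleR_conv_of_real by (simp add: zv algebra_simps)
  show "X1 f z = c1 * wave_term p C (\<lambda>a. a * A1 a) B1' j1 z + c1 * wave_term p C (\<lambda>a. a * A1 a) B1 (Suc j1) z
       + c2 * wave_term p C (\<lambda>a. a * A2 a) B2' j2 z + c2 * wave_term p C (\<lambda>a. a * A2 a) B2 (Suc j2) z"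
    unfolding X1_def D wave_term_def scaleR_conv_of_real by (simp add: zv algebra_simps)
qed

text \<open>The value of X0^2 + X1^2 on A(a) B(x) a g(x + \<i> C a), with A, B and their first two
  derivatives at the point entered as free reals. Thus the cutoffs and their limit, with entries 1,
  0, 0, 1, 0, 0, share one formula and one bound.\<close>

definition cut_Delta :: "real \<Rightarrow> real \<Rightarrow> real \<times> real \<Rightarrow> real \<Rightarrow> real \<Rightarrow> real \<Rightarrow> real \<Rightarrow> real \<Rightarrow> real \<Rightarrow> complex" where
  "cut_Delta p C z a0 a1 a2 b0 b1 b2 =
      of_real (snd z * (a0 * b0) + (3 * (snd z)\<^sup>2 * a1 + snd z ^ 3 * a2) * b0 + snd z ^ 3 * a0 * b2) * gen_deriv p 0 (zeta C z)
    + (\<i> * C * of_real (3 * (snd z)\<^sup>2 * (a0 * b0) + 2 * snd z ^ 3 * a1 * b0) + of_real (2 * snd z ^ 3 * a0 * b1)) * gen_deriv p 1 (zeta C z)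
    + of_real ((1 - C\<^sup>2) * snd z ^ 3 * (a0 * b0)) * gen_deriv p 2 (zeta C z)"

lemma Delta_cutoff:
  assumes f: "\<And>w. 0 < snd w \<Longrightarrow> f w = of_real (A (snd w) * B (fst w)) * (of_real (snd w) * gen_deriv p 0 (zeta C w))"
    and z: "0 < snd z" and C: "0 < C"
    and A: "\<And>a. (A has_real_derivative A1 a) (at a)" and A1: "\<And>a. (A1 has_real_derivative A2 a) (at a)"
    and B: "\<And>x. (B has_real_derivative B1 x) (at x)" and B1: "\<And>x. (B1 has_real_derivative B2 x) (at x)"
  shows "Delta f z = - cut_Delta p C z (A (snd z)) (A1 (snd z)) (A2 (snd z)) (B (fst z)) (B1 (fst z)) (B2 (fst z))"
proof -
  have a1: "((\<lambda>a. a * A a) has_real_derivative (A a + a * A1 a)) (at a)" for a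
    by (auto intro!: derivative_eq_intros A)
  have a2: "((\<lambda>a. a * (A a + a * A1 a)) has_real_derivative (A a + 3 * a * A1 a + a\<^sup>2 * A2 a)) (at a)" for a
    by (auto intro!: derivative_eq_intros A A1 simp: algebra_simps power2_eq_square)
  have a3: "((\<lambda>a. a * (a * A a)) has_real_derivative (2 * a * A a + a\<^sup>2 * A1 a)) (at a)" for a
    by (auto intro!: derivative_eq_intros A A1 simp: algebra_simps power2_eq_square)
  have f1: "\<forall>w. 0 < snd w \<longrightarrow> f w = 1 * wave_term p C (\<lambda>a. a * A a) B 0 w + 0 * wave_term p C (\<lambda>a. a * A a) B 0 w"
    using f by (simp add: wave_term_def)
  have x0: "\<forall>w. 0 < snd w \<longrightarrow> X0 f w = 1 * wave_term p C (\<lambda>a. a * (A a + a * A1 a)) B 0 w + (\<i> * C) * wave_term p C (\<lambda>a. a * (a * A a)) B 1 w"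
    using X0_wave_terms(1)[OF f1 _ C a1 B a1 B] by simp
  have x1: "\<forall>w. 0 < snd w \<longrightarrow> X1 f w = 1 * wave_term p C (\<lambda>a. a * (a * A a)) B1 0 w + 1 * wave_term p C (\<lambda>a. a * (a * A a)) B 1 w"
    using X0_wave_terms(2)[OF f1 _ C a1 B a1 B] by simp
  show ?thesis
    unfolding Delta_def X0_wave_terms(1)[where f = "X0 f", OF x0 z C a2 B a3 B] X0_wave_terms(2)[where f = "X1 f", OF x1 z C a3 B1 a3 B]
    by (simp add: cut_Delta_def wave_term_def algebra_simps power2_eq_square power3_eq_cube numeral_2_eq_2)
qed

text \<open>The wave without its factor sinh \<theta>, for C = cosh \<theta>. That factor is
  constant in (x, a) and is put back by linearity.\<close>

definition wave0 :: "real \<Rightarrow> real \<Rightarrow> real \<times> real \<Rightarrow> complex" where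
  "wave0 p C z = (if 0 < snd z then of_real (snd z) * gen_deriv p 0 (zeta C z) else 0)"

definition Delta_wave0 :: "real \<Rightarrow> real \<Rightarrow> real \<times> real \<Rightarrow> complex" where
  "Delta_wave0 p C z = (if 0 < snd z then - (of_real (snd z) * gen_deriv p 0 (zeta C z)
    + \<i> * C * of_real (3 * (snd z)\<^sup>2) * gen_deriv p 1 (zeta C z)
    + of_real ((1 - C\<^sup>2) * snd z ^ 3) * gen_deriv p 2 (zeta C z)) else 0)"

lemma continuous_on_gen_deriv_zeta:
  "0 < C \<Longrightarrow> continuous_on {z. 0 < snd z} (\<lambda>z. gen_deriv p j (zeta C z))"
  by (auto intro!: continuous_at_imp_continuous_on has_derivative_continuous[OF gen_deriv_zeta_has_derivative])

lemma measurable_rho_continuous: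
  fixes f :: "real \<times> real \<Rightarrow> 'a::topological_space"
  assumes "continuous_on {z. 0 < snd z} f"
  shows "f \<in> borel_measurable rho"
proof -
  have "f \<in> borel_measurable (restrict_space borel {z. 0 < snd z})"
    by (rule borel_measurable_continuous_on_restrict[OF assms])
  moreover have "sets rho = sets (restrict_space borel {z. 0 < snd z})"
    by (simp add: rho_def carrier_axb sets_restrict_space)
  ultimately show ?thesis by (simp cong: measurable_cong_sets)
qed

text \<open>For C \<ge> 1 one has a \<le> b = C a, so the coefficient of the j-th derivative of
  \<open>gen\<close> is at most a constant times b^(j+1) (1 + b)^2, uniformly in C; this is what
  \<open>gen_deriv_env\<close> controls. The growth in 1 + a stems from the derivatives of the
  cutoffs.\<close>

lemma cutoff_Delta_bound:
  assumes p: "0 < p"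
  shows "\<exists>K>0. \<forall>C z a0 a1 a2 b0 b1 b2. 1 \<le> C \<longrightarrow> 0 < snd z \<longrightarrow>
     \<bar>a0\<bar> \<le> 1 \<longrightarrow> \<bar>b0\<bar> \<le> 1 \<longrightarrow> snd z * \<bar>a1\<bar> \<le> c * (1 + snd z) \<longrightarrow> (snd z)\<^sup>2 * \<bar>a2\<bar> \<le> c * (1 + snd z)\<^sup>2 \<longrightarrow>
     \<bar>b1\<bar> \<le> c \<longrightarrow> \<bar>b2\<bar> \<le> c \<longrightarrow>
     norm (cut_Delta p C z a0 a1 a2 b0 b1 b2) \<le> K * axb_env p C z"
proof -
  obtain K0 where K0: "0 < K0" "\<And>\<zeta>. 0 < Im \<zeta> \<Longrightarrow> (1 + Im \<zeta>)\<^sup>2 * (Im \<zeta> ^ Suc 0 * norm (gen_deriv p 0 \<zeta>)) \<le> K0 * env p \<zeta>"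
    using gen_deriv_env[OF p, of 0] by blast
  obtain K1 where K1: "0 < K1" "\<And>\<zeta>. 0 < Im \<zeta> \<Longrightarrow> (1 + Im \<zeta>)\<^sup>2 * (Im \<zeta> ^ Suc 1 * norm (gen_deriv p 1 \<zeta>)) \<le> K1 * env p \<zeta>"
    using gen_deriv_env[OF p, of 1] by blast
  obtain K2 where K2: "0 < K2" "\<And>\<zeta>. 0 < Im \<zeta> \<Longrightarrow> (1 + Im \<zeta>)\<^sup>2 * (Im \<zeta> ^ Suc 2 * norm (gen_deriv p 2 \<zeta>)) \<le> K2 * env p \<zeta>"
    using gen_deriv_env[OF p, of 2] by blast
  define c' where "c' = \<bar>c\<bar>"
  \<comment> \<open>The coefficients of the separate terms add up to 1 + 3 c' + c' + c' for order 0
    and 3 + 2 c' + 2 c' for order 1; the 2 for order 2 comes from |1 - C^2| \<le> 2 C^3.\<close>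
  define K where "K = (1 + 5 * c') * K0 + (3 + 4 * c') * K1 + 2 * K2"
  have c': "0 \<le> c'" "c \<le> c'" by (auto simp: c'_def)
  show ?thesis
  proof (intro exI[of _ K] conjI allI impI)
    show "0 < K" unfolding K_def using K0 K1 K2 c' by (intro add_nonneg_pos add_nonneg_nonneg mult_nonneg_nonneg) auto
    fix C :: real and z :: "real \<times> real" and a0 a1 a2 b0 b1 b2 :: real
    assume C: "1 \<le> C" and z: "0 < snd z" and a0: "\<bar>a0\<bar> \<le> 1" and b0: "\<bar>b0\<bar> \<le> 1"
      and a1: "snd z * \<bar>a1\<bar> \<le> c * (1 + snd z)" and a2: "(snd z)\<^sup>2 * \<bar>a2\<bar> \<le> c * (1 + snd z)\<^sup>2" and b1: "\<bar>b1\<bar> \<le> c" and b2: "\<bar>b2\<bar> \<le> c"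
    define a where "a = snd z"
    define b where "b = C * a"
    define g where "g j = norm (gen_deriv p j (zeta C z))" for j
    define e where "e = axb_env p C z"
    have ab: "0 < a" "a \<le> b" "0 < b" using z C by (auto simp: a_def b_def mult_le_cancel_right1)
    have e: "e = env p (zeta C z)" "Im (zeta C z) = b" using z by (auto simp: e_def axb_env_def zeta_def b_def a_def)
    have A1: "a * \<bar>a1\<bar> \<le> c' * (1 + a)" and A2: "a\<^sup>2 * \<bar>a2\<bar> \<le> c' * (1 + a)\<^sup>2" and B: "\<bar>b1\<bar> \<le> c'" "\<bar>b2\<bar> \<le> c'"
      using a1 a2 b1 b2 c' ab order_trans[OF _ mult_right_mono[OF c'(2)]] by (auto simp: a_def)
    have ab0: "\<bar>a0 * b0\<bar> \<le> 1" using a0 b0 by (simp add: abs_mult mult_le_one)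
    have m1: "\<bar>s * t\<bar> \<le> \<bar>s\<bar>" if "\<bar>t\<bar> \<le> 1" for s t :: real
      using that by (simp add: abs_mult mult_left_le)
    have p1: "1 \<le> 1 + a" "1 + a \<le> (1 + a)\<^sup>2" "a\<^sup>2 \<le> (1 + a)\<^sup>2" "1 \<le> (1 + a)\<^sup>2" "a \<le> (1 + a)\<^sup>2"
      using ab by (auto simp: power2_eq_square algebra_simps)
    have T0: "\<bar>a * (a0 * b0) + (3 * a\<^sup>2 * a1 + a ^ 3 * a2) * b0 + a ^ 3 * a0 * b2\<bar> \<le> (1 + 5 * c') * (a * (1 + a)\<^sup>2)"
    proof -
      have t1: "\<bar>a * (a0 * b0)\<bar> \<le> a * (1 + a)\<^sup>2"
      proof -
        have "a \<le> a * (1 + a)\<^sup>2" using mult_left_mono[OF p1(4), of a] ab by simp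
        then show ?thesis using m1[OF ab0, of a] ab by linarith
      qed
      have t2: "\<bar>3 * a\<^sup>2 * a1 * b0\<bar> \<le> 3 * c' * (a * (1 + a)\<^sup>2)"
      proof -
        have "\<bar>3 * a\<^sup>2 * a1 * b0\<bar> \<le> \<bar>3 * a\<^sup>2 * a1\<bar>" by (rule m1[OF b0])
        also have "\<dots> = 3 * a * (a * \<bar>a1\<bar>)" using ab by (simp add: abs_mult power2_eq_square)
        also have "\<dots> \<le> 3 * a * (c' * (1 + a)\<^sup>2)"
          using A1 p1 c' ab by (intro mult_left_mono order_trans[OF A1] ) auto
        finally show ?thesis by (simp add: algebra_simps)
      qed
      have t3: "\<bar>a ^ 3 * a2 * b0\<bar> \<le> c' * (a * (1 + a)\<^sup>2)"
      proof -
        have "\<bar>a ^ 3 * a2 * b0\<bar> \<le> \<bar>a ^ 3 * a2\<bar>" by (rule m1[OF b0])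
        also have "\<dots> = a * (a\<^sup>2 * \<bar>a2\<bar>)" using ab by (simp add: abs_mult power2_eq_square power3_eq_cube)
        also have "\<dots> \<le> a * (c' * (1 + a)\<^sup>2)" using A2 ab by (intro mult_left_mono) auto
        finally show ?thesis by (simp add: algebra_simps)
      qed
      have t4: "\<bar>a ^ 3 * a0 * b2\<bar> \<le> c' * (a * (1 + a)\<^sup>2)"
      proof -
        have "\<bar>a ^ 3 * b2 * a0\<bar> \<le> \<bar>a ^ 3 * b2\<bar>" by (rule m1[OF a0])
        also have "\<dots> = (a * a\<^sup>2) * \<bar>b2\<bar>" using ab by (simp add: abs_mult power2_eq_square power3_eq_cube)
        also have "\<dots> \<le> (a * (1 + a)\<^sup>2) * c'" using B p1 ab by (intro mult_mono) auto
        finally show ?thesis by (simp add: algebra_simps)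
      qed
      have "a * (a0 * b0) + (3 * a\<^sup>2 * a1 + a ^ 3 * a2) * b0 + a ^ 3 * a0 * b2
        = a * (a0 * b0) + 3 * a\<^sup>2 * a1 * b0 + a ^ 3 * a2 * b0 + a ^ 3 * a0 * b2" by (simp add: algebra_simps)
      also have "\<bar>\<dots>\<bar> \<le> (1 + 5 * c') * (a * (1 + a)\<^sup>2)"
        using t1 t2 t3 t4 unfolding distrib_right by linarith
      finally show ?thesis .
    qed
    have T1: "norm (\<i> * C * of_real (3 * a\<^sup>2 * (a0 * b0) + 2 * a ^ 3 * a1 * b0) + of_real (2 * a ^ 3 * a0 * b1)) \<le> (3 + 4 * c') * (b * a * (1 + a)\<^sup>2)"
    proof -
      have t1: "\<bar>3 * a\<^sup>2 * (a0 * b0)\<bar> \<le> 3 * (a * a * (1 + a)\<^sup>2)"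
      proof -
        have "a * a \<le> a * a * (1 + a)\<^sup>2" using mult_left_mono[OF p1(4), of "a * a"] ab by simp
        moreover have "\<bar>3 * a\<^sup>2\<bar> = 3 * (a * a)" by (simp add: power2_eq_square)
        ultimately show ?thesis using m1[OF ab0, of "3 * a\<^sup>2"] by linarith
      qed
      have t2: "\<bar>2 * a ^ 3 * a1 * b0\<bar> \<le> 2 * c' * (a * a * (1 + a)\<^sup>2)"
      proof -
        have "\<bar>2 * a ^ 3 * a1 * b0\<bar> \<le> \<bar>2 * a ^ 3 * a1\<bar>" by (rule m1[OF b0])
        also have "\<dots> = 2 * a * a * (a * \<bar>a1\<bar>)" using ab by (simp add: abs_mult power3_eq_cube)
        also have "\<dots> \<le> 2 * a * a * (c' * (1 + a)\<^sup>2)"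
          using A1 p1 c' ab by (intro mult_left_mono order_trans[OF A1]) auto
        finally show ?thesis by (simp add: algebra_simps)
      qed
      have t3: "\<bar>2 * a ^ 3 * a0 * b1\<bar> \<le> 2 * c' * (b * a * (1 + a)\<^sup>2)"
      proof -
        have "\<bar>2 * a ^ 3 * b1 * a0\<bar> \<le> \<bar>2 * a ^ 3 * b1\<bar>" by (rule m1[OF a0])
        also have "\<dots> = 2 * ((a * a) * a) * \<bar>b1\<bar>" using ab by (simp add: abs_mult power3_eq_cube)
        also have "\<dots> \<le> 2 * ((b * a) * (1 + a)\<^sup>2) * c'" using B p1 ab by (intro mult_mono) auto
        finally show ?thesis by (simp add: algebra_simps)
      qed
      have "norm (\<i> * C * of_real (3 * a\<^sup>2 * (a0 * b0) + 2 * a ^ 3 * a1 * b0)) = C * \<bar>3 * a\<^sup>2 * (a0 * b0) + 2 * a ^ 3 * a1 * b0\<bar>"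
        using C by (simp add: norm_mult del: of_real_add of_real_mult of_real_power)
      also have "\<dots> \<le> C * ((3 + 2 * c') * (a * a * (1 + a)\<^sup>2))"
        using t1 t2 C unfolding distrib_right by (intro mult_left_mono) linarith+
      also have "\<dots> = (3 + 2 * c') * (b * a * (1 + a)\<^sup>2)" by (simp add: b_def algebra_simps)
      finally have "norm (\<i> * C * of_real (3 * a\<^sup>2 * (a0 * b0) + 2 * a ^ 3 * a1 * b0)) \<le> (3 + 2 * c') * (b * a * (1 + a)\<^sup>2)" .
      moreover have "norm (complex_of_real (2 * a ^ 3 * a0 * b1)) \<le> 2 * c' * (b * a * (1 + a)\<^sup>2)"
        using t3 by (simp only: norm_of_real)
      ultimately have "norm (\<i> * C * of_real (3 * a\<^sup>2 * (a0 * b0) + 2 * a ^ 3 * a1 * b0) + of_real (2 * a ^ 3 * a0 * b1))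
         \<le> (3 + 2 * c') * (b * a * (1 + a)\<^sup>2) + 2 * c' * (b * a * (1 + a)\<^sup>2)"
        by (rule norm_triangle_mono)
      also have "\<dots> = (3 + 4 * c') * (b * a * (1 + a)\<^sup>2)" by (simp add: algebra_simps)
      finally show ?thesis .
    qed
    have T2: "\<bar>(1 - C\<^sup>2) * a ^ 3 * (a0 * b0)\<bar> \<le> 2 * b ^ 3"
    proof -
      have "\<bar>(1 - C\<^sup>2) * a ^ 3 * (a0 * b0)\<bar> \<le> \<bar>(1 - C\<^sup>2) * a ^ 3\<bar>" by (rule m1[OF ab0])
      also have "\<dots> = \<bar>1 - C\<^sup>2\<bar> * a ^ 3" using ab by (simp add: abs_mult)
      also have "\<dots> \<le> (2 * C ^ 3) * a ^ 3"
      proof (rule mult_right_mono)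
        have "C\<^sup>2 \<le> C ^ 3" using C by (intro power_increasing) auto
        moreover have "1 \<le> C ^ 3" "0 \<le> C\<^sup>2" using C by auto
        ultimately show "\<bar>1 - C\<^sup>2\<bar> \<le> 2 * C ^ 3" by linarith
      qed (use ab in simp)
      also have "\<dots> = 2 * b ^ 3" by (simp add: b_def power_mult_distrib)
      finally show ?thesis .
    qed
    have g: "0 \<le> g j" for j by (simp add: g_def)
    have ba: "(1 + a)\<^sup>2 \<le> (1 + b)\<^sup>2" "1 \<le> (1 + b)\<^sup>2" using ab by (auto intro!: power_mono one_le_power)
    have S0: "a * (1 + a)\<^sup>2 * g 0 \<le> K0 * e"
    proof -
      have "a * (1 + a)\<^sup>2 * g 0 \<le> b * (1 + b)\<^sup>2 * g 0" using ab ba g by (intro mult_mono) auto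
      also have "\<dots> \<le> K0 * e" using K0(2)[of "zeta C z"] ab by (simp add: e g_def algebra_simps)
      finally show ?thesis .
    qed
    have S1: "b * a * (1 + a)\<^sup>2 * g 1 \<le> K1 * e"
    proof -
      have "b * a * (1 + a)\<^sup>2 * g 1 \<le> b * b * (1 + b)\<^sup>2 * g 1" using ab ba g by (intro mult_mono) auto
      also have "\<dots> \<le> K1 * e" using K1(2)[of "zeta C z"] ab by (simp add: e g_def algebra_simps power2_eq_square)
      finally show ?thesis .
    qed
    have S2: "b ^ 3 * g 2 \<le> K2 * e"
    proof -
      have "1 * (b ^ 3 * g 2) \<le> (1 + b)\<^sup>2 * (b ^ 3 * g 2)" using ab ba g by (intro mult_right_mono) auto
      also have "\<dots> \<le> K2 * e" using K2(2)[of "zeta C z"] ab by (simp add: e g_def numeral_3_eq_3 numeral_2_eq_2)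
      finally show ?thesis by simp
    qed
    have "norm (of_real (a * (a0 * b0) + (3 * a\<^sup>2 * a1 + a ^ 3 * a2) * b0 + a ^ 3 * a0 * b2) * gen_deriv p 0 (zeta C z)
      + (\<i> * C * of_real (3 * a\<^sup>2 * (a0 * b0) + 2 * a ^ 3 * a1 * b0) + of_real (2 * a ^ 3 * a0 * b1)) * gen_deriv p 1 (zeta C z)
      + of_real ((1 - C\<^sup>2) * a ^ 3 * (a0 * b0)) * gen_deriv p 2 (zeta C z))
      \<le> (1 + 5 * c') * (a * (1 + a)\<^sup>2) * g 0 + (3 + 4 * c') * (b * a * (1 + a)\<^sup>2) * g 1 + 2 * b ^ 3 * g 2"
    proof (intro norm_triangle_mono)
      show "norm (complex_of_real (a * (a0 * b0) + (3 * a\<^sup>2 * a1 + a ^ 3 * a2) * b0 + a ^ 3 * a0 * b2) * gen_deriv p 0 (zeta C z)) \<le> (1 + 5 * c') * (a * (1 + a)\<^sup>2) * g 0"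
        unfolding norm_mult norm_of_real g_def using T0 by (intro mult_right_mono) auto
      show "norm ((\<i> * C * of_real (3 * a\<^sup>2 * (a0 * b0) + 2 * a ^ 3 * a1 * b0) + of_real (2 * a ^ 3 * a0 * b1)) * gen_deriv p 1 (zeta C z)) \<le> (3 + 4 * c') * (b * a * (1 + a)\<^sup>2) * g 1"
        unfolding norm_mult[of _ "gen_deriv p 1 (zeta C z)"] g_def using T1 by (intro mult_right_mono) auto
      show "norm (complex_of_real ((1 - C\<^sup>2) * a ^ 3 * (a0 * b0)) * gen_deriv p 2 (zeta C z)) \<le> 2 * b ^ 3 * g 2"
        unfolding norm_mult norm_of_real g_def using T2 by (intro mult_right_mono) auto
    qed
    also have "\<dots> = (1 + 5 * c') * (a * (1 + a)\<^sup>2 * g 0) + (3 + 4 * c') * (b * a * (1 + a)\<^sup>2 * g 1) + 2 * (b ^ 3 * g 2)"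
      by (simp only: mult.assoc)
    also have "\<dots> \<le> (1 + 5 * c') * (K0 * e) + (3 + 4 * c') * (K1 * e) + 2 * (K2 * e)"
      using c' by (intro add_mono mult_left_mono S0 S1 S2) auto
    also have "\<dots> = K * e" by (simp add: K_def algebra_simps)
    finally show "norm (cut_Delta p C z a0 a1 a2 b0 b1 b2) \<le> K * axb_env p C z"
      unfolding a_def e_def cut_Delta_def .
  qed
qed

section \<open>Cutoffs in a and in x\<close>

definition cut_a :: "nat \<Rightarrow> real \<Rightarrow> real" where
  "cut_a n a = bump 0 (real (Suc n) * a - 1) * bump 0 (real (Suc n) - a)"

definition cut_a1 :: "nat \<Rightarrow> real \<Rightarrow> real" where
  "cut_a1 n a = real (Suc n) * bump 1 (real (Suc n) * a - 1) * bump 0 (real (Suc n) - a)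
     - bump 0 (real (Suc n) * a - 1) * bump 1 (real (Suc n) - a)"

definition cut_a2 :: "nat \<Rightarrow> real \<Rightarrow> real" where
  "cut_a2 n a = (real (Suc n))\<^sup>2 * bump 2 (real (Suc n) * a - 1) * bump 0 (real (Suc n) - a)
     - 2 * (real (Suc n) * bump 1 (real (Suc n) * a - 1) * bump 1 (real (Suc n) - a))
     + bump 0 (real (Suc n) * a - 1) * bump 2 (real (Suc n) - a)"

definition cut_x :: "nat \<Rightarrow> real \<Rightarrow> real" where
  "cut_x n x = bump 0 (real (Suc n) - x) * bump 0 (real (Suc n) + x)"

definition cut_x1 :: "nat \<Rightarrow> real \<Rightarrow> real" where
  "cut_x1 n x = bump 0 (real (Suc n) - x) * bump 1 (real (Suc n) + x) - bump 1 (real (Suc n) - x) * bump 0 (real (Suc n) + x)"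

definition cut_x2 :: "nat \<Rightarrow> real \<Rightarrow> real" where
  "cut_x2 n x = bump 2 (real (Suc n) - x) * bump 0 (real (Suc n) + x)
     - 2 * (bump 1 (real (Suc n) - x) * bump 1 (real (Suc n) + x)) + bump 0 (real (Suc n) - x) * bump 2 (real (Suc n) + x)"

lemma bump_DERIV [derivative_intros]:
  assumes "(f has_real_derivative D) (at x)"
  shows "((\<lambda>x. bump 0 (f x)) has_real_derivative bump 1 (f x) * D) (at x)"
    "((\<lambda>x. bump 1 (f x)) has_real_derivative bump 2 (f x) * D) (at x)"
  using DERIV_chain2[OF bump_has_derivative[of 0 "f x"] assms] DERIV_chain2[OF bump_has_derivative[of 1 "f x"] assms]
  by (simp_all del: One_nat_def add: One_nat_def[symmetric])

lemma cut_DERIV: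
  "(cut_a n has_real_derivative cut_a1 n a) (at a)" "(cut_a1 n has_real_derivative cut_a2 n a) (at a)"
  "(cut_x n has_real_derivative cut_x1 n x) (at x)" "(cut_x1 n has_real_derivative cut_x2 n x) (at x)"
  unfolding cut_a_def[abs_def] cut_a1_def[abs_def] cut_a2_def cut_x_def[abs_def] cut_x1_def[abs_def] cut_x2_def
  by (auto intro!: derivative_eq_intros simp: algebra_simps power2_eq_square simp del: One_nat_def)

lemma cut_01: "\<bar>cut_a n a\<bar> \<le> 1" "\<bar>cut_x n x\<bar> \<le> 1"
  by (auto simp: cut_a_def cut_x_def abs_mult bump_0 intro!: mult_le_one)

text \<open>Near a = 0 the cutoff is a function of R a with R = n + 1, so a d/da costs a bounded
  factor: with y = R a - 1 one has R a \<le> 1 + |y|, and \<open>bump_decay\<close> applies. Near a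
  = R it is a translate, and a d/da may cost a factor a; this is the source of the powers of 1 +
  a.\<close>

lemma cut_bounds:
  "\<exists>c\<ge>0. \<forall>n a x. 0 < a \<longrightarrow> a * \<bar>cut_a1 n a\<bar> \<le> c * (1 + a) \<and> a\<^sup>2 * \<bar>cut_a2 n a\<bar> \<le> c * (1 + a)\<^sup>2 \<and>
     \<bar>cut_x1 n x\<bar> \<le> c \<and> \<bar>cut_x2 n x\<bar> \<le> c"
proof -
  obtain d where d: "0 < d" "\<And>x. (1 + \<bar>x\<bar>)\<^sup>2 * \<bar>bump 1 x\<bar> \<le> d" "\<And>x. (1 + \<bar>x\<bar>) ^ 3 * \<bar>bump 2 x\<bar> \<le> d"
    using bump_decay by blast
  \<comment> \<open>2 d accounts for the two ends of a cutoff, 2 d^2 for the mixed product of first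
    derivatives.\<close>
  define c where "c = 2 * d + 2 * d\<^sup>2"
  have c0: "0 \<le> c" using d by (simp add: c_def)
  have low: "s * y \<le> t * y" if "s \<le> t" "0 \<le> y" for s t y :: real using that by (rule mult_right_mono)
  have b1: "\<bar>bump 1 x\<bar> \<le> d" "(1 + \<bar>x\<bar>) * \<bar>bump 1 x\<bar> \<le> d" for x
  proof -
    have "1 \<le> (1 + \<bar>x\<bar>)\<^sup>2" "1 + \<bar>x\<bar> \<le> (1 + \<bar>x\<bar>)\<^sup>2" by (auto simp: power2_eq_square algebra_simps)
    then show "\<bar>bump 1 x\<bar> \<le> d" "(1 + \<bar>x\<bar>) * \<bar>bump 1 x\<bar> \<le> d"
      using low[of 1 "(1 + \<bar>x\<bar>)\<^sup>2" "\<bar>bump 1 x\<bar>"] low[of "1 + \<bar>x\<bar>" "(1 + \<bar>x\<bar>)\<^sup>2" "\<bar>bump 1 x\<bar>"] d(2)[of x]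
      by linarith+
  qed
  have b2: "\<bar>bump 2 x\<bar> \<le> d" "(1 + \<bar>x\<bar>)\<^sup>2 * \<bar>bump 2 x\<bar> \<le> d" for x
  proof -
    have "1 \<le> (1 + \<bar>x\<bar>) ^ 3" "(1 + \<bar>x\<bar>)\<^sup>2 \<le> (1 + \<bar>x\<bar>) ^ 3" by (auto intro: power_increasing one_le_power)
    then show "\<bar>bump 2 x\<bar> \<le> d" "(1 + \<bar>x\<bar>)\<^sup>2 * \<bar>bump 2 x\<bar> \<le> d"
      using low[of 1 "(1 + \<bar>x\<bar>) ^ 3" "\<bar>bump 2 x\<bar>"] low[of "(1 + \<bar>x\<bar>)\<^sup>2" "(1 + \<bar>x\<bar>) ^ 3" "\<bar>bump 2 x\<bar>"] d(3)[of x]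
      by linarith+
  qed
  have b0: "\<bar>bump 0 x\<bar> \<le> 1" for x using bump_0[of x] by simp
  have m: "\<bar>s * bump 0 x\<bar> \<le> \<bar>s\<bar>" "\<bar>bump 0 x * s\<bar> \<le> \<bar>s\<bar>" for s x
    using b0[of x] by (auto simp: abs_mult intro: mult_left_le mult_left_le_one_le)
  show ?thesis
  proof (intro exI[of _ c] conjI allI impI c0)
    fix n :: nat and a x :: real assume a: "0 < a"
    define R where "R = real (Suc n)"
    define y where "y = R * a - 1"
    have Ra: "0 \<le> R * a" "R * a \<le> 1 + \<bar>y\<bar>" using a by (auto simp: R_def y_def)
    have k1: "R * a * \<bar>bump 1 y\<bar> \<le> d" using low[OF Ra(2) abs_ge_zero, of "bump 1 y"] b1(2)[of y] by linarith
    have k1': "\<bar>R * a * bump 1 y\<bar> \<le> d" using k1 Ra(1) by (simp only: abs_mult[of "R * a"] abs_of_nonneg)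
    have k2: "(R * a)\<^sup>2 * \<bar>bump 2 y\<bar> \<le> d"
      using low[OF power_mono[OF Ra(2,1), of 2] abs_ge_zero, of "bump 2 y"] b2(2)[of y] by linarith
    have "a * \<bar>cut_a1 n a\<bar> = \<bar>(R * a * bump 1 y) * bump 0 (R - a) - bump 0 y * (a * bump 1 (R - a))\<bar>"
    proof -
      have "a * \<bar>u\<bar> = \<bar>a * u\<bar>" for u using a by (simp add: abs_mult)
      then show ?thesis
        unfolding cut_a1_def R_def[symmetric] y_def[symmetric] by (simp only:) (intro arg_cong[of _ _ abs], simp add: algebra_simps)
    qed
    also have "\<dots> \<le> \<bar>R * a * bump 1 y\<bar> + \<bar>a * bump 1 (R - a)\<bar>"
      by (intro order_trans[OF abs_triangle_ineq4] add_mono m order_refl)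
    also have "\<dots> \<le> d + a * d"
      using k1' b1(1)[of "R - a"] a by (intro add_mono) (simp_all add: abs_mult mult_left_mono)
    also have "\<dots> \<le> c * (1 + a)" using d a by (simp add: c_def algebra_simps)
    finally show "a * \<bar>cut_a1 n a\<bar> \<le> c * (1 + a)" .
    have "a\<^sup>2 * \<bar>cut_a2 n a\<bar> = \<bar>((R * a)\<^sup>2 * bump 2 y) * bump 0 (R - a) - 2 * ((R * a * bump 1 y) * (a * bump 1 (R - a))) + bump 0 y * (a\<^sup>2 * bump 2 (R - a))\<bar>"
    proof -
      have "a\<^sup>2 * \<bar>u\<bar> = \<bar>a\<^sup>2 * u\<bar>" for u by (simp add: abs_mult)
      then show ?thesis
        unfolding cut_a2_def R_def[symmetric] y_def[symmetric]
        by (simp only:) (intro arg_cong[of _ _ abs], simp add: algebra_simps power2_eq_square)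
    qed
    also have "\<dots> \<le> \<bar>(R * a)\<^sup>2 * bump 2 y\<bar> + \<bar>2 * ((R * a * bump 1 y) * (a * bump 1 (R - a)))\<bar> + \<bar>a\<^sup>2 * bump 2 (R - a)\<bar>"
      by (intro order_trans[OF abs_triangle_ineq] order_trans[OF abs_triangle_ineq4] add_mono m order_refl)
    also have "\<dots> \<le> d + 2 * (d * (a * d)) + a\<^sup>2 * d"
    proof (intro add_mono)
      show "\<bar>(R * a)\<^sup>2 * bump 2 y\<bar> \<le> d" using k2 by (simp add: abs_mult)
      show "\<bar>a\<^sup>2 * bump 2 (R - a)\<bar> \<le> a\<^sup>2 * d" using b2(1)[of "R - a"] by (simp add: abs_mult mult_left_mono)
      have "\<bar>R * a * bump 1 y\<bar> \<le> d" "\<bar>a * bump 1 (R - a)\<bar> \<le> a * d"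
        using k1' b1(1)[of "R - a"] a by (auto simp: abs_mult mult_left_mono)
      then show "\<bar>2 * ((R * a * bump 1 y) * (a * bump 1 (R - a)))\<bar> \<le> 2 * (d * (a * d))"
        using d unfolding abs_mult[of 2] abs_mult[of "R * a * bump 1 y"] by (simp add: mult_mono)
    qed
    also have "\<dots> \<le> c * (1 + a)\<^sup>2"
    proof -
      have "c * (1 + a)\<^sup>2 - (d + 2 * (d * (a * d)) + a\<^sup>2 * d) = d + a\<^sup>2 * d + 4 * (a * d) + 2 * d\<^sup>2 + 2 * (a * d\<^sup>2) + 2 * (a\<^sup>2 * d\<^sup>2)"
        by (simp add: c_def algebra_simps power2_eq_square)
      also have "0 \<le> \<dots>" using d a by simp
      finally show ?thesis by simp
    qed
    finally show "a\<^sup>2 * \<bar>cut_a2 n a\<bar> \<le> c * (1 + a)\<^sup>2" .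
    have "\<bar>cut_x1 n x\<bar> \<le> \<bar>bump 1 (R + x)\<bar> + \<bar>bump 1 (R - x)\<bar>"
      unfolding cut_x1_def R_def[symmetric] by (intro order_trans[OF abs_triangle_ineq4] add_mono m order_refl)
    also have "\<dots> \<le> c" using b1(1)[of "R + x"] b1(1)[of "R - x"] d zero_le_power2[of d] unfolding c_def by linarith
    finally show "\<bar>cut_x1 n x\<bar> \<le> c" .
    have "\<bar>cut_x2 n x\<bar> \<le> \<bar>bump 2 (R - x)\<bar> + \<bar>2 * (bump 1 (R - x) * bump 1 (R + x))\<bar> + \<bar>bump 2 (R + x)\<bar>"
      unfolding cut_x2_def R_def[symmetric]
      by (intro order_trans[OF abs_triangle_ineq] order_trans[OF abs_triangle_ineq4] add_mono m order_refl)
    also have "\<dots> \<le> d + 2 * (d * d) + d"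
      using b2(1)[of "R - x"] b2(1)[of "R + x"] mult_mono[OF b1(1)[of "R - x"] b1(1)[of "R + x"]] d
      unfolding abs_mult[of 2] abs_mult[of "bump 1 (R - x)"] by (intro add_mono) auto
    also have "\<dots> = c" by (simp add: c_def power2_eq_square)
    finally show "\<bar>cut_x2 n x\<bar> \<le> c" .
  qed
qed

text \<open>\<open>bump_decay\<close> offers one power more than these weights use, and the spare
  power gives the limit 0.\<close>

lemma bump_weighted_at_top:
  "((\<lambda>y. (1 + y) * bump 1 y) \<longlongrightarrow> 0) at_top" "((\<lambda>y. (1 + y)\<^sup>2 * bump 2 y) \<longlongrightarrow> 0) at_top"
proof -
  obtain d where d: "0 < d" "\<And>x. (1 + \<bar>x\<bar>)\<^sup>2 * \<bar>bump 1 x\<bar> \<le> d" "\<And>x. (1 + \<bar>x\<bar>) ^ 3 * \<bar>bump 2 x\<bar> \<le> d"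
    using bump_decay by blast
  have lim: "((\<lambda>x::real. d / x) \<longlongrightarrow> 0) at_top"
    by (intro tendsto_divide_0[OF tendsto_const] filterlim_at_top_imp_at_infinity filterlim_ident)
  have *: "norm ((1 + x) ^ k * y) \<le> d / x" if "(1 + \<bar>x\<bar>) ^ (Suc k) * \<bar>y\<bar> \<le> d" "0 < x" for x y :: real and k
  proof -
    have "x * ((1 + x) ^ k * \<bar>y\<bar>) \<le> (1 + x) * ((1 + x) ^ k * \<bar>y\<bar>)" using that by (intro mult_right_mono) auto
    also have "\<dots> \<le> d" using that by (simp add: mult.assoc)
    finally show ?thesis using that by (simp add: abs_mult pos_le_divide_eq mult.commute)
  qed
  have 1: "norm ((1 + x) * bump 1 x) \<le> d / x" if "0 < x" for x
    using *[of x 1 "bump 1 x", unfolded Suc_1 power_one_right] d(2)[of x] that by blast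
  have 2: "norm ((1 + x)\<^sup>2 * bump 2 x) \<le> d / x" if "0 < x" for x
  proof -
    have "Suc 2 = 3" by simp
    then show ?thesis using *[of x 2 "bump 2 x"] d(3)[of x] that by (simp only:)
  qed
  show "((\<lambda>y. (1 + y) * bump 1 y) \<longlongrightarrow> 0) at_top"
    by (rule Lim_null_comparison[OF _ lim], rule eventually_mono[OF eventually_gt_at_top[of 0]]) (rule 1)
  show "((\<lambda>y. (1 + y)\<^sup>2 * bump 2 y) \<longlongrightarrow> 0) at_top"
    by (rule Lim_null_comparison[OF _ lim], rule eventually_mono[OF eventually_gt_at_top[of 0]]) (rule 2)
qed

lemma cut_tendsto:
  assumes a: "0 < a"
  shows "(\<lambda>n. cut_a n a) \<longlonglongrightarrow> 1" "(\<lambda>n. cut_a1 n a) \<longlonglongrightarrow> 0" "(\<lambda>n. cut_a2 n a) \<longlonglongrightarrow> 0"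
    "(\<lambda>n. cut_x n x) \<longlonglongrightarrow> 1" "(\<lambda>n. cut_x1 n x) \<longlonglongrightarrow> 0" "(\<lambda>n. cut_x2 n x) \<longlonglongrightarrow> 0"
proof -
  have R: "filterlim (\<lambda>n. real (Suc n)) at_top sequentially"
    using filterlim_compose[OF filterlim_real_sequentially filterlim_Suc] .
  have R1: "filterlim (\<lambda>n. real (Suc n) * a - 1) at_top sequentially"
    using filterlim_tendsto_add_at_top[OF tendsto_const[of "-1"] filterlim_at_top_mult_tendsto_pos[OF tendsto_const a R]] by simp
  have R2: "filterlim (\<lambda>n. real (Suc n) - y) at_top sequentially" for y
    using filterlim_tendsto_add_at_top[OF tendsto_const[of "-y"] R] by simp
  have R3: "filterlim (\<lambda>n. real (Suc n) + y) at_top sequentially" for y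
    using R2[of "-y"] by simp
  note L = filterlim_compose[OF bump_at_top(1)] filterlim_compose[OF bump_at_top(2)] filterlim_compose[OF bump_at_top(3)]
  \<comment> \<open>With y = (n + 1) a - 1 the factor n + 1 equals (1 + y) / a, a weight covered by
    \<open>bump_weighted_at_top\<close>.\<close>
  have W1: "(\<lambda>n. real (Suc n) * bump 1 (real (Suc n) * a - 1)) \<longlonglongrightarrow> 0"
  proof -
    have "(\<lambda>n. (1 + (real (Suc n) * a - 1)) * bump 1 (real (Suc n) * a - 1) / a) \<longlonglongrightarrow> 0 / a"
      by (intro tendsto_divide filterlim_compose[OF bump_weighted_at_top(1) R1] tendsto_const) (use a in simp)
    then show ?thesis using a by simp
  qed
  have W2: "(\<lambda>n. (real (Suc n))\<^sup>2 * bump 2 (real (Suc n) * a - 1)) \<longlonglongrightarrow> 0"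
  proof -
    have "(\<lambda>n. (1 + (real (Suc n) * a - 1))\<^sup>2 * bump 2 (real (Suc n) * a - 1) / a\<^sup>2) \<longlonglongrightarrow> 0 / a\<^sup>2"
      by (intro tendsto_divide filterlim_compose[OF bump_weighted_at_top(2) R1] tendsto_const) (use a in simp)
    then show ?thesis using a by (simp add: power_mult_distrib)
  qed
  show "(\<lambda>n. cut_a n a) \<longlonglongrightarrow> 1"
    unfolding cut_a_def using tendsto_mult[OF L(1)[OF R1] L(1)[OF R2]] by simp
  show "(\<lambda>n. cut_a1 n a) \<longlonglongrightarrow> 0"
    unfolding cut_a1_def using tendsto_diff[OF tendsto_mult[OF W1 L(1)[OF R2]] tendsto_mult[OF L(1)[OF R1] L(2)[OF R2]]] by simp
  show "(\<lambda>n. cut_a2 n a) \<longlonglongrightarrow> 0"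
    unfolding cut_a2_def
    using tendsto_add[OF tendsto_diff[OF tendsto_mult[OF W2 L(1)[OF R2]] tendsto_mult[OF tendsto_const[of 2] tendsto_mult[OF W1 L(2)[OF R2]]]]
       tendsto_mult[OF L(1)[OF R1] L(3)[OF R2]]] by simp
  show "(\<lambda>n. cut_x n x) \<longlonglongrightarrow> 1"
    unfolding cut_x_def using tendsto_mult[OF L(1)[OF R2] L(1)[OF R3]] by simp
  show "(\<lambda>n. cut_x1 n x) \<longlonglongrightarrow> 0"
    unfolding cut_x1_def using tendsto_diff[OF tendsto_mult[OF L(1)[OF R2] L(2)[OF R3]] tendsto_mult[OF L(2)[OF R2] L(1)[OF R3]]] by simp
  show "(\<lambda>n. cut_x2 n x) \<longlonglongrightarrow> 0"
    unfolding cut_x2_def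
    using tendsto_add[OF tendsto_diff[OF tendsto_mult[OF L(3)[OF R2] L(1)[OF R3]] tendsto_mult[OF tendsto_const[of 2] tendsto_mult[OF L(2)[OF R2] L(2)[OF R3]]]]
       tendsto_mult[OF L(1)[OF R2] L(3)[OF R3]]] by simp
qed

section \<open>Test functions that approximate the wave\<close>

definition cut_wave :: "real \<Rightarrow> real \<Rightarrow> nat \<Rightarrow> real \<times> real \<Rightarrow> complex" where
  "cut_wave p C n z = (if 0 < snd z then of_real (cut_a n (snd z) * cut_x n (fst z)) * (of_real (snd z) * gen_deriv p 0 (zeta C z)) else 0)"

lemma times_cont_diff_on_bump:
  fixes l :: "'a::real_normed_vector \<Rightarrow> real"
  assumes "open S" "bounded_linear l"
  shows "times_cont_diff_on n S (\<lambda>z. complex_of_real (bump 0 (l z + c)))"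
proof (rule times_cont_diff_on_family[OF assms(1), where F = "\<lambda>j z. complex_of_real (bump j (l z + c))" and m = "\<lambda>v. of_real (l v)"])
  fix j z
  have 1: "((\<lambda>z. l z + c) has_derivative l) (at z)"
    using has_derivative_add[OF bounded_linear_imp_has_derivative[OF assms(2)] has_derivative_const[of c]] by simp
  have "(bump j has_derivative (*) (bump (Suc j) (l z + c))) (at (l z + c))"
    using bump_has_derivative[of j "l z + c"] by (simp add: has_field_derivative_def)
  from has_derivative_of_real[OF has_derivative_compose[OF 1 this]]
  show "((\<lambda>z. complex_of_real (bump j (l z + c))) has_derivative (\<lambda>v. of_real (l v) * of_real (bump (Suc j) (l z + c)))) (at z)"
    by (simp add: mult.commute)
qed

lemma cut_wave_smooth:
  assumes C: "0 < C"
  shows "times_cont_diff_on m {z. 0 < snd z} (cut_wave p C n)"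
proof -
  let ?U = "{z::real \<times> real. 0 < snd z}"
  let ?R = "real (Suc n)"
  have l: "bounded_linear (\<lambda>z::real \<times> real. ?R * snd z)" "bounded_linear (\<lambda>z::real \<times> real. - snd z)"
    "bounded_linear (\<lambda>z::real \<times> real. - fst z)" "bounded_linear (\<lambda>z::real \<times> real. fst z)"
    by (auto intro!: bounded_linear_const_mult bounded_linear_fst bounded_linear_snd bounded_linear_minus)
  have g: "times_cont_diff_on m ?U (\<lambda>z. gen_deriv p 0 (zeta C z))"
    by (rule times_cont_diff_on_family[OF open_half_plane, where F = "\<lambda>j z. gen_deriv p j (zeta C z)" and m = "zeta C"],
        rule gen_deriv_zeta_has_derivative) (use C in simp)
  \<comment> \<open>The coordinate a as a chain of derivatives a, 1, 0, 0, ..., with direction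
    factor \<open>snd v\<close>.\<close>
  have "times_cont_diff_on m ?U ((\<lambda>j z. if j = 0 then complex_of_real (snd z) else if j = 1 then 1 else 0) (0::nat))"
    by (rule times_cont_diff_on_family[OF open_half_plane, where m = "\<lambda>v. of_real (snd v)"])
      (auto intro!: derivative_eq_intros)
  then have s: "times_cont_diff_on m ?U (\<lambda>z. complex_of_real (snd z))" by simp
  have "times_cont_diff_on m ?U (\<lambda>z. (complex_of_real (bump 0 (?R * snd z + (- 1))) * complex_of_real (bump 0 (- snd z + ?R))
     * (complex_of_real (bump 0 (- fst z + ?R)) * complex_of_real (bump 0 (fst z + ?R)))) * (complex_of_real (snd z) * gen_deriv p 0 (zeta C z)))"
    by (intro times_cont_diff_on_mult times_cont_diff_on_bump l open_half_plane g s)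
  then show ?thesis
    by (rule times_cont_diff_on_cong[OF open_half_plane, rotated])
       (auto simp: cut_wave_def cut_a_def cut_x_def algebra_simps)
qed

lemma cut_wave_test:
  assumes C: "0 < C"
  shows "cut_wave p C n \<in> test_functions"
proof -
  let ?R = "real (Suc n)"
  let ?K = "{- ?R..?R} \<times> {1 / ?R..?R}"
  have "compact ?K" by (intro compact_Times compact_Icc)
  moreover have "?K \<subseteq> carrier axb"
  proof
    fix z assume "z \<in> ?K"
    then have "1 / ?R \<le> snd z" by (auto simp del: of_nat_Suc)
    moreover have "0 < 1 / ?R" by simp
    ultimately have "0 < snd z" by linarith
    then show "z \<in> carrier axb" unfolding carrier_axb by simp
  qed
  moreover have "cut_wave p C n z = 0" if "z \<notin> ?K" for z
  proof (cases "0 < snd z")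
    case True
    have "?R * snd z - 1 \<le> 0 \<or> ?R - snd z \<le> 0 \<or> ?R - fst z \<le> 0 \<or> ?R + fst z \<le> 0"
      using that by (cases z) (auto simp: field_simps simp del: of_nat_Suc)
    then show ?thesis by (auto simp: cut_wave_def cut_a_def cut_x_def bump_nonpos simp del: of_nat_Suc)
  qed (simp add: cut_wave_def)
  ultimately show ?thesis
    unfolding test_functions_def carrier_axb using cut_wave_smooth[OF C, of _ p n]
    by (auto simp: carrier_axb[symmetric] simp del: of_nat_Suc)
qed

section \<open>Linearity of the Laplacian on test functions\<close>

lemma test_functions_differentiable:
  assumes "f \<in> test_functions" "0 < snd z"
  shows "f differentiable (at z)" "X0 f differentiable (at z)" "X1 f differentiable (at z)"
proof -
  have "times_cont_diff_on (Suc (Suc 0)) {z. 0 < snd z} f"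
    using assms(1) unfolding test_functions_def carrier_axb by blast
  then have d: "f differentiable (at z)" "(\<lambda>z. frechet_derivative f (at z) v) differentiable (at z)" for v
    using assms(2) unfolding times_cont_diff_on.simps by blast+
  show "f differentiable (at z)" by (rule d)
  have s: "(\<lambda>z::real \<times> real. snd z) differentiable (at z)"
    by (rule differentiableI[OF has_derivative_snd[OF has_derivative_ident]])
  show "X0 f differentiable (at z)" "X1 f differentiable (at z)"
    unfolding X0_def X1_def by (intro differentiable_scaleR s d)+
qed

lemma X_linear:
  assumes "\<forall>w. 0 < snd w \<longrightarrow> h w = c * f w + g w" "f differentiable (at z)" "g differentiable (at z)" "0 < snd z"
  shows "X0 h z = c * X0 f z + X0 g z" "X1 h z = c * X1 f z + X1 g z"
proof -
  have "((\<lambda>w. c * f w + g w) has_derivative (\<lambda>v. c * frechet_derivative f (at z) v + frechet_derivative g (at z) v)) (at z)"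
    using assms(2,3) by (intro has_derivative_add has_derivative_mult_right) (simp_all add: frechet_derivative_works[symmetric])
  then have "frechet_derivative h (at z) = (\<lambda>v. c * frechet_derivative f (at z) v + frechet_derivative g (at z) v)"
    by (rule frechet_derivative_half_plane) (use assms in auto)
  then show "X0 h z = c * X0 f z + X0 g z" "X1 h z = c * X1 f z + X1 g z"
    by (simp_all add: X0_def X1_def scaleR_add_right)
qed

lemma Delta_linear:
  assumes f: "f \<in> test_functions" and g: "g \<in> test_functions" and z: "0 < snd z"
  shows "Delta (\<lambda>z. c * f z + g z) z = c * Delta f z + Delta g z"
proof -
  note df = test_functions_differentiable[OF f] and dg = test_functions_differentiable[OF g]
  have x: "\<forall>w. 0 < snd w \<longrightarrow> X0 (\<lambda>z. c * f z + g z) w = c * X0 f w + X0 g w"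
    "\<forall>w. 0 < snd w \<longrightarrow> X1 (\<lambda>z. c * f z + g z) w = c * X1 f w + X1 g w"
    using X_linear[OF _ df(1) dg(1), where h = "\<lambda>z. c * f z + g z"] by blast+
  show ?thesis
    unfolding Delta_def X_linear(1)[OF x(1) df(2)[OF z] dg(2)[OF z] z] X_linear(2)[OF x(2) df(3)[OF z] dg(3)[OF z] z]
    by (simp add: algebra_simps)
qed

lemma test_functions_linear:
  assumes f: "f \<in> test_functions" and g: "g \<in> test_functions"
  shows "(\<lambda>z. c * f z + g z) \<in> test_functions"
proof -
  obtain K L where K: "compact K" "K \<subseteq> carrier axb" "\<And>z. z \<notin> K \<Longrightarrow> f z = 0"
    and L: "compact L" "L \<subseteq> carrier axb" "\<And>z. z \<notin> L \<Longrightarrow> g z = 0"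
    using f g unfolding test_functions_def by blast
  have "compact (K \<union> L)" "K \<union> L \<subseteq> carrier axb" "\<forall>z. z \<notin> K \<union> L \<longrightarrow> c * f z + g z = 0"
    using K L by auto
  moreover have "times_cont_diff_on n (carrier axb) (\<lambda>z. c * f z + g z)" for n
    using f g unfolding test_functions_def carrier_axb
    by (intro times_cont_diff_on_add times_cont_diff_on_mult times_cont_diff_on_const open_half_plane) blast+
  ultimately show ?thesis unfolding test_functions_def by blast
qed

lemma Delta_zero: "Delta (\<lambda>z. 0) = (\<lambda>z. 0)"
  by (simp add: Delta_def X0_def X1_def)

lemma test_functions_zero: "(\<lambda>z. 0) \<in> test_functions"
  unfolding test_functions_def by (auto intro!: times_cont_diff_on_const exI[of _ "{}"])

lemma closed_subspace_Delta_p: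
  assumes p: "1 \<le> p"
  shows "closed_subspace rho p (Delta_p p)"
  unfolding Delta_p_def
proof (rule closed_subspace_closure_op[OF p])
  show "(\<lambda>z. 0, \<lambda>z. 0) \<in> {(f, Delta f) |f. f \<in> test_functions}"
    using test_functions_zero Delta_zero by auto
next
  fix u v u' v' :: "real \<times> real \<Rightarrow> complex" and c
  assume "(u, v) \<in> {(f, Delta f) |f. f \<in> test_functions}" "(u', v') \<in> {(f, Delta f) |f. f \<in> test_functions}"
  then have u: "u \<in> test_functions" "v = Delta u" "u' \<in> test_functions" "v' = Delta u'" by auto
  show "\<exists>(U, V)\<in>{(f, Delta f) |f. f \<in> test_functions}. \<forall>z\<in>space rho. U z = c * u z + u' z \<and> V z = c * v z + v' z"
  proof (rule bexI[of _ "(\<lambda>z. c * u z + u' z, Delta (\<lambda>z. c * u z + u' z))"])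
    show "case (\<lambda>z. c * u z + u' z, Delta (\<lambda>z. c * u z + u' z)) of
      (U, V) \<Rightarrow> \<forall>z\<in>space rho. U z = c * u z + u' z \<and> V z = c * v z + v' z"
      using Delta_linear[OF u(1,3)] by (simp add: u(2,4) space_rho)
    show "(\<lambda>z. c * u z + u' z, Delta (\<lambda>z. c * u z + u' z)) \<in> {(f, Delta f) |f. f \<in> test_functions}"
      using test_functions_linear[OF u(1,3), of c] by blast
  qed
qed

abbreviation cut_Delta_at :: "real \<Rightarrow> real \<Rightarrow> nat \<Rightarrow> real \<times> real \<Rightarrow> complex" where
  "cut_Delta_at p C n z \<equiv> cut_Delta p C z (cut_a n (snd z)) (cut_a1 n (snd z)) (cut_a2 n (snd z))
     (cut_x n (fst z)) (cut_x1 n (fst z)) (cut_x2 n (fst z))"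

lemma Delta_cut_wave:
  assumes "0 < C" "0 < snd z"
  shows "Delta (cut_wave p C n) z = - cut_Delta_at p C n z"
  by (rule Delta_cutoff[OF _ assms(2,1) cut_DERIV]) (simp add: cut_wave_def)

lemma Delta_wave0_eq: "0 < snd z \<Longrightarrow> Delta_wave0 p C z = - cut_Delta p C z 1 0 0 1 0 0"
  by (simp add: Delta_wave0_def cut_Delta_def)

lemma bump_continuous [continuous_intros]:
  "continuous_on S f \<Longrightarrow> continuous_on S (\<lambda>x. bump j (f x))"
  by (rule continuous_on_compose2[of UNIV "bump j"])
    (auto intro!: continuous_at_imp_continuous_on DERIV_isCont[OF bump_has_derivative])

lemma wave0_bound:
  assumes "0 < p"
  shows "\<exists>K>0. \<forall>C z. 1 \<le> C \<longrightarrow> 0 < snd z \<longrightarrow> norm (wave0 p C z) \<le> K * axb_env p C z"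
proof -
  obtain K where K: "0 < K" "\<And>\<zeta>. 0 < Im \<zeta> \<Longrightarrow> (1 + Im \<zeta>)\<^sup>2 * (Im \<zeta> ^ Suc 0 * norm (gen_deriv p 0 \<zeta>)) \<le> K * env p \<zeta>"
    using gen_deriv_env[OF assms, of 0] by blast
  have "norm (wave0 p C z) \<le> K * axb_env p C z" if C: "1 \<le> C" and z: "0 < snd z" for C z
  proof -
    have b: "snd z \<le> C * snd z" "0 < C * snd z" using C z by auto
    have "norm (wave0 p C z) = 1 * (snd z * norm (gen_deriv p 0 (zeta C z)))"
      using z by (simp add: wave0_def norm_mult)
    also have "\<dots> \<le> (1 + C * snd z)\<^sup>2 * (C * snd z * norm (gen_deriv p 0 (zeta C z)))"
      using b z by (intro mult_mono) (auto intro: one_le_power)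
    also have "\<dots> \<le> K * axb_env p C z"
      using K(2)[of "zeta C z"] b z by (simp add: Im_zeta axb_env_def zeta_def[symmetric])
    finally show ?thesis .
  qed
  with K(1) show ?thesis by blast
qed

text \<open>The cut off waves and their Laplacians stay below multiples of one envelope, uniformly
  in n, and converge pointwise. Dominated convergence gives both limits in L^p, hence a point of the
  closure.\<close>

lemma wave0_in_Delta_p:
  assumes p: "1 < p" and C: "1 \<le> C"
  shows "(wave0 p C, Delta_wave0 p C) \<in> Delta_p p"
proof -
  have C0: "0 < C" and p0: "0 < p" and p1: "1 \<le> p" using C p by auto
  obtain c where c: "0 \<le> c" "\<And>n a x. 0 < a \<Longrightarrow> a * \<bar>cut_a1 n a\<bar> \<le> c * (1 + a) \<and> a\<^sup>2 * \<bar>cut_a2 n a\<bar> \<le> c * (1 + a)\<^sup>2 \<and>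
     \<bar>cut_x1 n x\<bar> \<le> c \<and> \<bar>cut_x2 n x\<bar> \<le> c"
    using cut_bounds by blast
  obtain K0 where K0: "0 < K0" "\<And>C z. 1 \<le> C \<Longrightarrow> 0 < snd z \<Longrightarrow> norm (wave0 p C z) \<le> K0 * axb_env p C z"
    using wave0_bound[OF p0] by blast
  obtain K where K: "0 < K" "\<And>C z a0 a1 a2 b0 b1 b2. 1 \<le> C \<Longrightarrow> 0 < snd z \<Longrightarrow>
     \<bar>a0\<bar> \<le> 1 \<Longrightarrow> \<bar>b0\<bar> \<le> 1 \<Longrightarrow> snd z * \<bar>a1\<bar> \<le> c * (1 + snd z) \<Longrightarrow> (snd z)\<^sup>2 * \<bar>a2\<bar> \<le> c * (1 + snd z)\<^sup>2 \<Longrightarrow>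
     \<bar>b1\<bar> \<le> c \<Longrightarrow> \<bar>b2\<bar> \<le> c \<Longrightarrow> norm (cut_Delta p C z a0 a1 a2 b0 b1 b2) \<le> K * axb_env p C z"
    using cutoff_Delta_bound[OF p0, of c] by blast
  have D1: "norm (Delta (cut_wave p C n) z) \<le> K * axb_env p C z" if "0 < snd z" for n z
    unfolding Delta_cut_wave[OF C0 that] norm_minus_cancel
    using that c(2) cut_01 by (intro K C) blast+
  have D2: "norm (Delta_wave0 p C z) \<le> K * axb_env p C z" if "0 < snd z" for z
    unfolding Delta_wave0_eq[OF that] norm_minus_cancel
    by (rule K(2)[OF C that]) (use c(1) that in auto)
  have W: "norm (cut_wave p C n z) \<le> norm (wave0 p C z)" if "0 < snd z" for n z
  proof -
    have "norm (cut_wave p C n z) = \<bar>cut_a n (snd z)\<bar> * \<bar>cut_x n (fst z)\<bar> * norm (wave0 p C z)"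
      using that by (simp add: cut_wave_def wave0_def norm_mult abs_mult)
    also have "\<dots> \<le> 1 * 1 * norm (wave0 p C z)"
      by (intro mult_right_mono mult_mono cut_01) auto
    finally show ?thesis by simp
  qed
  have W1: "norm (cut_wave p C n z) \<le> K0 * axb_env p C z" if "0 < snd z" for n z
    using order_trans[OF W[OF that] K0(2)[OF C that]] .
  note cg = continuous_on_gen_deriv_zeta[OF C0]
  have ct: "continuous_on {z. 0 < snd z} (\<lambda>z. cut_Delta_at p C n z)" for n
    unfolding cut_Delta_def cut_a_def cut_a1_def cut_a2_def cut_x_def cut_x1_def cut_x2_def
    by (intro continuous_intros cg)
  have m1: "Delta (cut_wave p C n) \<in> borel_measurable rho" for n
  proof (subst measurable_cong)
    show "Delta (cut_wave p C n) z = - cut_Delta_at p C n z" if "z \<in> space rho" for z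
      using that by (intro Delta_cut_wave C0) (simp add: space_rho)
  qed (intro measurable_rho_continuous continuous_on_minus ct)
  have m2: "Delta_wave0 p C \<in> borel_measurable rho"
  proof (subst measurable_cong)
    show "Delta_wave0 p C z = - cut_Delta p C z 1 0 0 1 0 0" if "z \<in> space rho" for z
      using that by (intro Delta_wave0_eq) (simp add: space_rho)
  qed (unfold cut_Delta_def, intro measurable_rho_continuous continuous_intros cg)
  have m3: "cut_wave p C n \<in> borel_measurable rho" for n
    using cut_wave_smooth[OF C0, of 0 p n] by (intro measurable_rho_continuous) simp
  have m4: "wave0 p C \<in> borel_measurable rho"
  proof (subst measurable_cong)
    show "wave0 p C z = of_real (snd z) * gen_deriv p 0 (zeta C z)" if "z \<in> space rho" for z
      using that by (simp add: space_rho wave0_def)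
  qed (intro measurable_rho_continuous continuous_intros cg)
  show ?thesis
    unfolding Delta_p_def closure_op_iff[OF p1]
  proof (intro allI impI)
    fix e :: real assume e: "0 < e"
    have "eventually (\<lambda>n. Lp_le rho p (\<lambda>z. cut_wave p C n z - wave0 p C z) e) sequentially"
    proof (rule Lp_le_env_dominated[OF p C0 _ _ _ _ e, where K = "K0 + K0"])
      show "(\<lambda>z. cut_wave p C n z - wave0 p C z) \<in> borel_measurable rho" for n
        using m3[of n] m4 by (rule borel_measurable_diff)
      show "norm (cut_wave p C n z - wave0 p C z) \<le> (K0 + K0) * axb_env p C z" if "0 < snd z" for n z
        unfolding distrib_right using W1[OF that] K0(2)[OF C that] by (intro order_trans[OF norm_triangle_ineq4] add_mono)
      show "(\<lambda>n. cut_wave p C n z - wave0 p C z) \<longlonglongrightarrow> 0" if "0 < snd z" for z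
      proof -
        have "(\<lambda>n. of_real (cut_a n (snd z) * cut_x n (fst z)) * wave0 p C z - wave0 p C z) \<longlonglongrightarrow> of_real (1 * 1) * wave0 p C z - wave0 p C z"
          by (intro tendsto_intros cut_tendsto[OF that])
        then show ?thesis using that by (simp add: cut_wave_def wave0_def)
      qed
    qed (use K0 in simp)
    moreover have "eventually (\<lambda>n. Lp_le rho p (\<lambda>z. Delta (cut_wave p C n) z - Delta_wave0 p C z) e) sequentially"
    proof (rule Lp_le_env_dominated[OF p C0 _ _ _ _ e, where K = "K + K"])
      show "(\<lambda>z. Delta (cut_wave p C n) z - Delta_wave0 p C z) \<in> borel_measurable rho" for n
        using m1[of n] m2 by (rule borel_measurable_diff)
      show "norm (Delta (cut_wave p C n) z - Delta_wave0 p C z) \<le> (K + K) * axb_env p C z" if "0 < snd z" for n z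
        unfolding distrib_right using D1[OF that] D2[OF that] by (intro order_trans[OF norm_triangle_ineq4] add_mono)
      show "(\<lambda>n. Delta (cut_wave p C n) z - Delta_wave0 p C z) \<longlonglongrightarrow> 0" if "0 < snd z" for z
      proof -
        have "(\<lambda>n. - cut_Delta_at p C n z - Delta_wave0 p C z) \<longlonglongrightarrow> - cut_Delta p C z 1 0 0 1 0 0 - Delta_wave0 p C z"
          unfolding cut_Delta_def by (intro tendsto_intros cut_tendsto[OF that])
        then show ?thesis using that by (simp add: Delta_cut_wave[OF C0 that] Delta_wave0_eq[OF that])
      qed
    qed (use K in simp)
    ultimately have "eventually (\<lambda>n. Lp_le rho p (\<lambda>z. cut_wave p C n z - wave0 p C z) e \<and> Lp_le rho p (\<lambda>z. Delta (cut_wave p C n) z - Delta_wave0 p C z) e) sequentially"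
      by (rule eventually_conj)
    then obtain n where n: "Lp_le rho p (\<lambda>z. cut_wave p C n z - wave0 p C z) e" "Lp_le rho p (\<lambda>z. Delta (cut_wave p C n) z - Delta_wave0 p C z) e"
      by (auto simp: eventually_sequentially)
    have "cut_wave p C n \<in> Lp rho p"
      by (rule Lp_le_imp_Lp[OF Lp_le_env[OF p C0 m3, of K0]]) (use K0 W1 in auto)
    moreover have "Delta (cut_wave p C n) \<in> Lp rho p"
      by (rule Lp_le_imp_Lp[OF Lp_le_env[OF p C0 m1, of K]]) (use K D1 in auto)
    ultimately show "\<exists>(u, v)\<in>{(f, Delta f) |f. f \<in> test_functions}. u \<in> Lp rho p \<and> v \<in> Lp rho p \<and>
        Lp_le rho p (\<lambda>z. u z - wave0 p C z) e \<and> Lp_le rho p (\<lambda>z. v z - Delta_wave0 p C z) e"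
      using n cut_wave_test[OF C0, of p n] by (intro bexI[of _ "(cut_wave p C n, Delta (cut_wave p C n))"]) auto
  qed
qed

section \<open>The wave curve\<close>

text \<open>Writing \<open>b = a cosh \<theta>\<close>, \<open>b' = a sinh \<theta>\<close> and \<open>\<zeta> = x + \<i> b\<close>, all \<open>\<theta>\<close>-derivatives of \<open>b' g(\<zeta>)\<close> are combinations
  of products of \<open>b\<^sup>i b'\<^sup>k\<close> and the \<open>j\<close>-th derivative of \<open>g\<close> at \<open>\<zeta>\<close> with \<open>i + k = j + 1\<close>.  By Cauchy's inequality
  on the disc of radius \<open>b / 2\<close> these are all bounded by the same envelope.\<close>

definition wave_mono :: "real \<Rightarrow> nat \<Rightarrow> nat \<Rightarrow> nat \<Rightarrow> real \<Rightarrow> real \<times> real \<Rightarrow> complex" where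
  "wave_mono p i k j \<theta> z = (if 0 < snd z then
     of_real ((snd z * cosh \<theta>) ^ i * (snd z * sinh \<theta>) ^ k) * gen_deriv p j (zeta (cosh \<theta>) z) else 0)"

text \<open>The relation i + k = j + 1 survives \<partial>_\<theta>: differentiating b or b'
  exchanges one for the other, and differentiating g raises j while adding a factor b'. Bounds and
  measurability are proved once for the class, by induction, and then hold for all derivatives of
  the wave.\<close>

inductive_set wave_class :: "real \<Rightarrow> (real \<Rightarrow> real \<times> real \<Rightarrow> complex) set" for p where
  mono: "i + k = Suc j \<Longrightarrow> wave_mono p i k j \<in> wave_class p"
| add: "f \<in> wave_class p \<Longrightarrow> g \<in> wave_class p \<Longrightarrow> (\<lambda>\<theta> z. f \<theta> z + g \<theta> z) \<in> wave_class p"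
| scale: "f \<in> wave_class p \<Longrightarrow> (\<lambda>\<theta> z. c * f \<theta> z) \<in> wave_class p"

lemma wave_class_outside: "f \<in> wave_class p \<Longrightarrow> \<not> 0 < snd z \<Longrightarrow> f \<theta> z = 0"
  by (induction rule: wave_class.induct) (auto simp: wave_mono_def)

lemma gen_deriv_theta:
  assumes "0 < snd z"
  shows "((\<lambda>\<theta>. gen_deriv p j (zeta (cosh \<theta>) z)) has_vector_derivative
     \<i> * of_real (snd z * sinh \<theta>) * gen_deriv p (Suc j) (zeta (cosh \<theta>) z)) (at \<theta>)"
proof -
  have 1: "((\<lambda>\<theta>. zeta (cosh \<theta>) z) has_vector_derivative \<i> * of_real (snd z * sinh \<theta>)) (at \<theta>)"
  proof -
    have "((\<lambda>\<theta>. of_real (fst z) + \<i> * of_real (snd z * cosh \<theta>)) has_vector_derivative 0 + \<i> * of_real (snd z * sinh \<theta>)) (at \<theta>)"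
      by (intro has_vector_derivative_add has_vector_derivative_const has_vector_derivative_mult_right has_vector_derivative_of_real)
         (auto intro!: derivative_eq_intros)
    moreover have "(\<lambda>\<theta>. zeta (cosh \<theta>) z) = (\<lambda>\<theta>. of_real (fst z) + \<i> * of_real (snd z * cosh \<theta>))"
      by (auto simp: zeta_def complex_eq_iff)
    ultimately show ?thesis by simp
  qed
  have "0 < Im (zeta (cosh \<theta>) z)" using assms by (simp add: Im_zeta cosh_real_pos)
  from field_vector_diff_chain_at[OF 1 gen_deriv_has_derivative[OF this, of p j]]
  show ?thesis by (simp add: o_def)
qed

text \<open>The conditionals answer truncated subtraction: for i = 0 or k = 0 the coefficient is 0,
  but the monomial next to it must still satisfy the grading to lie in
  \<open>wave_class\<close>.\<close>

lemma wave_mono_deriv: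
  "((\<lambda>\<theta>. wave_mono p i k j \<theta> z) has_vector_derivative
     of_nat i * wave_mono p (i - 1) (if i = 0 then k else k + 1) j \<theta> z
     + of_nat k * wave_mono p (if k = 0 then i else i + 1) (k - 1) j \<theta> z
     + \<i> * wave_mono p i (k + 1) (Suc j) \<theta> z) (at \<theta>)"
proof (cases "0 < snd z")
  case True
  let ?b = "snd z * cosh \<theta>" and ?b' = "snd z * sinh \<theta>"
  have r: "((\<lambda>\<theta>. (snd z * cosh \<theta>) ^ i * (snd z * sinh \<theta>) ^ k) has_real_derivative
     (of_nat i * ?b ^ (i - 1) * ?b' ) * ?b' ^ k + ?b ^ i * (of_nat k * ?b' ^ (k - 1) * ?b)) (at \<theta>)"
  proof -
    have B: "((\<lambda>\<theta>. snd z * cosh \<theta>) has_real_derivative ?b') (at \<theta>)" "((\<lambda>\<theta>. snd z * sinh \<theta>) has_real_derivative ?b) (at \<theta>)"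
      by (auto intro!: derivative_eq_intros)
    show ?thesis
      using DERIV_mult[OF DERIV_power[OF B(1), of i] DERIV_power[OF B(2), of k]] by (simp add: ac_simps)
  qed
  have "((\<lambda>\<theta>. complex_of_real ((snd z * cosh \<theta>) ^ i * (snd z * sinh \<theta>) ^ k) * gen_deriv p j (zeta (cosh \<theta>) z)) has_vector_derivative
     of_real (?b ^ i * ?b' ^ k) * (\<i> * of_real ?b' * gen_deriv p (Suc j) (zeta (cosh \<theta>) z))
     + of_real ((of_nat i * ?b ^ (i - 1) * ?b' ) * ?b' ^ k + ?b ^ i * (of_nat k * ?b' ^ (k - 1) * ?b)) * gen_deriv p j (zeta (cosh \<theta>) z)) (at \<theta>)"
    by (intro has_vector_derivative_mult has_vector_derivative_of_real r gen_deriv_theta True)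
  then show ?thesis
    unfolding wave_mono_def if_P[OF True]
    by (rule has_vector_derivative_eq_rhs) (auto simp: algebra_simps)
qed (simp add: wave_mono_def)

lemma wave_class_deriv:
  assumes "f \<in> wave_class p"
  shows "\<exists>f'\<in>wave_class p. \<forall>\<theta> z. ((\<lambda>\<theta>. f \<theta> z) has_vector_derivative f' \<theta> z) (at \<theta>)"
  using assms
proof (induction rule: wave_class.induct)
  case (mono i k j)
  have "(\<lambda>\<theta> z. of_nat i * wave_mono p (i - 1) (if i = 0 then k else k + 1) j \<theta> z
     + of_nat k * wave_mono p (if k = 0 then i else i + 1) (k - 1) j \<theta> z
     + \<i> * wave_mono p i (k + 1) (Suc j) \<theta> z) \<in> wave_class p"
    by (intro wave_class.intros) (use mono in auto)
  then show ?case by (rule bexI[rotated]) (intro allI wave_mono_deriv)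
next
  case (add f g)
  then obtain f' g' where *: "f' \<in> wave_class p" "\<forall>\<theta> z. ((\<lambda>\<theta>. f \<theta> z) has_vector_derivative f' \<theta> z) (at \<theta>)"
    "g' \<in> wave_class p" "\<forall>\<theta> z. ((\<lambda>\<theta>. g \<theta> z) has_vector_derivative g' \<theta> z) (at \<theta>)" by blast
  show ?case
    by (rule bexI[OF _ wave_class.add[OF *(1,3)]]) (use *(2,4) in \<open>auto intro!: has_vector_derivative_add\<close>)
next
  case (scale f c)
  then obtain f' where *: "f' \<in> wave_class p" "\<forall>\<theta> z. ((\<lambda>\<theta>. f \<theta> z) has_vector_derivative f' \<theta> z) (at \<theta>)" by blast
  show ?case
    by (rule bexI[OF _ wave_class.scale[OF *(1)]]) (use *(2) in \<open>auto intro!: has_vector_derivative_mult_right\<close>)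
qed

lemma axb_env_zeta: "0 < snd z \<Longrightarrow> axb_env p C z = env p (zeta C z)"
  by (simp add: axb_env_def zeta_def)

text \<open>|sinh \<theta>| \<le> cosh \<theta> lets b' be replaced by b, and b^(i+k) = b^(j+1) is
  the power that the envelope controls.\<close>

lemma wave_class_bound:
  assumes p: "0 < p" and "f \<in> wave_class p"
  shows "\<exists>K\<ge>0. \<forall>\<theta> z. 0 < snd z \<longrightarrow> norm (f \<theta> z) \<le> K * axb_env p (cosh \<theta>) z"
  using assms(2)
proof (induction rule: wave_class.induct)
  case (mono i k j)
  obtain K where K: "0 < K" "\<And>\<zeta>. 0 < Im \<zeta> \<Longrightarrow> (1 + Im \<zeta>)\<^sup>2 * (Im \<zeta> ^ Suc j * norm (gen_deriv p j \<zeta>)) \<le> K * env p \<zeta>"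
    using gen_deriv_env[OF p, of j] by blast
  have "norm (wave_mono p i k j \<theta> z) \<le> K * axb_env p (cosh \<theta>) z" if z: "0 < snd z" for \<theta> z
  proof -
    let ?b = "snd z * cosh \<theta>"
    have b: "0 < ?b" using z by (simp add: cosh_real_pos)
    have "\<bar>sinh \<theta>\<bar> \<le> cosh \<theta>" unfolding abs_le_iff using sinh_le_cosh_real[of \<theta>] sinh_le_cosh_real[of "- \<theta>"] by simp
    then have s: "\<bar>snd z * sinh \<theta>\<bar> \<le> ?b" using z by (simp add: abs_mult mult_left_mono)
    have "norm (wave_mono p i k j \<theta> z) = ?b ^ i * \<bar>snd z * sinh \<theta>\<bar> ^ k * norm (gen_deriv p j (zeta (cosh \<theta>) z))"
      using z b by (simp add: wave_mono_def norm_mult norm_power abs_mult power_abs power_mult_distrib cosh_real_nonneg)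
    also have "\<dots> \<le> ?b ^ i * ?b ^ k * norm (gen_deriv p j (zeta (cosh \<theta>) z))"
      using b s by (intro mult_right_mono mult_left_mono power_mono) auto
    also have "\<dots> = 1 * (?b ^ Suc j * norm (gen_deriv p j (zeta (cosh \<theta>) z)))"
      using mono by (simp add: power_add[symmetric])
    also have "\<dots> \<le> (1 + ?b)\<^sup>2 * (?b ^ Suc j * norm (gen_deriv p j (zeta (cosh \<theta>) z)))"
      using b by (intro mult_right_mono) (auto intro!: one_le_power mult_nonneg_nonneg zero_le_power)
    also have "\<dots> \<le> K * axb_env p (cosh \<theta>) z"
      using K(2)[of "zeta (cosh \<theta>) z"] b z by (simp add: Im_zeta axb_env_zeta mult.commute[of "cosh \<theta>"])
    finally show ?thesis .
  qed
  with K(1) show ?case by (intro exI[of _ K]) auto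
next
  case (add f g)
  then obtain K L where K: "0 \<le> K" "\<And>\<theta> z. 0 < snd z \<Longrightarrow> norm (f \<theta> z) \<le> K * axb_env p (cosh \<theta>) z"
    and L: "0 \<le> L" "\<And>\<theta> z. 0 < snd z \<Longrightarrow> norm (g \<theta> z) \<le> L * axb_env p (cosh \<theta>) z" by blast
  have "norm (f \<theta> z + g \<theta> z) \<le> (K + L) * axb_env p (cosh \<theta>) z" if "0 < snd z" for \<theta> z
    unfolding distrib_right by (intro norm_triangle_mono K L that)
  then show ?case using K L by (intro exI[of _ "K + L"]) auto
next
  case (scale f c)
  then obtain K where K: "0 \<le> K" "\<And>\<theta> z. 0 < snd z \<Longrightarrow> norm (f \<theta> z) \<le> K * axb_env p (cosh \<theta>) z" by blast
  have "norm (c * f \<theta> z) \<le> (norm c * K) * axb_env p (cosh \<theta>) z" if "0 < snd z" for \<theta> z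
    unfolding norm_mult mult.assoc by (intro mult_left_mono K that) simp
  then show ?case using K by (intro exI[of _ "norm c * K"]) auto
qed

lemma wave_class_measurable:
  assumes "f \<in> wave_class p"
  shows "(\<lambda>(\<theta>, z). f \<theta> z) \<in> borel_measurable (borel \<Otimes>\<^sub>M borel)"
  using assms
proof (induction rule: wave_class.induct)
  case (mono i k j)
  let ?U = "{w::real \<times> real \<times> real. 0 < snd (snd w)}"
  have U: "open ?U" by (intro open_Collect_less continuous_intros)
  have h: "continuous_on ?U (\<lambda>w. zeta (cosh (fst w)) (snd w))"
    unfolding zeta_def Complex_eq by (intro continuous_intros)
  have "continuous_on ?U (\<lambda>w. gen_deriv p j (zeta (cosh (fst w)) (snd w)))"
    by (rule continuous_on_compose2[OF holomorphic_on_imp_continuous_on[OF gen_deriv_holomorphic] h])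
      (auto simp: upper_def Im_zeta cosh_real_pos)
  then have "continuous_on ?U (\<lambda>w. of_real ((snd (snd w) * cosh (fst w)) ^ i * (snd (snd w) * sinh (fst w)) ^ k) * gen_deriv p j (zeta (cosh (fst w)) (snd w)))"
    by (intro continuous_intros)
  from borel_measurable_continuous_on_indicator[OF _ this]
  have "(\<lambda>w. indicator ?U w *\<^sub>R (of_real ((snd (snd w) * cosh (fst w)) ^ i * (snd (snd w) * sinh (fst w)) ^ k) * gen_deriv p j (zeta (cosh (fst w)) (snd w)))) \<in> borel_measurable borel"
    using U by simp
  also have "(\<lambda>w. indicator ?U w *\<^sub>R (of_real ((snd (snd w) * cosh (fst w)) ^ i * (snd (snd w) * sinh (fst w)) ^ k) * gen_deriv p j (zeta (cosh (fst w)) (snd w))))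
    = (\<lambda>(\<theta>, z). wave_mono p i k j \<theta> z)"
    by (auto simp: wave_mono_def indicator_def fun_eq_iff)
  finally show ?case by (simp add: borel_prod)
qed (auto simp: split_beta' intro!: borel_measurable_add borel_measurable_times)

section \<open>Envelopes at neighbouring \<theta> and Lipschitz bounds\<close>

lemma cosh_ratio: "\<bar>\<theta> - \<theta>'\<bar> \<le> 1 \<Longrightarrow> cosh \<theta>' \<le> exp 1 * cosh (\<theta>::real)"
proof -
  assume h: "\<bar>\<theta> - \<theta>'\<bar> \<le> 1"
  have "exp \<theta>' \<le> exp 1 * exp \<theta>" "exp (- \<theta>') \<le> exp 1 * exp (- \<theta>)" using h by (auto simp: mult_exp_exp)
  then show ?thesis unfolding cosh_field_def distrib_left times_divide_eq_right by (intro divide_right_mono add_mono) auto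
qed

lemma norm_zeta_ratio:
  assumes "0 < s" "0 < t" "s \<le> exp 1 * t"
  shows "norm (Complex x s) \<le> exp 1 * norm (Complex x t)"
proof -
  have "1 \<le> exp (1::real)" by simp
  then have e: "1 \<le> (exp 1 :: real)\<^sup>2" by (rule one_le_power)
  have "x\<^sup>2 \<le> (exp 1)\<^sup>2 * x\<^sup>2" using mult_right_mono[OF e, of "x\<^sup>2"] by simp
  moreover have "s\<^sup>2 \<le> (exp 1 * t)\<^sup>2" using assms by (intro power_mono) auto
  ultimately have "x\<^sup>2 + s\<^sup>2 \<le> (exp 1)\<^sup>2 * (x\<^sup>2 + t\<^sup>2)" by (simp add: power_mult_distrib distrib_left)
  then have "sqrt (x\<^sup>2 + s\<^sup>2) \<le> sqrt ((exp 1)\<^sup>2 * (x\<^sup>2 + t\<^sup>2))" by (rule real_sqrt_le_mono)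
  then show ?thesis by (simp add: complex_norm real_sqrt_mult)
qed

text \<open>A shift of \<theta> by at most 1 changes b by a factor between 1 / e and e, and
  |\<zeta>| and |\<zeta> + \<i>| by no more than that. This costs e for b, e^\<beta> for the power
  of |\<zeta>| and e^4 for that of |\<zeta> + \<i>|.\<close>

lemma axb_env_ratio:
  assumes p: "0 < p" and h: "\<bar>\<theta> - \<theta>'\<bar> \<le> 1" and z: "0 < snd z"
  shows "axb_env p (cosh \<theta>') z \<le> exp (5 + beta p) * axb_env p (cosh \<theta>) z"
proof -
  let ?b = "cosh \<theta> * snd z" and ?b' = "cosh \<theta>' * snd z"
  let ?n = "norm (Complex (fst z) ?b)" and ?n' = "norm (Complex (fst z) ?b')"
  let ?m = "norm (Complex (fst z) (?b + 1))" and ?m' = "norm (Complex (fst z) (?b' + 1))"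
  have b: "0 < ?b" "0 < ?b'" using z by (auto simp: cosh_real_pos)
  have b1: "?b' \<le> exp 1 * ?b" using cosh_ratio[OF h] z by simp
  have b2: "?b \<le> exp 1 * ?b'" using cosh_ratio[of \<theta>' \<theta>] h z by (simp add: abs_minus_commute)
  have bp: "0 < beta p" using p by (simp add: beta_def add_pos_pos)
  have pos: "0 < ?n" "0 < ?n'" "0 < ?m" "0 < ?m'" using b by (auto simp: complex_eq_iff)
  have n: "?n \<le> exp 1 * ?n'" using b b2 by (intro norm_zeta_ratio) auto
  have m: "?m \<le> exp 1 * ?m'" using b b2 by (intro norm_zeta_ratio) (auto simp: distrib_left add_mono)
  have N: "?n' powr (- beta p) \<le> exp (beta p) * ?n powr (- beta p)"
  proof -
    have "?n' powr (- beta p) \<le> (?n / exp 1) powr (- beta p)"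
      using n pos bp by (intro powr_mono2') (auto simp: divide_le_eq mult.commute)
    also have "\<dots> = exp (beta p) * ?n powr (- beta p)"
      by (simp add: powr_divide powr_minus exp_powr_real field_simps)
    finally show ?thesis .
  qed
  have M: "1 / ?m' ^ 4 \<le> exp 4 * (1 / ?m ^ 4)"
  proof -
    have "1 / ?m' ^ 4 \<le> 1 / (?m / exp 1) ^ 4"
      using m pos by (intro divide_left_mono power_mono mult_pos_pos zero_less_power) (auto simp: divide_le_eq mult.commute)
    also have "\<dots> = exp 4 * (1 / ?m ^ 4)" by (simp add: power_divide exp_of_nat_mult[of 4 1, symmetric])
    finally show ?thesis .
  qed
  have e: "axb_env p (cosh t) z = (cosh t * snd z) * norm (Complex (fst z) (cosh t * snd z)) powr (- beta p) * (1 / norm (Complex (fst z) (cosh t * snd z + 1)) ^ 4)" for t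
  proof -
    have "Complex (fst z) (cosh t * snd z) + \<i> = Complex (fst z) (cosh t * snd z + 1)" by (simp add: complex_eq_iff)
    then show ?thesis using z by (simp add: axb_env_def env_def)
  qed
  have "axb_env p (cosh \<theta>') z \<le> (exp 1 * ?b) * (exp (beta p) * ?n powr (- beta p)) * (exp 4 * (1 / ?m ^ 4))"
    unfolding e using b by (intro mult_mono b1 N M) auto
  also have "\<dots> = (exp 1 * exp (beta p) * exp 4) * axb_env p (cosh \<theta>) z" unfolding e by (simp only: ac_simps)
  also have "exp 1 * exp (beta p) * exp 4 = exp (5 + beta p)" by (simp add: exp_add[symmetric])
  finally show ?thesis .
qed

lemma vector_derivative_mean_bound:
  fixes f :: "real \<Rightarrow> complex"
  assumes "\<And>t. t \<in> {a..b} \<Longrightarrow> (f has_vector_derivative f' t) (at t)" "a \<le> b"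
    "\<And>t. t \<in> {a..b} \<Longrightarrow> norm (f' t) \<le> B"
  shows "norm (f b - f a) \<le> B * (b - a)"
proof -
  have "(f' has_integral f b - f a) {a..b}"
    using assms by (intro fundamental_theorem_of_calculus) (auto intro: has_vector_derivative_at_within)
  moreover have "0 \<le> B" using assms(2) order_trans[OF norm_ge_zero assms(3)[of a]] by auto
  ultimately show ?thesis
    using has_integral_bound[of B "f'" "f b - f a" a b] assms by auto
qed

lemma wave_class_measurable_rho:
  assumes "f \<in> wave_class p"
  shows "f \<theta> \<in> borel_measurable rho"
proof -
  have "(\<lambda>z. (\<lambda>(\<theta>, z). f \<theta> z) (\<theta>, z)) \<in> borel_measurable borel"
    by (rule measurable_compose[OF measurable_Pair1' wave_class_measurable[OF assms]]) simp
  then show ?thesis by (intro measurable_rho) simp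
qed

lemma wave_class_Lp:
  assumes p: "1 < p" and f: "f \<in> wave_class p"
  shows "\<exists>K\<ge>0. \<forall>\<theta>. Lp_le rho p (f \<theta>) K"
proof -
  obtain K where K: "0 \<le> K" "\<And>\<theta> z. 0 < snd z \<Longrightarrow> norm (f \<theta> z) \<le> K * axb_env p (cosh \<theta>) z"
    using wave_class_bound[OF _ f] p by auto
  have "Lp_le rho p (f \<theta>) (K * env_norm p)" for \<theta>
    by (rule Lp_le_env[OF p _ wave_class_measurable_rho[OF f] K]) (simp_all add: cosh_real_pos)
  moreover have "0 \<le> K * env_norm p" using K env_norm(1)[OF p] by simp
  ultimately show ?thesis by blast
qed

text \<open>A mean value estimate in which the envelope at the base point \<theta> bounds the
  derivative on the whole segment. Since it is pointwise in z with a majorant of controlled norm, it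
  passes to L^p.\<close>

lemma wave_class_local_increment:
  assumes p: "1 < p" and f: "f \<in> wave_class p"
  shows "\<exists>K\<ge>0. \<forall>\<theta> \<theta>' z. \<bar>\<theta> - \<theta>'\<bar> \<le> 1 \<longrightarrow> 0 < snd z \<longrightarrow> norm (f \<theta>' z - f \<theta> z) \<le> K * \<bar>\<theta>' - \<theta>\<bar> * axb_env p (cosh \<theta>) z"
proof -
  obtain f' where f': "f' \<in> wave_class p" "\<And>\<theta> z. ((\<lambda>\<theta>. f \<theta> z) has_vector_derivative f' \<theta> z) (at \<theta>)"
    using wave_class_deriv[OF f] by blast
  obtain K where K: "0 \<le> K" "\<And>\<theta> z. 0 < snd z \<Longrightarrow> norm (f' \<theta> z) \<le> K * axb_env p (cosh \<theta>) z"
    using wave_class_bound[OF _ f'(1)] p by auto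
  have "norm (f \<theta>' z - f \<theta> z) \<le> (K * exp (5 + beta p)) * \<bar>\<theta>' - \<theta>\<bar> * axb_env p (cosh \<theta>) z"
    if h: "\<bar>\<theta> - \<theta>'\<bar> \<le> 1" and z: "0 < snd z" for \<theta> \<theta>' z
  proof -
    have d: "norm (f' t z) \<le> K * exp (5 + beta p) * axb_env p (cosh \<theta>) z" if "\<bar>\<theta> - t\<bar> \<le> 1" for t
    proof -
      have "norm (f' t z) \<le> K * axb_env p (cosh t) z" by (rule K(2)[OF z])
      also have "\<dots> \<le> K * (exp (5 + beta p) * axb_env p (cosh \<theta>) z)"
        using p by (intro mult_left_mono axb_env_ratio K that z) auto
      finally show ?thesis by simp
    qed
    show ?thesis
    proof (cases "\<theta> \<le> \<theta>'")
      case True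
      have "norm (f \<theta>' z - f \<theta> z) \<le> K * exp (5 + beta p) * axb_env p (cosh \<theta>) z * (\<theta>' - \<theta>)"
        by (rule vector_derivative_mean_bound[OF f'(2) True d]) (use h in auto)
      then show ?thesis using True by (simp add: ac_simps)
    next
      case False
      have "norm (f \<theta> z - f \<theta>' z) \<le> K * exp (5 + beta p) * axb_env p (cosh \<theta>) z * (\<theta> - \<theta>')"
        by (rule vector_derivative_mean_bound[OF f'(2) _ d]) (use h False in auto)
      then show ?thesis using False by (simp add: ac_simps norm_minus_commute)
    qed
  qed
  moreover have "0 \<le> K * exp (5 + beta p)" using K by simp
  ultimately show ?thesis by blast
qed

lemma wave_class_Lipschitz:
  assumes p: "1 < p" and f: "f \<in> wave_class p"
  shows "\<exists>L\<ge>0. \<forall>\<theta> \<theta>'. Lp_le rho p (\<lambda>z. f \<theta> z - f \<theta>' z) (L * \<bar>\<theta> - \<theta>'\<bar>)"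
proof -
  obtain K where K: "0 \<le> K" "\<And>\<theta>. Lp_le rho p (f \<theta>) K" using wave_class_Lp[OF p f] by blast
  obtain L where L: "0 \<le> L" "\<And>\<theta> \<theta>' z. \<bar>\<theta> - \<theta>'\<bar> \<le> 1 \<Longrightarrow> 0 < snd z \<Longrightarrow> norm (f \<theta>' z - f \<theta> z) \<le> L * \<bar>\<theta>' - \<theta>\<bar> * axb_env p (cosh \<theta>) z"
    using wave_class_local_increment[OF p f] by blast
  \<comment> \<open>The first entry serves increments of length at most 1, the second the longer
    ones, where 2 K \<le> 2 K |\<theta> - \<theta>'|.\<close>
  define D where "D = max (L * env_norm p) (2 * K)"
  have "Lp_le rho p (\<lambda>z. f \<theta> z - f \<theta>' z) (D * \<bar>\<theta> - \<theta>'\<bar>)" for \<theta> \<theta>'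
  proof (cases "\<bar>\<theta> - \<theta>'\<bar> \<le> 1")
    case True
    have "Lp_le rho p (\<lambda>z. f \<theta> z - f \<theta>' z) (L * \<bar>\<theta> - \<theta>'\<bar> * env_norm p)"
    proof (rule Lp_le_env[OF p, of "cosh \<theta>'"])
      show "norm (f \<theta> z - f \<theta>' z) \<le> L * \<bar>\<theta> - \<theta>'\<bar> * axb_env p (cosh \<theta>') z" if "0 < snd z" for z
        using L(2)[of \<theta>' \<theta> z] True that by (simp add: abs_minus_commute)
      show "(\<lambda>z. f \<theta> z - f \<theta>' z) \<in> borel_measurable rho"
        by (rule borel_measurable_diff[OF wave_class_measurable_rho[OF f] wave_class_measurable_rho[OF f]])
    qed (use L(1) in \<open>simp_all add: cosh_real_pos\<close>)
    moreover have "L * \<bar>\<theta> - \<theta>'\<bar> * env_norm p \<le> D * \<bar>\<theta> - \<theta>'\<bar>"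
      using mult_right_mono[of "L * env_norm p" D "\<bar>\<theta> - \<theta>'\<bar>"] by (simp add: D_def ac_simps)
    ultimately show ?thesis by (rule Lp_le_mono) (use p in simp)
  next
    case False
    have "Lp_le rho p (\<lambda>z. f \<theta> z - f \<theta>' z) (K + K)"
      by (rule Lp_le_diff[OF K(2) K(2)]) (use p in simp)
    moreover have "K + K \<le> D * \<bar>\<theta> - \<theta>'\<bar>"
    proof -
      have "(2 * K) * 1 \<le> D * \<bar>\<theta> - \<theta>'\<bar>" using False K(1) by (intro mult_mono) (auto simp: D_def)
      then show ?thesis by simp
    qed
    ultimately show ?thesis by (rule Lp_le_mono) (use p in simp)
  qed
  moreover have "0 \<le> D" using K(1) by (simp add: D_def le_max_iff_disj)
  ultimately show ?thesis by blast
qed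

lemma wave_class_difference_quotient:
  assumes p: "1 < p" and f: "f \<in> wave_class p" and f': "f' \<in> wave_class p"
    and d: "\<And>\<theta> z. ((\<lambda>\<theta>. f \<theta> z) has_vector_derivative f' \<theta> z) (at \<theta>)"
  shows "\<exists>L\<ge>0. \<forall>\<theta> h. 0 < h \<longrightarrow> h \<le> 1 \<longrightarrow>
    Lp_le rho p (\<lambda>z. of_real (1 / h) * (f (\<theta> + h) z - f \<theta> z) - f' \<theta> z) (L * h)"
proof -
  obtain L where L: "0 \<le> L" "\<And>\<theta> \<theta>' z. \<bar>\<theta> - \<theta>'\<bar> \<le> 1 \<Longrightarrow> 0 < snd z \<Longrightarrow> norm (f' \<theta>' z - f' \<theta> z) \<le> L * \<bar>\<theta>' - \<theta>\<bar> * axb_env p (cosh \<theta>) z"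
    using wave_class_local_increment[OF p f'] by blast
  have "Lp_le rho p (\<lambda>z. of_real (1 / h) * (f (\<theta> + h) z - f \<theta> z) - f' \<theta> z) (L * h * env_norm p)" if h: "0 < h" "h \<le> 1" for \<theta> h
  proof (rule Lp_le_env[OF p, of "cosh \<theta>"])
    fix z :: "real \<times> real" assume z: "0 < snd z"
    \<comment> \<open>Subtracting the linear function t f'(\<theta>) leaves the derivative f'(t) -
      f'(\<theta>), which is O(h) on the segment, so the mean value estimate gains a factor
      h.\<close>
    have d': "((\<lambda>t. f t z - t *\<^sub>R f' \<theta> z) has_vector_derivative f' t z - f' \<theta> z) (at t)" for t
    proof -
      have "((\<lambda>t. t *\<^sub>R f' \<theta> z) has_vector_derivative f' \<theta> z) (at t)"
        by (rule has_vector_derivative_eq_rhs[OF has_vector_derivative_scaleR[OF DERIV_ident has_vector_derivative_const]]) simp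
      then show ?thesis by (rule has_vector_derivative_diff[OF d])
    qed
    have "norm ((f (\<theta> + h) z - (\<theta> + h) *\<^sub>R f' \<theta> z) - (f \<theta> z - \<theta> *\<^sub>R f' \<theta> z)) \<le> (L * h * axb_env p (cosh \<theta>) z) * (\<theta> + h - \<theta>)"
    proof (rule vector_derivative_mean_bound[OF d'])
      fix t assume t: "t \<in> {\<theta>..\<theta> + h}"
      have "norm (f' t z - f' \<theta> z) \<le> L * \<bar>t - \<theta>\<bar> * axb_env p (cosh \<theta>) z" using t h by (intro L z) auto
      also have "\<dots> \<le> L * h * axb_env p (cosh \<theta>) z"
        using t h L by (intro mult_right_mono mult_left_mono axb_env_nonneg) (auto simp: cosh_real_pos)
      finally show "norm (f' t z - f' \<theta> z) \<le> L * h * axb_env p (cosh \<theta>) z" .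
    qed (use h in auto)
    also have "(f (\<theta> + h) z - (\<theta> + h) *\<^sub>R f' \<theta> z) - (f \<theta> z - \<theta> *\<^sub>R f' \<theta> z) = of_real h * (of_real (1 / h) * (f (\<theta> + h) z - f \<theta> z) - f' \<theta> z)"
      using h by (simp add: algebra_simps scaleR_conv_of_real)
    finally have "norm (of_real (1 / h) * (f (\<theta> + h) z - f \<theta> z) - f' \<theta> z) * h \<le> L * h * axb_env p (cosh \<theta>) z * h"
      unfolding norm_mult using h by (simp add: mult.commute)
    then show "norm (of_real (1 / h) * (f (\<theta> + h) z - f \<theta> z) - f' \<theta> z) \<le> L * h * axb_env p (cosh \<theta>) z"
      by (rule mult_right_le_imp_le[OF _ h(1)])
  next
    show "(\<lambda>z. of_real (1 / h) * (f (\<theta> + h) z - f \<theta> z) - f' \<theta> z) \<in> borel_measurable rho"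
      using wave_class_measurable_rho[OF f] wave_class_measurable_rho[OF f']
      by (intro borel_measurable_diff borel_measurable_times borel_measurable_const)
  qed (use L(1) h in \<open>simp_all add: cosh_real_pos\<close>)
  moreover have "L * h * env_norm p = (L * env_norm p) * h" for h by simp
  moreover have "0 \<le> L * env_norm p" using L env_norm(1)[OF p] by simp
  ultimately show ?thesis by (intro exI[of _ "L * env_norm p"]) simp
qed

section \<open>The wave and its \<theta>-derivatives\<close>

primrec wave :: "real \<Rightarrow> nat \<Rightarrow> real \<Rightarrow> real \<times> real \<Rightarrow> complex" where
  "wave p 0 = wave_mono p 0 1 0"
| "wave p (Suc j) = (\<lambda>\<theta> z. vector_derivative (\<lambda>\<theta>. wave p j \<theta> z) (at \<theta>))"

lemma wave_in_class: "wave p j \<in> wave_class p"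
proof (induction j)
  case 0
  show ?case by (simp, rule wave_class.mono) simp
next
  case (Suc j)
  then obtain f' where f': "f' \<in> wave_class p" "\<And>\<theta> z. ((\<lambda>\<theta>. wave p j \<theta> z) has_vector_derivative f' \<theta> z) (at \<theta>)"
    using wave_class_deriv by blast
  then have "wave p (Suc j) = f'" by (auto simp: fun_eq_iff vector_derivative_at)
  with f' show ?case by simp
qed

lemma wave_deriv: "((\<lambda>\<theta>. wave p j \<theta> z) has_vector_derivative wave p (Suc j) \<theta> z) (at \<theta>)"
proof -
  obtain f' where f': "\<And>\<theta> z. ((\<lambda>\<theta>. wave p j \<theta> z) has_vector_derivative f' \<theta> z) (at \<theta>)"
    using wave_class_deriv[OF wave_in_class[of p j]] by blast
  show ?thesis using f'[of z \<theta>] unfolding wave.simps(2) vector_derivative_at[OF f'] .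
qed

lemma wave_1: "wave p 1 = (\<lambda>\<theta> z. wave_mono p 1 0 0 \<theta> z + \<i> * wave_mono p 0 2 1 \<theta> z)"
  using wave_mono_deriv[of p 0 1 0] by (auto simp: fun_eq_iff vector_derivative_at numeral_2_eq_2)

lemma wave_2: "wave p 2 = (\<lambda>\<theta> z. wave_mono p 0 1 0 \<theta> z + 3 * \<i> * wave_mono p 1 1 1 \<theta> z - wave_mono p 0 3 2 \<theta> z)"
proof (intro ext)
  fix \<theta> z
  have "((\<lambda>\<theta>. wave p 1 \<theta> z) has_vector_derivative
    (wave_mono p 0 1 0 \<theta> z + 3 * \<i> * wave_mono p 1 1 1 \<theta> z - wave_mono p 0 3 2 \<theta> z)) (at \<theta>)"
    unfolding wave_1
    by (rule has_vector_derivative_eq_rhs[OF has_vector_derivative_add[OF wave_mono_deriv has_vector_derivative_mult_right[OF wave_mono_deriv]]])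
      (simp add: algebra_simps numeral_2_eq_2 numeral_3_eq_3)
  then show "wave p 2 \<theta> z = wave_mono p 0 1 0 \<theta> z + 3 * \<i> * wave_mono p 1 1 1 \<theta> z - wave_mono p 0 3 2 \<theta> z"
    using vector_derivative_at[of "\<lambda>\<theta>. wave p 1 \<theta> z"] by (simp add: numeral_2_eq_2)
qed

text \<open>The wave is odd in \<theta>. Hence its derivatives of even order vanish at \<theta> = 0,
  which removes a boundary term when the resolvents are computed.\<close>

lemma wave_parity: "wave p j (- \<theta>) z = (- 1) ^ Suc j * wave p j \<theta> z"
proof (induction j arbitrary: \<theta>)
  case 0
  show ?case by (simp add: wave_mono_def)
next
  case (Suc j)
  have "((\<lambda>\<theta>. wave p j (- \<theta>) z) has_vector_derivative (- 1) *\<^sub>R wave p (Suc j) (- \<theta>) z) (at \<theta>)"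
    using vector_diff_chain_at[of uminus "- 1" \<theta> "\<lambda>\<theta>. wave p j \<theta> z" "wave p (Suc j) (- \<theta>) z"] wave_deriv[of p j z "- \<theta>"]
    by (simp add: o_def has_vector_derivative_minus)
  moreover have "((\<lambda>\<theta>. wave p j (- \<theta>) z) has_vector_derivative (- 1) ^ Suc j * wave p (Suc j) \<theta> z) (at \<theta>)"
    unfolding Suc by (intro has_vector_derivative_mult_right wave_deriv)
  ultimately have "(- 1) *\<^sub>R wave p (Suc j) (- \<theta>) z = (- 1) ^ Suc j * wave p (Suc j) \<theta> z"
    by (rule vector_derivative_unique_at)
  then show ?case by (simp add: minus_equation_iff)
qed

lemma wave_even_at_0: "even j \<Longrightarrow> wave p j 0 z = 0"
  using wave_parity[of p j 0 z] by simp

text \<open>Only the wave itself is approximated by test functions; its \<open>\<theta>\<close>-derivatives are reached through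
  difference quotients, because the graph is closed.\<close>

lemma wave_in_Delta_p:
  assumes p: "1 < p"
  shows "(wave p j \<theta>, \<lambda>z. - wave p (j + 2) \<theta> z) \<in> Delta_p p"
proof (induction j arbitrary: \<theta>)
  case 0
  have A: "closed_subspace rho p (Delta_p p)" using p by (intro closed_subspace_Delta_p) simp
  have "(\<lambda>z. of_real (sinh \<theta>) * wave0 p (cosh \<theta>) z, \<lambda>z. of_real (sinh \<theta>) * Delta_wave0 p (cosh \<theta>) z) \<in> Delta_p p"
    by (intro closed_subspace_scale[OF A] wave0_in_Delta_p p cosh_real_ge_1)
  also have "(\<lambda>z. of_real (sinh \<theta>) * wave0 p (cosh \<theta>) z) = wave p 0 \<theta>"
    by (auto simp: fun_eq_iff wave0_def wave_mono_def)
  also have "(\<lambda>z. of_real (sinh \<theta>) * Delta_wave0 p (cosh \<theta>) z) = (\<lambda>z. - wave p (0 + 2) \<theta> z)"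
  proof
    fix z :: "real \<times> real"
    \<comment> \<open>Turns the coefficient (1 - C^2) a^3 of the second derivative, times sinh
      \<theta>, into - b'^3, as found by differentiating the wave twice in \<theta>.\<close>
    have c: "1 - (cosh \<theta>)\<^sup>2 = - (sinh \<theta>)\<^sup>2" by (simp add: cosh_square_eq)
    show "of_real (sinh \<theta>) * Delta_wave0 p (cosh \<theta>) z = - wave p (0 + 2) \<theta> z"
      unfolding add_0 wave_2 wave_mono_def Delta_wave0_def c
      by (simp add: algebra_simps power2_eq_square power3_eq_cube)
  qed
  finally show ?case .
next
  case (Suc j)
  have A: "closed_subspace rho p (Delta_p p)" using p by (intro closed_subspace_Delta_p) simp
  have W: "(\<lambda>\<theta> z. - 1 * wave p (j + 2) \<theta> z) \<in> wave_class p" "(\<lambda>\<theta> z. - 1 * wave p (Suc j + 2) \<theta> z) \<in> wave_class p"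
    by (intro wave_class.scale wave_in_class)+
  have d: "((\<lambda>\<theta>. - 1 * wave p (j + 2) \<theta> z) has_vector_derivative - 1 * wave p (Suc j + 2) \<theta> z) (at \<theta>)" for \<theta> z
    using has_vector_derivative_mult_right[OF wave_deriv[of p "j + 2" z \<theta>], of "- 1"] by simp
  obtain L where L: "0 \<le> L" "\<And>\<theta> h. 0 < h \<Longrightarrow> h \<le> 1 \<Longrightarrow>
    Lp_le rho p (\<lambda>z. of_real (1 / h) * (wave p j (\<theta> + h) z - wave p j \<theta> z) - wave p (Suc j) \<theta> z) (L * h)"
    using wave_class_difference_quotient[OF p wave_in_class wave_in_class wave_deriv, of j] by blast
  obtain D where D: "0 \<le> D" "\<And>\<theta> h. 0 < h \<Longrightarrow> h \<le> 1 \<Longrightarrow>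
    Lp_le rho p (\<lambda>z. of_real (1 / h) * (- 1 * wave p (j + 2) (\<theta> + h) z - - 1 * wave p (j + 2) \<theta> z) - - 1 * wave p (Suc j + 2) \<theta> z) (D * h)"
    using wave_class_difference_quotient[OF p W d] by blast
  show ?case
  proof (rule closed_subspaceD(5)[OF A])
    fix e :: real assume e: "0 < e"
    define h where "h = min 1 (e / (L + D + 1))"
    have s: "0 < L + D + 1" using L D by simp
    have h: "0 < h" "h \<le> 1" using e s by (auto simp: h_def)
    have "h * (L + D + 1) \<le> e" using s by (simp add: h_def pos_le_divide_eq[symmetric])
    then have "h * L + h * D + h \<le> e" by (simp add: distrib_left)
    moreover have "0 \<le> h * L" "0 \<le> h * D" using h L D by auto
    ultimately have he: "L * h \<le> e" "D * h \<le> e" using h by (auto simp: mult.commute)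
    define u where "u = (\<lambda>z. of_real (1 / h) * (- 1 * wave p j \<theta> z + wave p j (\<theta> + h) z))"
    define v where "v = (\<lambda>z. of_real (1 / h) * (- 1 * - wave p (j + 2) \<theta> z + - wave p (j + 2) (\<theta> + h) z))"
    have uv: "(u, v) \<in> Delta_p p"
      unfolding u_def v_def
      by (rule closed_subspace_scale[OF A closed_subspaceD(3)[OF A Suc.IH Suc.IH]])
    have p0: "0 < p" using p by simp
    have "Lp_le rho p (\<lambda>z. u z - wave p (Suc j) \<theta> z) e"
      using Lp_le_mono[OF L(2)[OF h] he(1) p0] by (simp add: u_def)
    moreover have "Lp_le rho p (\<lambda>z. v z - - wave p (Suc j + 2) \<theta> z) e"
      using Lp_le_mono[OF D(2)[OF h] he(2) p0] by (simp add: v_def)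
    ultimately show "\<exists>(u, v)\<in>Delta_p p. Lp_le rho p (\<lambda>z. u z - wave p (Suc j) \<theta> z) e \<and> Lp_le rho p (\<lambda>z. v z - - wave p (Suc j + 2) \<theta> z) e"
      using uv by blast
  qed
qed

section \<open>Kernels of the powers of the resolvent\<close>

lemma poly_antiderivative: "\<exists>Q. pderiv Q = (R :: real poly)"
proof -
  define Q where "Q = (\<Sum>i\<le>degree R. monom (coeff R i / real (Suc i)) (Suc i))"
  have sum: "pderiv (sum f A) = (\<Sum>i\<in>A. pderiv (f i))" for f :: "nat \<Rightarrow> real poly" and A
    by (induction A rule: infinite_finite_induct) (simp_all add: pderiv_add)
  have "pderiv Q = (\<Sum>i\<le>degree R. monom (coeff R i) i)"
    unfolding Q_def sum by (intro sum.cong refl) (simp add: pderiv_monom del: of_nat_Suc)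
  then show ?thesis by (metis poly_as_sum_of_monoms)
qed

text \<open>The operator 2 - d/dx is invertible on polynomials because d/dx lowers the degree. If S
  solves the equation for q', then (q + S) / 2 solves it for q.\<close>

lemma poly_first_order_ode: "\<exists>R. smult 2 R - pderiv R = (q :: real poly)"
proof (induction "degree q" arbitrary: q rule: less_induct)
  case less
  show ?case
  proof (cases "degree q = 0")
    case True
    then obtain c where "q = [:c:]" by (rule degree_eq_zeroE)
    then show ?thesis by (intro exI[of _ "[:c/2:]"]) simp
  next
    case False
    then have "degree (pderiv q) < degree q" by (simp add: degree_pderiv)
    then obtain S where S: "smult 2 S - pderiv S = pderiv q" using less by blast
    have "smult 2 (smult (1/2) (q + S)) - pderiv (smult (1/2) (q + S)) = q + S - smult (1/2) (pderiv q + pderiv S)"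
      by (simp add: pderiv_smult pderiv_add)
    also have "pderiv q + pderiv S = smult 2 S" using S by (simp add: algebra_simps)
    finally show ?thesis by (intro exI[of _ "smult (1/2) (q + S)"]) simp
  qed
qed

text \<open>1 - d^2/d\<eta>^2 maps Q exp (- \<eta>) to (2 Q' - Q'') exp (- \<eta>). The equation is
  of first order in Q', and the constant of integration in Q is spent on the condition at 0.\<close>

lemma kernel_poly_step:
  "\<exists>Q. smult 2 (pderiv Q) - pderiv (pderiv Q) = (q :: real poly) \<and> poly (pderiv Q) 0 = poly Q 0"
proof -
  obtain R where R: "smult 2 R - pderiv R = q" using poly_first_order_ode by blast
  obtain Q where Q: "pderiv Q = R" using poly_antiderivative by blast
  define Q' where "Q' = Q + [:poly R 0 - poly Q 0:]"
  have "pderiv Q' = R" by (simp add: Q'_def pderiv_add Q pderiv_pCons)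
  moreover have "poly Q' 0 = poly R 0" by (simp add: Q'_def)
  ultimately show ?thesis using R by (intro exI[of _ Q']) simp
qed

text \<open>On the half line \<open>kernel_poly i * exp (- \<eta>)\<close> is the convolution kernel of the \<open>(i + 1)\<close>-st power of the resolvent
  \<open>(1 - d\<^sup>2 / d\<eta>\<^sup>2)\<^sup>-\<^sup>1\<close>, an even function on the line.  For \<open>i > 0\<close> it is differentiable at \<open>0\<close>, whence the
  condition on the value there.\<close>

primrec kernel_poly :: "nat \<Rightarrow> real poly" where
  "kernel_poly 0 = [:1/2:]"
| "kernel_poly (Suc i) = (SOME Q. smult 2 (pderiv Q) - pderiv (pderiv Q) = kernel_poly i \<and> poly (pderiv Q) 0 = poly Q 0)"

lemma kernel_poly_Suc:
  "smult 2 (pderiv (kernel_poly (Suc i))) - pderiv (pderiv (kernel_poly (Suc i))) = kernel_poly i"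
  "poly (pderiv (kernel_poly (Suc i))) 0 = poly (kernel_poly (Suc i)) 0"
  using someI_ex[OF kernel_poly_step[of "kernel_poly i"]] by simp_all

declare kernel_poly.simps(2) [simp del]

definition ker :: "nat \<Rightarrow> real \<Rightarrow> real" where
  "ker i \<eta> = poly (kernel_poly i) \<eta> * exp (- \<eta>)"

definition ker' :: "nat \<Rightarrow> real \<Rightarrow> real" where
  "ker' i \<eta> = poly (pderiv (kernel_poly i) - kernel_poly i) \<eta> * exp (- \<eta>)"

lemma poly_exp_DERIV:
  "((\<lambda>\<eta>. poly q \<eta> * exp (- \<eta>)) has_real_derivative poly (pderiv q - q) \<eta> * exp (- \<eta>)) (at \<eta>)"
  by (auto intro!: derivative_eq_intros simp: algebra_simps)

text \<open>Since \<open>ker'\<close> is the first derivative, the last two clauses say that 1 -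
  d^2/d\<eta>^2 annihilates \<open>ker 0\<close> on the half line and lowers the index of the other
  kernels by one.\<close>

lemma ker_DERIV:
  "(ker i has_real_derivative ker' i \<eta>) (at \<eta>)"
  "(ker' 0 has_real_derivative ker 0 \<eta>) (at \<eta>)"
  "(ker' (Suc i) has_real_derivative ker (Suc i) \<eta> - ker i \<eta>) (at \<eta>)"
proof -
  show "(ker i has_real_derivative ker' i \<eta>) (at \<eta>)"
    unfolding ker_def[abs_def] ker'_def by (rule poly_exp_DERIV)
  show "(ker' 0 has_real_derivative ker 0 \<eta>) (at \<eta>)"
    using poly_exp_DERIV[of "pderiv (kernel_poly 0) - kernel_poly 0" \<eta>]
    unfolding ker_def ker'_def[abs_def] by (simp add: pderiv_pCons pderiv_diff)
  let ?q = "kernel_poly (Suc i)"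
  have s2: "smult 2 r = r + r" for r :: "real poly" using smult_add_left[of 1 1 r] by simp
  have "pderiv (pderiv ?q - ?q) - (pderiv ?q - ?q) = ?q - (smult 2 (pderiv ?q) - pderiv (pderiv ?q))"
    unfolding s2 by (simp add: pderiv_diff)
  also have "\<dots> = ?q - kernel_poly i" by (simp only: kernel_poly_Suc)
  finally have q: "pderiv (pderiv ?q - ?q) - (pderiv ?q - ?q) = ?q - kernel_poly i" .
  have "poly (?q - kernel_poly i) \<eta> * exp (- \<eta>) = ker (Suc i) \<eta> - ker i \<eta>"
    by (simp add: ker_def left_diff_distrib)
  then show "(ker' (Suc i) has_real_derivative ker (Suc i) \<eta> - ker i \<eta>) (at \<eta>)"
    using poly_exp_DERIV[of "pderiv ?q - ?q" \<eta>, unfolded q] unfolding ker'_def[abs_def] by simp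
qed

text \<open>The derivative of the even kernel exp (- |\<eta>|) / 2 jumps by - 1 at 0, half of it on
  each side; the later kernels have no corner.\<close>

lemma ker'_at_0: "ker' 0 0 = - 1/2" "ker' (Suc i) 0 = 0"
  using kernel_poly_Suc(2)[of i] by (simp_all add: ker'_def pderiv_pCons)

section \<open>Integration by parts against the kernels\<close>

lemma poly_exp_bound:
  fixes q :: "real poly"
  shows "\<exists>C>0. \<forall>\<eta>\<ge>0. \<bar>poly q \<eta> * exp (- \<eta>)\<bar> \<le> C / (1 + \<eta>\<^sup>2)"
proof -
  obtain C where C: "C > 0" "\<And>u. 0 \<le> u \<Longrightarrow> \<bar>poly ([:1, 0, 1:] * q) u\<bar> \<le> C * exp (1 * u)"
    using poly_le_exp[of 1 "[:1, 0, 1:] * q"] by auto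
  have "\<bar>poly q \<eta> * exp (- \<eta>)\<bar> \<le> C / (1 + \<eta>\<^sup>2)" if "0 \<le> \<eta>" for \<eta>
  proof -
    have p: "0 < 1 + \<eta>\<^sup>2" by (simp add: add_pos_nonneg)
    have "(1 + \<eta>\<^sup>2) * \<bar>poly q \<eta>\<bar> = \<bar>poly ([:1, 0, 1:] * q) \<eta>\<bar>"
    proof -
      have "poly ([:1, 0, 1:] * q) \<eta> = (1 + \<eta>\<^sup>2) * poly q \<eta>" by (simp add: power2_eq_square algebra_simps)
      then show ?thesis using p by (simp only: abs_mult abs_of_pos)
    qed
    also have "\<dots> \<le> C * exp \<eta>" using C(2)[OF that] by simp
    finally have "(1 + \<eta>\<^sup>2) * \<bar>poly q \<eta>\<bar> * exp (- \<eta>) \<le> C * exp \<eta> * exp (- \<eta>)"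
      by (intro mult_right_mono) auto
    also have "\<dots> = C" by (simp add: exp_minus)
    finally show ?thesis using p by (simp add: abs_mult pos_le_divide_eq ac_simps)
  qed
  with C show ?thesis by blast
qed

lemma inverse_square_profile: "0 < C \<Longrightarrow> 0 < \<eta> \<Longrightarrow> C / (1 + \<eta>\<^sup>2) \<le> C * power_profile 0 (- 2) \<eta>"
proof -
  assume C: "0 < C" and \<eta>: "0 < \<eta>"
  have "1 / (1 + \<eta>\<^sup>2) \<le> power_profile 0 (- 2) \<eta>"
  proof (cases "\<eta> \<le> 1")
    case True
    then show ?thesis using \<eta> by (simp add: power_profile_def divide_le_eq_1 add_pos_nonneg)
  next
    case False
    then have "1 / (1 + \<eta>\<^sup>2) \<le> 1 / \<eta>\<^sup>2" by (intro divide_left_mono mult_pos_pos) (auto simp: add_pos_nonneg)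
    then show ?thesis using False by (simp add: power_profile_def powr_minus powr_numeral inverse_eq_divide)
  qed
  from mult_left_mono[OF this, of C] C show ?thesis by simp
qed

lemma integrable_half_line_bound:
  fixes f :: "real \<Rightarrow> complex"
  assumes "f \<in> borel_measurable borel" "0 < C" "\<And>\<eta>. 0 < \<eta> \<Longrightarrow> norm (f \<eta>) \<le> C / (1 + \<eta>\<^sup>2)"
  shows "integrable half_line f"
proof -
  have m: "f \<in> borel_measurable half_line" using assms(1) by (rule measurable_half_line)
  have "(\<integral>\<^sup>+\<eta>. ennreal (norm (f \<eta>)) \<partial>half_line) \<le> (\<integral>\<^sup>+\<eta>. ennreal C * ennreal (power_profile 0 (- 2) \<eta>) \<partial>half_line)"
  proof (rule nn_integral_mono)
    fix \<eta> assume "\<eta> \<in> space half_line"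
    then have "0 < \<eta>" by (simp add: space_restrict_space)
    then have "norm (f \<eta>) \<le> C * power_profile 0 (- 2) \<eta>"
      using assms(3)[of \<eta>] inverse_square_profile[OF assms(2), of \<eta>] by linarith
    then show "ennreal (norm (f \<eta>)) \<le> ennreal C * ennreal (power_profile 0 (- 2) \<eta>)"
      using assms(2) by (simp add: ennreal_mult[symmetric] power_profile_nonneg ennreal_leI)
  qed
  also have "\<dots> = ennreal C * (\<integral>\<^sup>+\<eta>. ennreal (power_profile 0 (- 2) \<eta>) \<partial>half_line)"
    by (intro nn_integral_cmult measurable_half_line) measurable
  also have "\<dots> < \<infinity>" using power_profile_integral[of 0 "- 2"] by (simp add: ennreal_mult_less_top)
  finally show ?thesis using m by (simp add: integrable_iff_bounded)
qed

lemma half_line_FTC: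
  fixes F f :: "real \<Rightarrow> complex"
  assumes F: "\<And>x. (F has_vector_derivative f x) (at x)" and f: "continuous_on UNIV f"
    and i: "integrable half_line f" and lim: "(F \<longlongrightarrow> 0) at_top"
  shows "(\<integral>x. f x \<partial>half_line) = - F 0"
proof -
  have e: "einterval 0 \<infinity> = {0::real<..}" by (auto simp: einterval_def)
  have si: "set_integrable lborel (einterval 0 \<infinity>) f"
    using i unfolding e set_integrable_def by (subst (asm) integrable_restrict_space) auto
  have cont: "isCont F 0" using F by (rule has_vector_derivative_continuous)
  have "(LBINT x=0..\<infinity>. f x) = 0 - F 0"
  proof (rule interval_integral_FTC_integrable[OF _ F _ si])
    show "isCont f x" for x using f by (simp add: continuous_on_eq_continuous_at)
    have "(F \<longlongrightarrow> F 0) (at_right 0)" using cont by (simp add: isCont_def filterlim_at_split)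
    then show "((F \<circ> real_of_ereal) \<longlongrightarrow> F 0) (at_right 0)"
      unfolding zero_ereal_def by (simp only: ereal_tendsto_simps)
    show "((F \<circ> real_of_ereal) \<longlongrightarrow> 0) (at_left \<infinity>)" using lim by (simp add: ereal_tendsto_simps)
  qed simp
  moreover have "(LBINT x=0..\<infinity>. f x) = (\<integral>x. f x \<partial>half_line)"
    unfolding interval_lebesgue_integral_def set_lebesgue_integral_def e
    by (subst integral_restrict_space) auto
  ultimately show ?thesis by simp
qed

text \<open>Green's formula on the half line: ker' h - ker h' has the derivative ker'' h - ker h''
  and vanishes at infinity. At 0 the second term drops out by h'(0) = 0, and the first leaves h(0) /
  2 for index 0 and nothing for the later ones.\<close>

lemma ker_integral_identity:
  fixes h h1 h2 :: "real \<Rightarrow> complex"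
  assumes h: "\<And>x. (h has_vector_derivative h1 x) (at x)" "\<And>x. (h1 has_vector_derivative h2 x) (at x)"
    and c2: "continuous_on UNIV h2"
    and B: "\<And>x. norm (h x) \<le> B" "\<And>x. norm (h1 x) \<le> B" "\<And>x. norm (h2 x) \<le> B"
  shows "integrable half_line (\<lambda>x. ker i x *\<^sub>R h x)"
    and "h1 0 = 0 \<Longrightarrow> (\<integral>x. ker 0 x *\<^sub>R h x \<partial>half_line) - (\<integral>x. ker 0 x *\<^sub>R h2 x \<partial>half_line) = h 0 / 2"
    and "h1 0 = 0 \<Longrightarrow> (\<integral>x. ker (Suc i) x *\<^sub>R h x \<partial>half_line) - (\<integral>x. ker (Suc i) x *\<^sub>R h2 x \<partial>half_line) = (\<integral>x. ker i x *\<^sub>R h x \<partial>half_line)"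
proof -
  have c0: "continuous_on UNIV h" and c1: "continuous_on UNIV h1"
    using h by (auto intro!: continuous_at_imp_continuous_on has_vector_derivative_continuous)
  have ck: "continuous_on UNIV (ker j)" "continuous_on UNIV (ker' j)" for j
    unfolding ker_def ker'_def by (intro continuous_intros)+
  have B0: "0 \<le> B" using order_trans[OF norm_ge_zero B(1)] .
  have bound: "\<exists>C>0. \<forall>x\<ge>0. norm ((poly q x * exp (- x)) *\<^sub>R f x) \<le> C / (1 + x\<^sup>2)" if "\<And>x. norm (f x) \<le> B" for q :: "real poly" and f :: "real \<Rightarrow> complex"
  proof -
    obtain C where C: "C > 0" "\<And>\<eta>. 0 \<le> \<eta> \<Longrightarrow> \<bar>poly q \<eta> * exp (- \<eta>)\<bar> \<le> C / (1 + \<eta>\<^sup>2)" using poly_exp_bound by blast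
    have "norm ((poly q x * exp (- x)) *\<^sub>R f x) \<le> (C * (B + 1)) / (1 + x\<^sup>2)" if "0 \<le> x" for x
    proof -
      have "norm ((poly q x * exp (- x)) *\<^sub>R f x) \<le> (C / (1 + x\<^sup>2)) * (B + 1)"
        unfolding norm_scaleR using C(1) by (intro mult_mono C(2) that order_trans[OF \<open>\<And>x. norm (f x) \<le> B\<close>]) auto
      then show ?thesis by simp
    qed
    moreover have "0 < C * (B + 1)" using C B0 by simp
    ultimately show ?thesis by blast
  qed
  have int: "integrable half_line (\<lambda>x. ker j x *\<^sub>R f x)" if f: "\<And>x. norm (f x) \<le> B" and cf: "continuous_on UNIV f" for j and f :: "real \<Rightarrow> complex"
  proof -
    obtain C where C: "0 < C" "\<forall>x\<ge>0. norm ((poly (kernel_poly j) x * exp (- x)) *\<^sub>R f x) \<le> C / (1 + x\<^sup>2)"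
      using bound[where f = f and q = "kernel_poly j", OF f] by (elim exE conjE) (rule that)
    show ?thesis
    proof (rule integrable_half_line_bound[OF _ C(1)])
      show "(\<lambda>x. ker j x *\<^sub>R f x) \<in> borel_measurable borel"
        by (intro borel_measurable_continuous_onI continuous_on_scaleR ck cf)
      show "norm (ker j x *\<^sub>R f x) \<le> C / (1 + x\<^sup>2)" if "0 < x" for x
        unfolding ker_def by (rule C(2)[rule_format]) (use that in simp)
    qed
  qed
  show "integrable half_line (\<lambda>x. ker i x *\<^sub>R h x)" by (rule int[where f = h, OF B(1) c0])
  have lim: "((\<lambda>x. (poly q x * exp (- x)) *\<^sub>R f x) \<longlongrightarrow> 0) at_top" if f: "\<And>x. norm (f x) \<le> B" for q :: "real poly" and f :: "real \<Rightarrow> complex"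
  proof -
    obtain C where C: "C > 0" "\<forall>x\<ge>0. norm ((poly q x * exp (- x)) *\<^sub>R f x) \<le> C / (1 + x\<^sup>2)"
      using bound[where f = f and q = q, OF f] by (elim exE conjE) (rule that)
    have "((\<lambda>x::real. C / (1 + x\<^sup>2)) \<longlongrightarrow> 0) at_top"
      by (intro tendsto_divide_0[OF tendsto_const] filterlim_at_top_imp_at_infinity
          filterlim_tendsto_add_at_top[OF tendsto_const] filterlim_pow_at_top filterlim_ident) simp
    then show ?thesis
      by (rule Lim_null_comparison[rotated]) (rule eventually_mono[OF eventually_ge_at_top[of 0]], rule C(2)[rule_format])
  qed
  have main: "(\<integral>x. k x *\<^sub>R h x - ker j x *\<^sub>R h2 x \<partial>half_line) = - (ker' j 0 *\<^sub>R h 0 - ker j 0 *\<^sub>R h1 0)"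
    if k: "\<And>x. (ker' j has_real_derivative k x) (at x)" "continuous_on UNIV k" "integrable half_line (\<lambda>x. k x *\<^sub>R h x)" for j k
  proof (rule half_line_FTC)
    show "((\<lambda>x. ker' j x *\<^sub>R h x - ker j x *\<^sub>R h1 x) has_vector_derivative k x *\<^sub>R h x - ker j x *\<^sub>R h2 x) (at x)" for x
      by (rule has_vector_derivative_eq_rhs[OF has_vector_derivative_diff[OF
          has_vector_derivative_scaleR[OF k(1) h(1)] has_vector_derivative_scaleR[OF ker_DERIV(1) h(2)]]]) simp
    show "continuous_on UNIV (\<lambda>x. k x *\<^sub>R h x - ker j x *\<^sub>R h2 x)" by (intro continuous_intros k(2) c0 c2 ck)
    show "integrable half_line (\<lambda>x. k x *\<^sub>R h x - ker j x *\<^sub>R h2 x)"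
      by (rule Bochner_Integration.integrable_diff[OF k(3) int[where f = h2, OF B(3) c2]])
    show "((\<lambda>x. ker' j x *\<^sub>R h x - ker j x *\<^sub>R h1 x) \<longlongrightarrow> 0) at_top"
      using tendsto_diff[OF lim[where f = h and q = "pderiv (kernel_poly j) - kernel_poly j", OF B(1)]
         lim[where f = h1 and q = "kernel_poly j", OF B(2)]]
      unfolding ker_def ker'_def diff_0_right .
  qed
  assume h10: "h1 0 = 0"
  have "(\<integral>x. ker 0 x *\<^sub>R h x - ker 0 x *\<^sub>R h2 x \<partial>half_line) = - (ker' 0 0 *\<^sub>R h 0 - ker 0 0 *\<^sub>R h1 0)"
    by (rule main[OF ker_DERIV(2) ck(1) int[where f = h, OF B(1) c0]])
  also have "\<dots> = h 0 / 2" by (simp add: ker'_at_0 h10 scaleR_conv_of_real)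
  finally show "(\<integral>x. ker 0 x *\<^sub>R h x \<partial>half_line) - (\<integral>x. ker 0 x *\<^sub>R h2 x \<partial>half_line) = h 0 / 2"
    by (simp add: Bochner_Integration.integral_diff int[where f = h, OF B(1) c0] int[where f = h2, OF B(3) c2])
  have ik: "integrable half_line (\<lambda>x. (ker (Suc i) x - ker i x) *\<^sub>R h x)"
    unfolding scaleR_diff_left by (intro Bochner_Integration.integrable_diff int[where f = h, OF B(1) c0])
  have "(\<integral>x. (ker (Suc i) x - ker i x) *\<^sub>R h x - ker (Suc i) x *\<^sub>R h2 x \<partial>half_line) = 0"
    using main[OF ker_DERIV(3) _ ik] by (simp add: ker'_at_0 h10 ck continuous_on_diff)
  then show "(\<integral>x. ker (Suc i) x *\<^sub>R h x \<partial>half_line) - (\<integral>x. ker (Suc i) x *\<^sub>R h2 x \<partial>half_line) = (\<integral>x. ker i x *\<^sub>R h x \<partial>half_line)"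
    by (simp add: scaleR_diff_left Bochner_Integration.integral_diff int[where f = h, OF B(1) c0] int[where f = h2, OF B(3) c2] algebra_simps)
qed

section \<open>Powers of the resolvent along the wave curve\<close>

text \<open>For fixed z the envelope is at most b^(1 - \<beta>) = b^(- 1 / (2 p)), a decreasing
  power of b = a cosh \<theta> \<ge> a. Bounds for each z are needed because the integrations by
  parts are carried out pointwise.\<close>

lemma wave_pointwise_bounded:
  assumes p: "0 < p"
  shows "\<exists>B. \<forall>\<theta>. norm (wave p j \<theta> z) \<le> B"
proof (cases "0 < snd z")
  case False
  then show ?thesis using wave_class_outside[OF wave_in_class] by (intro exI[of _ 0]) simp
next
  case True
  obtain K where K: "0 \<le> K" "\<And>\<theta> z. 0 < snd z \<Longrightarrow> norm (wave p j \<theta> z) \<le> K * axb_env p (cosh \<theta>) z"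
    using wave_class_bound[OF p wave_in_class] by blast
  have "axb_env p (cosh \<theta>) z \<le> snd z powr (- 1 / (2 * p))" for \<theta>
  proof -
    define b where "b = cosh \<theta> * snd z"
    let ?\<zeta> = "zeta (cosh \<theta>) z"
    have b: "0 < b" "snd z \<le> b" using True cosh_real_ge_1[of \<theta>] by (auto simp: b_def cosh_real_pos)
    have I: "Im ?\<zeta> = b" by (simp add: Im_zeta b_def)
    have n: "b \<le> norm ?\<zeta>" "1 \<le> norm (?\<zeta> + \<i>)" using norm_upper[of ?\<zeta>] I b by auto
    have bp: "0 < beta p" using p by (simp add: beta_def add_pos_pos)
    have "axb_env p (cosh \<theta>) z = b * norm ?\<zeta> powr (- beta p) * (1 / norm (?\<zeta> + \<i>) ^ 4)"
      using True by (simp add: axb_env_zeta env_def I)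
    also have "\<dots> \<le> b * b powr (- beta p) * 1"
      using b n bp by (intro mult_mono powr_mono2' mult_nonneg_nonneg) (auto simp: divide_le_eq_1 one_le_power)
    also have "\<dots> = b powr (- 1 / (2 * p))"
      using b powr_add[of b 1 "- beta p"] by (simp add: beta_def)
    also have "\<dots> \<le> snd z powr (- 1 / (2 * p))"
      using b True p by (intro powr_mono2') auto
    finally show ?thesis .
  qed
  then have "norm (wave p j \<theta> z) \<le> K * snd z powr (- 1 / (2 * p))" for \<theta>
    using K(2)[OF True, of \<theta>] mult_left_mono[OF _ K(1)] order_trans by blast
  then show ?thesis by blast
qed

text \<open>After the substitution \<eta> = \<surd>t \<theta> the kernel does not depend on t. Only
  derivatives of odd order occur, since the start has order 1 and \<Delta> = - \<partial>_\<theta>^2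
  raises the order by 2.\<close>

definition kwave :: "real \<Rightarrow> nat \<Rightarrow> nat \<Rightarrow> real \<Rightarrow> real \<times> real \<Rightarrow> complex" where
  "kwave p j i t z = (\<integral>\<eta>. ker i \<eta> *\<^sub>R wave p (2 * j + 1) (\<eta> / sqrt t) z \<partial>half_line)"

text \<open>This is \<open>\<Delta>\<^sup>j\<close> applied to the \<open>(i + 1)\<close>-st power (not the \<open>i\<close>-th) of \<open>(t + \<Delta>)\<^sup>-\<^sup>1\<close> applied to \<open>wave p 1 0\<close>.\<close>

definition gwave :: "real \<Rightarrow> nat \<Rightarrow> nat \<Rightarrow> real \<Rightarrow> real \<times> real \<Rightarrow> complex" where
  "gwave p j i t z = (2 * (- 1) ^ j / t ^ Suc i) *\<^sub>R kwave p j i t z"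

text \<open>\<open>ker_integral_identity\<close> for h(\<eta>) = w(\<eta> / \<surd>t) with w a
  derivative of odd order: each differentiation brings a factor 1 / \<surd>t, and h'(0) = 0 because
  derivatives of even order vanish at 0.\<close>

lemma kwave_identity:
  assumes p: "0 < p" and t: "0 < t"
  shows "kwave p 0 0 t z - (1 / t) *\<^sub>R kwave p 1 0 t z = wave p 1 0 z / 2"
    and "kwave p j (Suc i) t z - (1 / t) *\<^sub>R kwave p (Suc j) (Suc i) t z = kwave p j i t z"
proof -
  define r where "r = sqrt t"
  have r: "0 < r" "1 / r * (1 / r) = 1 / t" using t by (auto simp: r_def)
  have h: "((\<lambda>\<eta>. wave p n (\<eta> / r) z) has_vector_derivative (1 / r) *\<^sub>R wave p (Suc n) (\<eta> / r) z) (at \<eta>)" for n \<eta>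
  proof -
    have "((\<lambda>\<eta>. \<eta> / r) has_vector_derivative 1 / r) (at \<eta>)"
      using r by (auto intro!: derivative_eq_intros simp: has_real_derivative_iff_has_vector_derivative[symmetric])
    from vector_diff_chain_at[OF this wave_deriv] show ?thesis by (simp add: o_def)
  qed
  have cont: "continuous_on UNIV (\<lambda>\<eta>. wave p n (\<eta> / r) z)" for n
    using h by (auto intro!: continuous_at_imp_continuous_on has_vector_derivative_continuous)
  have id: "(\<integral>x. ker 0 x *\<^sub>R wave p (2 * j + 1) (x / r) z \<partial>half_line) - (\<integral>x. ker 0 x *\<^sub>R ((1 / t) *\<^sub>R wave p (2 * j + 3) (x / r) z) \<partial>half_line) = wave p (2 * j + 1) 0 z / 2"
    "(\<integral>x. ker (Suc i) x *\<^sub>R wave p (2 * j + 1) (x / r) z \<partial>half_line) - (\<integral>x. ker (Suc i) x *\<^sub>R ((1 / t) *\<^sub>R wave p (2 * j + 3) (x / r) z) \<partial>half_line)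
      = (\<integral>x. ker i x *\<^sub>R wave p (2 * j + 1) (x / r) z \<partial>half_line)" for i j
  proof -
    obtain B0 where B0: "\<And>\<theta>. norm (wave p (2 * j + 1) \<theta> z) \<le> B0" using wave_pointwise_bounded[OF p] by blast
    obtain B1 where B1: "\<And>\<theta>. norm (wave p (Suc (2 * j + 1)) \<theta> z) \<le> B1" using wave_pointwise_bounded[OF p] by blast
    obtain B2 where B2: "\<And>\<theta>. norm (wave p (2 * j + 3) \<theta> z) \<le> B2" using wave_pointwise_bounded[OF p] by blast
    define B where "B = max B0 (max (1 / r * B1) (1 / t * B2))"
    have d2: "((\<lambda>\<eta>. (1 / r) *\<^sub>R wave p (Suc (2 * j + 1)) (\<eta> / r) z) has_vector_derivative (1 / t) *\<^sub>R wave p (2 * j + 3) (\<eta> / r) z) (at \<eta>)" for \<eta>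
      by (rule has_vector_derivative_eq_rhs[OF has_vector_derivative_scaleR[OF DERIV_const h]])
        (simp only: scaleR_scaleR r(2), simp add: eval_nat_numeral)
    have b0: "norm (wave p (2 * j + 1) (x / r) z) \<le> B" for x
      using B0[of "x / r"] by (simp add: B_def le_max_iff_disj)
    have b1: "norm ((1 / r) *\<^sub>R wave p (Suc (2 * j + 1)) (x / r) z) \<le> B" for x
      unfolding B_def norm_scaleR using mult_left_mono[OF B1[of "x / r"], of "1 / r"] r
      by (intro max.coboundedI2 max.coboundedI1) simp
    have b2: "norm ((1 / t) *\<^sub>R wave p (2 * j + 3) (x / r) z) \<le> B" for x
      unfolding B_def norm_scaleR using mult_left_mono[OF B2[of "x / r"], of "1 / t"] t
      by (intro max.coboundedI2) simp
    have z0: "(1 / r) *\<^sub>R wave p (Suc (2 * j + 1)) (0 / r) z = 0" by (simp add: wave_even_at_0 del: wave.simps)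
    note K = ker_integral_identity[OF h d2 _ b0 b1 b2]
    show "(\<integral>x. ker 0 x *\<^sub>R wave p (2 * j + 1) (x / r) z \<partial>half_line) - (\<integral>x. ker 0 x *\<^sub>R ((1 / t) *\<^sub>R wave p (2 * j + 3) (x / r) z) \<partial>half_line) = wave p (2 * j + 1) 0 z / 2"
      using K(2)[OF _ z0] cont by (simp add: continuous_on_scaleR del: wave.simps)
    show "(\<integral>x. ker (Suc i) x *\<^sub>R wave p (2 * j + 1) (x / r) z \<partial>half_line) - (\<integral>x. ker (Suc i) x *\<^sub>R ((1 / t) *\<^sub>R wave p (2 * j + 3) (x / r) z) \<partial>half_line)
      = (\<integral>x. ker i x *\<^sub>R wave p (2 * j + 1) (x / r) z \<partial>half_line)"
      by (rule K(3)[OF _ z0]) (intro continuous_on_scaleR continuous_on_const cont)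
  qed
  have k: "(\<integral>x. ker i x *\<^sub>R ((1 / t) *\<^sub>R wave p (2 * j + 3) (x / r) z) \<partial>half_line) = (1 / t) *\<^sub>R kwave p (Suc j) i t z" for i j
    unfolding kwave_def r_def[symmetric] scaleR_left_commute[of _ "1 / t"] integral_scaleR_right
    by (simp add: eval_nat_numeral del: wave.simps)
  have k0: "(\<integral>x. ker i x *\<^sub>R wave p (2 * j + 1) (x / r) z \<partial>half_line) = kwave p j i t z" for i j
    by (simp only: kwave_def r_def)
  show "kwave p 0 0 t z - (1 / t) *\<^sub>R kwave p 1 0 t z = wave p 1 0 z / 2"
    using id(1)[of 0] unfolding k k0 by (simp del: wave.simps)
  show "kwave p j (Suc i) t z - (1 / t) *\<^sub>R kwave p (Suc j) (Suc i) t z = kwave p j i t z"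
    using id(2)[of i j] unfolding k k0 .
qed

text \<open>The resolvent equation 1 = t (t + \<Delta>)^(-1) + \<Delta> (t + \<Delta>)^(-1),
  multiplied by \<Delta>^j (t + \<Delta>)^(- i - 1) in the second part. The 2 in
  \<open>gwave\<close> compensates for integrating over half of the line.\<close>

lemma gwave_identity:
  assumes p: "0 < p" and t: "0 < t"
  shows "wave p 1 0 z = t *\<^sub>R gwave p 0 0 t z + gwave p 1 0 t z"
    and "gwave p j i t z = t *\<^sub>R gwave p j (Suc i) t z + gwave p (Suc j) (Suc i) t z"
proof -
  have "wave p 1 0 z = 2 * (wave p 1 0 z / 2)" by simp
  also have "\<dots> = 2 * (kwave p 0 0 t z - (1 / t) *\<^sub>R kwave p 1 0 t z)" by (simp only: kwave_identity(1)[OF p t])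
  also have "\<dots> = t *\<^sub>R gwave p 0 0 t z + gwave p 1 0 t z"
    using t by (simp add: gwave_def scaleR_conv_of_real algebra_simps)
  finally show "wave p 1 0 z = t *\<^sub>R gwave p 0 0 t z + gwave p 1 0 t z" .
  have "gwave p j i t z = (2 * (- 1) ^ j / t ^ Suc i) *\<^sub>R (kwave p j (Suc i) t z - (1 / t) *\<^sub>R kwave p (Suc j) (Suc i) t z)"
    unfolding gwave_def kwave_identity(2)[OF p t] ..
  also have "\<dots> = t *\<^sub>R gwave p j (Suc i) t z + gwave p (Suc j) (Suc i) t z"
    using t by (simp add: gwave_def scaleR_conv_of_real algebra_simps)
  finally show "gwave p j i t z = t *\<^sub>R gwave p j (Suc i) t z + gwave p (Suc j) (Suc i) t z" .
qed

section \<open>Curves of resolvents: measurability, bounds and local Lipschitz estimates\<close>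

definition locally_Lipschitz_real :: "(real \<Rightarrow> real) \<Rightarrow> bool" where
  "locally_Lipschitz_real V \<longleftrightarrow> (\<forall>a b. 0 < a \<longrightarrow> a \<le> b \<longrightarrow> (\<exists>L\<ge>0. \<forall>s\<in>{a..b}. \<forall>t\<in>{a..b}. \<bar>V s - V t\<bar> \<le> L * \<bar>s - t\<bar>))"

lemma locally_Lipschitz_realI:
  assumes V: "\<And>t. 0 < t \<Longrightarrow> (V has_real_derivative V' t) (at t)" and c: "continuous_on {0<..} V'"
  shows "locally_Lipschitz_real V"
  unfolding locally_Lipschitz_real_def
proof (intro allI impI)
  fix a b :: real assume a: "0 < a" "a \<le> b"
  have "continuous_on {a..b} V'" by (rule continuous_on_subset[OF c]) (use a in auto)
  then have "bounded (V' ` {a..b})" by (intro compact_imp_bounded compact_continuous_image) auto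
  then obtain L where L: "\<And>t. t \<in> {a..b} \<Longrightarrow> norm (V' t) \<le> L" unfolding bounded_iff by blast
  have "norm (V s - V t) \<le> L * norm (s - t)" if "s \<in> {a..b}" "t \<in> {a..b}" for s t
    by (rule field_differentiable_bound[OF convex_real_interval(5)[of a b] _ L])
      (use V a that in \<open>auto intro: has_field_derivative_at_within\<close>)
  moreover have "0 \<le> L" using order_trans[OF norm_ge_zero L[of a]] a by simp
  ultimately show "\<exists>L\<ge>0. \<forall>s\<in>{a..b}. \<forall>t\<in>{a..b}. \<bar>V s - V t\<bar> \<le> L * \<bar>s - t\<bar>" unfolding real_norm_def by blast
qed

lemma locally_Lipschitz_Lp_scaleR:
  assumes p: "1 \<le> p" and V: "locally_Lipschitz_real V" and c: "locally_Lipschitz_Lp M p c"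
    and K: "\<And>t. 0 < t \<Longrightarrow> Lp_le M p (c t) K"
  shows "locally_Lipschitz_Lp M p (\<lambda>t z. V t *\<^sub>R c t z)"
  unfolding locally_Lipschitz_Lp_def
proof (intro allI impI)
  fix a b :: real assume a: "0 < a" "a \<le> b"
  have p0: "0 < p" using p by simp
  obtain L where L: "0 \<le> L" "\<And>s t. s \<in> {a..b} \<Longrightarrow> t \<in> {a..b} \<Longrightarrow> \<bar>V s - V t\<bar> \<le> L * \<bar>s - t\<bar>"
    using V[unfolded locally_Lipschitz_real_def, rule_format, OF a] by auto
  obtain D where D: "0 \<le> D" "\<And>s t. s \<in> {a..b} \<Longrightarrow> t \<in> {a..b} \<Longrightarrow> Lp_le M p (\<lambda>z. c s z - c t z) (D * \<bar>s - t\<bar>)"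
    using c[unfolded locally_Lipschitz_Lp_def, rule_format, OF a] by auto
  have K0: "0 \<le> K" using Lp_le_nonneg[OF K[OF a(1)]] .
  define B where "B = \<bar>V a\<bar> + L * (b - a)"
  have B: "\<bar>V t\<bar> \<le> B" if "t \<in> {a..b}" for t
  proof -
    have "\<bar>V t - V a\<bar> \<le> L * \<bar>t - a\<bar>" using that by (intro L) auto
    also have "\<dots> \<le> L * (b - a)" using that L by (intro mult_left_mono) auto
    finally show ?thesis unfolding B_def by linarith
  qed
  have B0: "0 \<le> B" using B[of a] a by auto
  have "Lp_le M p (\<lambda>z. V s *\<^sub>R c s z - V t *\<^sub>R c t z) ((L * K + B * D) * \<bar>s - t\<bar>)" if st: "s \<in> {a..b}" "t \<in> {a..b}" for s t
  proof -
    have "Lp_le M p (\<lambda>z. (V s - V t) *\<^sub>R c s z + V t *\<^sub>R (c s z - c t z)) (\<bar>V s - V t\<bar> * K + \<bar>V t\<bar> * (D * \<bar>s - t\<bar>))"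
      by (intro Lp_le_add Lp_le_scaleR K D st p p0) (use st a in auto)
    moreover have "\<bar>V s - V t\<bar> * K + \<bar>V t\<bar> * (D * \<bar>s - t\<bar>) \<le> (L * \<bar>s - t\<bar>) * K + B * (D * \<bar>s - t\<bar>)"
      by (intro add_mono mult_right_mono L st B K0 mult_nonneg_nonneg D) auto
    then have "\<bar>V s - V t\<bar> * K + \<bar>V t\<bar> * (D * \<bar>s - t\<bar>) \<le> (L * K + B * D) * \<bar>s - t\<bar>" by (simp add: algebra_simps)
    ultimately have "Lp_le M p (\<lambda>z. (V s - V t) *\<^sub>R c s z + V t *\<^sub>R (c s z - c t z)) ((L * K + B * D) * \<bar>s - t\<bar>)"
      using p0 by (rule Lp_le_mono)
    then show ?thesis by (simp add: scaleR_diff_left scaleR_diff_right)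
  qed
  moreover have "0 \<le> L * K + B * D" using L K0 B0 D by simp
  ultimately show "\<exists>L\<ge>0. \<forall>s\<in>{a..b}. \<forall>t\<in>{a..b}. Lp_le M p (\<lambda>z. V s *\<^sub>R c s z - V t *\<^sub>R c t z) (L * \<bar>s - t\<bar>)" by blast
qed

lemma wave_class_curve_measurable:
  assumes w: "w \<in> wave_class p" and h: "h \<in> borel_measurable N"
  shows "(\<lambda>(t, z). w (h t) z) \<in> borel_measurable (N \<Otimes>\<^sub>M rho)"
proof -
  have i: "(\<lambda>z. z) \<in> borel_measurable rho" by (rule measurable_rho) simp
  have "(\<lambda>x. (h (fst x), snd x)) \<in> measurable (N \<Otimes>\<^sub>M rho) (borel \<Otimes>\<^sub>M borel)"
    by (intro measurable_Pair measurable_compose[OF measurable_fst h] measurable_compose[OF measurable_snd i])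
  from measurable_compose[OF this wave_class_measurable[OF w]] show ?thesis by (simp add: split_beta')
qed

lemma ker_measurable [measurable]: "ker i \<in> borel_measurable borel"
  unfolding ker_def by (intro borel_measurable_continuous_onI continuous_intros)

lemma ker_integrable: "(\<integral>\<^sup>+\<eta>. ennreal \<bar>ker i \<eta>\<bar> \<partial>half_line) < \<infinity>" "(\<integral>\<^sup>+\<eta>. ennreal (\<eta> * \<bar>ker i \<eta>\<bar>) \<partial>half_line) < \<infinity>"
proof -
  have *: "(\<integral>\<^sup>+\<eta>. ennreal \<bar>poly q \<eta> * exp (- \<eta>)\<bar> \<partial>half_line) < \<infinity>" for q :: "real poly"
  proof -
    obtain C where C: "0 < C" "\<forall>\<eta>\<ge>0. \<bar>poly q \<eta> * exp (- \<eta>)\<bar> \<le> C / (1 + \<eta>\<^sup>2)" using poly_exp_bound by blast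
    have "integrable half_line (\<lambda>\<eta>. complex_of_real (poly q \<eta> * exp (- \<eta>)))"
    proof (rule integrable_half_line_bound[OF _ C(1)])
      show "(\<lambda>\<eta>. complex_of_real (poly q \<eta> * exp (- \<eta>))) \<in> borel_measurable borel"
        by (intro borel_measurable_continuous_onI continuous_intros)
      show "norm (complex_of_real (poly q \<eta> * exp (- \<eta>))) \<le> C / (1 + \<eta>\<^sup>2)" if "0 < \<eta>" for \<eta>
        unfolding norm_of_real using C(2) that by simp
    qed
    then show ?thesis by (simp only: integrable_iff_bounded norm_of_real)
  qed
  show "(\<integral>\<^sup>+\<eta>. ennreal \<bar>ker i \<eta>\<bar> \<partial>half_line) < \<infinity>" using *[of "kernel_poly i"] by (simp only: ker_def)
  have "(\<integral>\<^sup>+\<eta>. ennreal (\<eta> * \<bar>ker i \<eta>\<bar>) \<partial>half_line) = (\<integral>\<^sup>+\<eta>. ennreal \<bar>poly ([:0, 1:] * kernel_poly i) \<eta> * exp (- \<eta>)\<bar> \<partial>half_line)"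
    by (intro nn_integral_cong) (auto simp: space_restrict_space ker_def abs_mult)
  then show "(\<integral>\<^sup>+\<eta>. ennreal (\<eta> * \<bar>ker i \<eta>\<bar>) \<partial>half_line) < \<infinity>" using *[of "[:0, 1:] * kernel_poly i"] by (simp only:)
qed

lemma ker_locally_Lipschitz: "locally_Lipschitz_real (ker i)"
proof (rule locally_Lipschitz_realI[OF ker_DERIV(1)])
  show "continuous_on {0<..} (ker' i)" unfolding ker'_def by (intro continuous_intros)
qed

lemma wave_ker_curve:
  assumes p: "1 < p" and w: "w \<in> wave_class p" and r: "0 < r"
  shows "\<exists>\<eta>. Lp_curve rho p (\<lambda>\<eta> z. ker i \<eta> *\<^sub>R w (\<eta> / r) z) \<eta>"
proof -
  have p1: "1 \<le> p" "0 < p" using p by auto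
  obtain K where K: "0 \<le> K" "\<And>\<theta>. Lp_le rho p (w \<theta>) K" using wave_class_Lp[OF p w] by blast
  obtain L where L: "0 \<le> L" "\<And>\<theta> \<theta>'. Lp_le rho p (\<lambda>z. w \<theta> z - w \<theta>' z) (L * \<bar>\<theta> - \<theta>'\<bar>)" using wave_class_Lipschitz[OF p w] by blast
  have lip: "locally_Lipschitz_Lp rho p (\<lambda>\<eta> z. w (\<eta> / r) z)"
    unfolding locally_Lipschitz_Lp_def
  proof (intro allI impI exI[of _ "L / r"] conjI ballI)
    fix s t :: real
    have "L * \<bar>s / r - t / r\<bar> = L / r * \<bar>s - t\<bar>" using r by (simp add: diff_divide_distrib[symmetric] abs_divide)
    then show "Lp_le rho p (\<lambda>z. w (s / r) z - w (t / r) z) (L / r * \<bar>s - t\<bar>)" using L(2)[of "s / r" "t / r"] by simp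
  qed (use L r in simp)
  have km: "ker i \<in> borel_measurable half_line" by (rule measurable_half_line) measurable
  have dm: "(\<lambda>\<eta>. \<eta> / r) \<in> borel_measurable half_line" by (rule measurable_half_line) measurable
  have "Lp_curve rho p (\<lambda>\<eta> z. ker i \<eta> *\<^sub>R w (\<eta> / r) z) (\<lambda>\<eta>. \<bar>ker i \<eta>\<bar> * K)"
    unfolding Lp_curve_def
  proof (intro conjI allI impI)
    have "(\<lambda>x. ker i (fst x) *\<^sub>R (case x of (t, z) \<Rightarrow> w (t / r) z)) \<in> borel_measurable (half_line \<Otimes>\<^sub>M rho)"
      by (intro borel_measurable_scaleR measurable_compose[OF measurable_fst km] wave_class_curve_measurable[OF w dm])
    then show "(\<lambda>(\<eta>, z). ker i \<eta> *\<^sub>R w (\<eta> / r) z) \<in> borel_measurable (half_line \<Otimes>\<^sub>M rho)"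
      by (simp add: split_beta')
    show "locally_Lipschitz_Lp rho p (\<lambda>\<eta> z. ker i \<eta> *\<^sub>R w (\<eta> / r) z)"
      by (rule locally_Lipschitz_Lp_scaleR[OF p1(1) ker_locally_Lipschitz lip K(2)])
    show "Lp_le rho p (\<lambda>z. ker i \<eta> *\<^sub>R w (\<eta> / r) z) (\<bar>ker i \<eta>\<bar> * K)" for \<eta>
      by (intro Lp_le_scaleR K p1)
    show "(\<lambda>\<eta>. \<bar>ker i \<eta>\<bar> * K) \<in> borel_measurable borel" by measurable
    have "(\<integral>\<^sup>+\<eta>. ennreal (\<bar>ker i \<eta>\<bar> * K) \<partial>half_line) = (\<integral>\<^sup>+\<eta>. ennreal \<bar>ker i \<eta>\<bar> \<partial>half_line) * ennreal K"
      using K km by (subst nn_integral_multc[symmetric]) (auto simp: ennreal_mult)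
    also have "\<dots> < \<infinity>" using ker_integrable(1)[of i] by (simp add: ennreal_mult_less_top)
    finally show "(\<integral>\<^sup>+\<eta>. ennreal (\<bar>ker i \<eta>\<bar> * K) \<partial>half_line) < \<infinity>" .
  qed
  then show ?thesis by blast
qed

text \<open>For every \<eta> the Laplacian acts on the wave as - \<partial>_\<theta>^2; being
  closed, it may be taken under the integral against the kernel.\<close>

lemma gwave_in_Delta_p:
  assumes p: "1 < p" and t: "0 < t"
  shows "(gwave p j i t, gwave p (Suc j) i t) \<in> Delta_p p"
proof -
  have p1: "1 \<le> p" using p by simp
  note A = closed_subspace_Delta_p[OF p1]
  have r: "0 < sqrt t" using t by simp
  have w: "(\<lambda>\<theta> z. - 1 * wave p (2 * j + 3) \<theta> z) \<in> wave_class p" by (intro wave_class.scale wave_in_class)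
  obtain \<eta> where \<eta>: "Lp_curve rho p (\<lambda>\<eta> z. ker i \<eta> *\<^sub>R wave p (2 * j + 1) (\<eta> / sqrt t) z) \<eta>"
    using wave_ker_curve[OF p wave_in_class r] by blast
  obtain \<eta>' where \<eta>': "Lp_curve rho p (\<lambda>\<eta> z. ker i \<eta> *\<^sub>R (- 1 * wave p (2 * j + 3) (\<eta> / sqrt t) z)) \<eta>'"
    using wave_ker_curve[OF p w r] by blast
  have "(\<lambda>z. \<integral>\<eta>. ker i \<eta> *\<^sub>R wave p (2 * j + 1) (\<eta> / sqrt t) z \<partial>half_line,
         \<lambda>z. \<integral>\<eta>. ker i \<eta> *\<^sub>R (- 1 * wave p (2 * j + 3) (\<eta> / sqrt t) z) \<partial>half_line) \<in> Delta_p p"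
  proof (rule closed_subspace_integral[OF sigma_finite_rho p1 A \<eta> \<eta>'])
    fix \<eta> :: real
    have "(wave p (2 * j + 1) (\<eta> / sqrt t), \<lambda>z. - 1 * wave p (2 * j + 3) (\<eta> / sqrt t) z) \<in> Delta_p p"
      using wave_in_Delta_p[OF p, of "2 * j + 1"] by (simp add: eval_nat_numeral del: wave.simps)
    from closed_subspace_scale[OF A this, of "of_real (ker i \<eta>)"]
    show "(\<lambda>z. ker i \<eta> *\<^sub>R wave p (2 * j + 1) (\<eta> / sqrt t) z, \<lambda>z. ker i \<eta> *\<^sub>R (- 1 * wave p (2 * j + 3) (\<eta> / sqrt t) z)) \<in> Delta_p p"
      by (simp only: scaleR_conv_of_real)
  qed
  also have "(\<lambda>z. \<integral>\<eta>. ker i \<eta> *\<^sub>R wave p (2 * j + 1) (\<eta> / sqrt t) z \<partial>half_line) = kwave p j i t"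
    by (simp only: kwave_def[abs_def])
  also have "(\<lambda>z. \<integral>\<eta>. ker i \<eta> *\<^sub>R (- 1 * wave p (2 * j + 3) (\<eta> / sqrt t) z) \<partial>half_line) = (\<lambda>z. - kwave p (Suc j) i t z)"
    unfolding kwave_def by (simp add: eval_nat_numeral del: wave.simps)
  finally have "(kwave p j i t, \<lambda>z. - kwave p (Suc j) i t z) \<in> Delta_p p" .
  from closed_subspace_scale[OF A this, of "of_real (2 * (- 1) ^ j / t ^ Suc i)"]
  show ?thesis by (simp add: gwave_def[abs_def] scaleR_conv_of_real)
qed

text \<open>The norms of the waves are bounded uniformly in \<theta>, so by Minkowski's integral
  inequality only the integral of |ker| enters, and t does not.\<close>

lemma kwave_bound:
  assumes p: "1 < p"
  shows "\<exists>C\<ge>0. \<forall>t>0. Lp_le rho p (kwave p j i t) C"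
proof -
  have p1: "1 \<le> p" "0 < p" using p by auto
  obtain K where K: "0 \<le> K" "\<And>\<theta>. Lp_le rho p (wave p (2 * j + 1) \<theta>) K" using wave_class_Lp[OF p wave_in_class] by blast
  define C where "C = enn2real (\<integral>\<^sup>+\<eta>. ennreal \<bar>ker i \<eta>\<bar> \<partial>half_line) * K"
  have km: "ker i \<in> borel_measurable half_line" by (rule measurable_half_line) measurable
  have C: "(\<integral>\<^sup>+\<eta>. ennreal (\<bar>ker i \<eta>\<bar> * K) \<partial>half_line) \<le> ennreal C"
  proof -
    have "(\<integral>\<^sup>+\<eta>. ennreal (\<bar>ker i \<eta>\<bar> * K) \<partial>half_line) = (\<integral>\<^sup>+\<eta>. ennreal \<bar>ker i \<eta>\<bar> \<partial>half_line) * ennreal K"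
      using K km by (subst nn_integral_multc[symmetric]) (auto simp: ennreal_mult)
    also have "\<dots> = ennreal C" using ker_integrable(1)[of i] K by (simp add: C_def ennreal_mult)
    finally show ?thesis by simp
  qed
  have "Lp_le rho p (kwave p j i t) C" if t: "0 < t" for t
    unfolding kwave_def
  proof (rule Lp_le_integral(2)[OF sigma_finite_half_line sigma_finite_rho _ _ _ C _ p1(1)])
    have "0 < sqrt t" using t by simp
    then obtain \<eta> where "Lp_curve rho p (\<lambda>\<eta> z. ker i \<eta> *\<^sub>R wave p (2 * j + 1) (\<eta> / sqrt t) z) \<eta>"
      using wave_ker_curve[OF p wave_in_class] by blast
    then show "(\<lambda>(\<eta>, z). ker i \<eta> *\<^sub>R wave p (2 * j + 1) (\<eta> / sqrt t) z) \<in> borel_measurable (half_line \<Otimes>\<^sub>M rho)"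
      by (simp only: Lp_curve_def)
    show "Lp_le rho p (\<lambda>z. ker i \<eta> *\<^sub>R wave p (2 * j + 1) (\<eta> / sqrt t) z) (\<bar>ker i \<eta>\<bar> * K)" for \<eta>
      by (intro Lp_le_scaleR K p1)
    show "(\<lambda>\<eta>. \<bar>ker i \<eta>\<bar> * K) \<in> borel_measurable half_line" using km by measurable
    show "0 \<le> C" using K by (simp add: C_def)
  qed
  moreover have "0 \<le> C" using K by (simp add: C_def)
  ultimately show ?thesis by blast
qed

declare wave.simps(2) [simp del]

lemma ker_wave_integrable:
  assumes p: "0 < p" and r: "0 < r"
  shows "integrable half_line (\<lambda>\<eta>. ker i \<eta> *\<^sub>R wave p n (\<eta> / r) z)"
proof -
  obtain C where C: "0 < C" "\<forall>\<eta>\<ge>0. \<bar>poly (kernel_poly i) \<eta> * exp (- \<eta>)\<bar> \<le> C / (1 + \<eta>\<^sup>2)" using poly_exp_bound by blast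
  obtain B where B: "\<And>\<theta>. norm (wave p n \<theta> z) \<le> B" using wave_pointwise_bounded[OF p] by blast
  have B0: "0 \<le> B" using order_trans[OF norm_ge_zero B] .
  have "continuous_on UNIV (\<lambda>\<theta>. wave p n \<theta> z)"
    by (intro continuous_at_imp_continuous_on ballI has_vector_derivative_continuous[OF wave_deriv])
  then have c: "continuous_on UNIV (\<lambda>\<eta>. wave p n (\<eta> / r) z)"
    by (rule continuous_on_compose2) (use r in \<open>auto intro!: continuous_intros\<close>)
  show ?thesis
  proof (rule integrable_half_line_bound)
    show "(\<lambda>\<eta>. ker i \<eta> *\<^sub>R wave p n (\<eta> / r) z) \<in> borel_measurable borel"
      unfolding ker_def by (intro borel_measurable_continuous_onI continuous_intros c)
    show "0 < C * (B + 1)" using C B0 by simp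
    show "norm (ker i \<eta> *\<^sub>R wave p n (\<eta> / r) z) \<le> C * (B + 1) / (1 + \<eta>\<^sup>2)" if \<eta>: "0 < \<eta>" for \<eta>
    proof -
      have "norm (ker i \<eta> *\<^sub>R wave p n (\<eta> / r) z) \<le> (C / (1 + \<eta>\<^sup>2)) * (B + 1)"
        unfolding norm_scaleR ker_def using C \<eta> B0 by (intro mult_mono C(2)[rule_format] order_trans[OF B]) auto
      then show ?thesis by simp
    qed
  qed
qed

text \<open>For s and t the arguments of the wave differ by \<eta> |1 / \<surd>s - 1 / \<surd>t|, so
  the Lipschitz bound in \<theta> costs the first moment of the kernel, and t^(- 1/2) is locally
  Lipschitz away from 0.\<close>

lemma kwave_locally_Lipschitz:
  assumes p: "1 < p"
  shows "locally_Lipschitz_Lp rho p (kwave p j i)"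
proof -
  have p1: "1 \<le> p" "0 < p" using p by auto
  obtain L where L: "0 \<le> L" "\<And>\<theta> \<theta>'. Lp_le rho p (\<lambda>z. wave p (2 * j + 1) \<theta> z - wave p (2 * j + 1) \<theta>' z) (L * \<bar>\<theta> - \<theta>'\<bar>)"
    using wave_class_Lipschitz[OF p wave_in_class] by blast
  define D where "D = L * enn2real (\<integral>\<^sup>+\<eta>. ennreal (\<eta> * \<bar>ker i \<eta>\<bar>) \<partial>half_line)"
  have D0: "0 \<le> D" using L by (simp add: D_def)
  have km: "ker i \<in> borel_measurable half_line" by (rule measurable_half_line) measurable
  have diff: "Lp_le rho p (\<lambda>z. kwave p j i s z - kwave p j i t z) (D * \<bar>1 / sqrt s - 1 / sqrt t\<bar>)" if st: "0 < s" "0 < t" for s t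
  proof -
    define d where "d = \<bar>1 / sqrt s - 1 / sqrt t\<bar>"
    have sq: "0 < sqrt s" "0 < sqrt t" using st by auto
    have curve: "(\<lambda>(\<eta>, z). ker i \<eta> *\<^sub>R wave p (2 * j + 1) (\<eta> / r) z) \<in> borel_measurable (half_line \<Otimes>\<^sub>M rho)" if "0 < r" for r
      using wave_ker_curve[OF p wave_in_class[of p "2 * j + 1"] that, of i] unfolding Lp_curve_def by blast
    have eq: "(\<lambda>z. kwave p j i s z - kwave p j i t z)
      = (\<lambda>z. \<integral>\<eta>. ker i \<eta> *\<^sub>R (wave p (2 * j + 1) (\<eta> / sqrt s) z - wave p (2 * j + 1) (\<eta> / sqrt t) z) \<partial>half_line)"
      unfolding kwave_def scaleR_diff_right
      by (intro ext Bochner_Integration.integral_diff[symmetric] ker_wave_integrable p1 sq)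
    show ?thesis
      unfolding eq d_def[symmetric]
    proof (rule Lp_le_integral(2)[OF sigma_finite_half_line sigma_finite_rho _ _ _ _ _ p1(1)])
      show "(\<lambda>(\<eta>, z). ker i \<eta> *\<^sub>R (wave p (2 * j + 1) (\<eta> / sqrt s) z - wave p (2 * j + 1) (\<eta> / sqrt t) z)) \<in> borel_measurable (half_line \<Otimes>\<^sub>M rho)"
        using borel_measurable_diff[OF curve[OF sq(1)] curve[OF sq(2)]] by (simp add: split_beta' scaleR_diff_right)
      show "Lp_le rho p (\<lambda>z. ker i \<eta> *\<^sub>R (wave p (2 * j + 1) (\<eta> / sqrt s) z - wave p (2 * j + 1) (\<eta> / sqrt t) z)) (L * d * (\<eta> * \<bar>ker i \<eta>\<bar>))"
        if "\<eta> \<in> space half_line" for \<eta>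
      proof -
        have \<eta>: "0 < \<eta>" using that by (simp add: space_restrict_space)
        have "\<eta> / sqrt s - \<eta> / sqrt t = \<eta> * (1 / sqrt s - 1 / sqrt t)" by (simp add: algebra_simps)
        then have "\<bar>\<eta> / sqrt s - \<eta> / sqrt t\<bar> = \<eta> * d" using \<eta> by (simp add: d_def abs_mult)
        then have "Lp_le rho p (\<lambda>z. wave p (2 * j + 1) (\<eta> / sqrt s) z - wave p (2 * j + 1) (\<eta> / sqrt t) z) (L * (\<eta> * d))"
          using L(2)[of "\<eta> / sqrt s" "\<eta> / sqrt t"] by simp
        from Lp_le_scaleR[OF this p1(2), of "ker i \<eta>"] show ?thesis by (simp add: ac_simps)
      qed
      show "(\<lambda>\<eta>. L * d * (\<eta> * \<bar>ker i \<eta>\<bar>)) \<in> borel_measurable half_line"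
        by (rule measurable_half_line) measurable
      have "(\<integral>\<^sup>+\<eta>. ennreal (L * d * (\<eta> * \<bar>ker i \<eta>\<bar>)) \<partial>half_line) = (\<integral>\<^sup>+\<eta>. ennreal (L * d) * ennreal (\<eta> * \<bar>ker i \<eta>\<bar>) \<partial>half_line)"
        using L by (intro nn_integral_cong) (simp add: ennreal_mult d_def space_restrict_space)
      also have "\<dots> = ennreal (L * d) * (\<integral>\<^sup>+\<eta>. ennreal (\<eta> * \<bar>ker i \<eta>\<bar>) \<partial>half_line)"
        by (intro nn_integral_cmult measurable_half_line) measurable
      also have "\<dots> = ennreal (L * d) * ennreal (enn2real (\<integral>\<^sup>+\<eta>. ennreal (\<eta> * \<bar>ker i \<eta>\<bar>) \<partial>half_line))"
        using ker_integrable(2)[of i] by simp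
      also have "\<dots> = ennreal (D * d)" using L by (simp add: D_def d_def ennreal_mult[symmetric] ac_simps)
      finally show "(\<integral>\<^sup>+\<eta>. ennreal (L * d * (\<eta> * \<bar>ker i \<eta>\<bar>)) \<partial>half_line) \<le> ennreal (D * d)" by simp
      show "0 \<le> D * d" using D0 by (simp add: d_def)
    qed
  qed
  have V: "locally_Lipschitz_real (\<lambda>t. t powr (- 1/2))"
  proof (rule locally_Lipschitz_realI)
    show "((\<lambda>t. t powr (- 1/2)) has_real_derivative (- 1/2) * t powr (- 1/2 - 1)) (at t)" if "0 < t" for t
      using that by (rule has_real_derivative_powr)
  qed (auto intro!: continuous_intros)
  show ?thesis
    unfolding locally_Lipschitz_Lp_def
  proof (intro allI impI)
    fix a b :: real assume a: "0 < a" "a \<le> b"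
    obtain M where M: "0 \<le> M" "\<And>s t. s \<in> {a..b} \<Longrightarrow> t \<in> {a..b} \<Longrightarrow> \<bar>s powr (- 1/2) - t powr (- 1/2)\<bar> \<le> M * \<bar>s - t\<bar>"
      using V[unfolded locally_Lipschitz_real_def, rule_format, OF a] by auto
    have "Lp_le rho p (\<lambda>z. kwave p j i s z - kwave p j i t z) (D * M * \<bar>s - t\<bar>)" if st: "s \<in> {a..b}" "t \<in> {a..b}" for s t
    proof -
      have pos: "0 < s" "0 < t" using st a by auto
      have sq: "1 / sqrt u = u powr (- 1/2)" if "0 < u" for u
        using that powr_minus[of u "1/2"] by (simp add: powr_half_sqrt inverse_eq_divide)
      have "D * \<bar>1 / sqrt s - 1 / sqrt t\<bar> \<le> D * (M * \<bar>s - t\<bar>)"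
        unfolding sq[OF pos(1)] sq[OF pos(2)] by (intro mult_left_mono M st D0)
      then show ?thesis using Lp_le_mono[OF diff[OF pos] _ p1(2)] by (simp add: mult.assoc)
    qed
    moreover have "0 \<le> D * M" using D0 M by simp
    ultimately show "\<exists>L\<ge>0. \<forall>s\<in>{a..b}. \<forall>t\<in>{a..b}. Lp_le rho p (\<lambda>z. kwave p j i s z - kwave p j i t z) (L * \<bar>s - t\<bar>)" by blast
  qed
qed

lemma kwave_measurable: "(\<lambda>(t, z). kwave p j i t z) \<in> borel_measurable (half_line \<Otimes>\<^sub>M rho)"
proof -
  let ?N = "(half_line \<Otimes>\<^sub>M rho) \<Otimes>\<^sub>M half_line"
  have i: "(\<lambda>z. z) \<in> borel_measurable rho" by (rule measurable_rho) simp
  have km: "ker i \<in> borel_measurable half_line" by (rule measurable_half_line) measurable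
  have idm: "(\<lambda>t. t) \<in> borel_measurable half_line" by (rule measurable_half_line) simp
  have t: "(\<lambda>x. fst (fst x)) \<in> borel_measurable ?N"
    by (intro measurable_compose[OF measurable_compose[OF measurable_fst measurable_fst] idm])
  have e: "(\<lambda>x. snd x) \<in> borel_measurable ?N" by (intro measurable_compose[OF measurable_snd idm])
  have z: "(\<lambda>x. snd (fst x)) \<in> borel_measurable ?N"
    by (intro measurable_compose[OF measurable_compose[OF measurable_fst measurable_snd] i])
  have "(\<lambda>x. (snd x / sqrt (fst (fst x)), snd (fst x))) \<in> measurable ?N (borel \<Otimes>\<^sub>M borel)"
    by (intro measurable_Pair borel_measurable_divide e z measurable_compose[OF t]) measurable
  from measurable_compose[OF this wave_class_measurable[OF wave_in_class]]
  have "(\<lambda>x. wave p (2 * j + 1) (snd x / sqrt (fst (fst x))) (snd (fst x))) \<in> borel_measurable ?N" by (simp add: split_beta')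
  then have "(\<lambda>x. ker i (snd x) *\<^sub>R wave p (2 * j + 1) (snd x / sqrt (fst (fst x))) (snd (fst x))) \<in> borel_measurable ?N"
    by (intro borel_measurable_scaleR measurable_compose[OF measurable_snd km])
  then have "(\<lambda>x. \<integral>\<eta>. ker i \<eta> *\<^sub>R wave p (2 * j + 1) (\<eta> / sqrt (fst x)) (snd x) \<partial>half_line) \<in> borel_measurable (half_line \<Otimes>\<^sub>M rho)"
    by (intro sigma_finite_measure.borel_measurable_lebesgue_integral[OF sigma_finite_half_line]) (simp add: split_beta')
  then show ?thesis by (simp add: kwave_def split_beta')
qed

section \<open>Estimates in t and membership in the Sobolev space\<close>

lemma gwave_bound:
  assumes p: "1 < p"
  shows "\<exists>C\<ge>0. \<forall>t>0. Lp_le rho p (gwave p j i t) (C / t ^ Suc i)"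
proof -
  obtain C where C: "0 \<le> C" "\<And>t. 0 < t \<Longrightarrow> Lp_le rho p (kwave p j i t) C" using kwave_bound[OF p] by blast
  have "Lp_le rho p (gwave p j i t) (2 * C / t ^ Suc i)" if t: "0 < t" for t
    using Lp_le_scaleR[OF C(2)[OF t], of "2 * (- 1) ^ j / t ^ Suc i"] p t
    by (simp add: gwave_def[abs_def] abs_mult power_abs)
  then show ?thesis using C(1) by (intro exI[of _ "2 * C"]) auto
qed

text \<open>With R = (t + \<Delta>)^(-1), every \<Delta> cancels one factor 1 / t because \<Delta> R
  = 1 - t R. The induction uses \<Delta>^(j+1) R^m \<phi> = \<Delta>^j R^(m-1) \<phi> - t \<Delta>^j
  R^m \<phi>. For as many Laplacians as resolvents the bound is uniform in t, which is needed as t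
  tends to 0.\<close>

lemma gwave_bound_small:
  assumes p: "1 < p" and ji: "j \<le> Suc i"
  shows "\<exists>C\<ge>0. \<forall>t>0. Lp_le rho p (gwave p j i t) (C / t ^ (Suc i - j))"
  using ji
proof (induction j arbitrary: i)
  case 0
  show ?case using gwave_bound[OF p, of 0 i] by simp
next
  case (Suc j)
  have p1: "1 \<le> p" "0 < p" using p by auto
  show ?case
  proof (cases i)
    \<comment> \<open>Here R^(m-1) \<phi> is \<phi> itself, which is no \<open>gwave\<close>, as the
      index of \<open>gwave\<close> starts at the first power of the resolvent.\<close>
    case 0
    then have j: "j = 0" using Suc.prems by simp
    obtain K where K: "0 \<le> K" "\<And>\<theta>. Lp_le rho p (wave p 1 \<theta>) K" using wave_class_Lp[OF p wave_in_class] by blast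
    obtain C where C: "0 \<le> C" "\<And>t. 0 < t \<Longrightarrow> Lp_le rho p (gwave p 0 0 t) (C / t ^ Suc 0)" using gwave_bound[OF p] by blast
    have "Lp_le rho p (gwave p 1 0 t) (K + C)" if t: "0 < t" for t
    proof -
      have "Lp_le rho p (\<lambda>z. wave p 1 0 z - t *\<^sub>R gwave p 0 0 t z) (K + \<bar>t\<bar> * (C / t ^ Suc 0))"
        by (intro Lp_le_diff Lp_le_scaleR K C t p1)
      moreover have "(\<lambda>z. wave p 1 0 z - t *\<^sub>R gwave p 0 0 t z) = gwave p 1 0 t"
        using gwave_identity(1)[OF p1(2) t] by (simp add: fun_eq_iff)
      ultimately show ?thesis using t by simp
    qed
    then show ?thesis using K C j 0 by (intro exI[of _ "K + C"]) simp
  next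
    case (Suc i')
    then have j: "j \<le> Suc i'" using Suc.prems by simp
    obtain C where C: "0 \<le> C" "\<And>t. 0 < t \<Longrightarrow> Lp_le rho p (gwave p j i' t) (C / t ^ (Suc i' - j))"
      using Suc.IH[OF j] by blast
    obtain D where D: "0 \<le> D" "\<And>t. 0 < t \<Longrightarrow> Lp_le rho p (gwave p j (Suc i') t) (D / t ^ (Suc (Suc i') - j))"
      using Suc.IH[of "Suc i'"] j by (metis le_Suc_eq)
    have "Lp_le rho p (gwave p (Suc j) (Suc i') t) ((C + D) / t ^ (Suc i' - j))" if t: "0 < t" for t
    proof -
      have "Lp_le rho p (\<lambda>z. gwave p j i' t z - t *\<^sub>R gwave p j (Suc i') t z) (C / t ^ (Suc i' - j) + \<bar>t\<bar> * (D / t ^ (Suc (Suc i') - j)))"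
        by (intro Lp_le_diff Lp_le_scaleR C D t p1)
      moreover have "(\<lambda>z. gwave p j i' t z - t *\<^sub>R gwave p j (Suc i') t z) = gwave p (Suc j) (Suc i') t"
        unfolding gwave_identity(2)[OF p1(2) t, of j i'] by simp
      moreover have "C / t ^ (Suc i' - j) + \<bar>t\<bar> * (D / t ^ (Suc (Suc i') - j)) = (C + D) / t ^ (Suc i' - j)"
        using t j by (simp add: Suc_diff_le add_divide_distrib)
      ultimately show ?thesis by simp
    qed
    then show ?thesis using C D \<open>i = Suc i'\<close> by (intro exI[of _ "C + D"]) simp
  qed
qed

text \<open>The index \<open>m\<close> of \<open>gwave\<close> stands for the power m + 1 of the
  resolvent, which explains \<open>Suc m\<close> as the number of steps: this is (\<Delta> (t +
  \<Delta>)^(-1))^(m+1) \<phi>.\<close>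

lemma gwave_resolvent:
  assumes p: "1 < p" and t: "0 < t"
  shows "(wave p 1 0, gwave p (Suc m) m t) \<in> resolvent_op (Delta_p p) t ^^ Suc m"
proof -
  have p0: "0 < p" using p by simp
  show ?thesis
  proof (induction m)
    case 0
    have "wave p 1 0 = (\<lambda>z. t *\<^sub>R gwave p 0 0 t z + gwave p (Suc 0) 0 t z)"
      unfolding One_nat_def[symmetric] by (rule ext) (rule gwave_identity(1)[OF p0 t])
    then show ?case using gwave_in_Delta_p[OF p t, of 0 0] unfolding resolvent_op_def by auto
  next
    case (Suc m)
    have "gwave p (Suc m) m t = (\<lambda>z. t *\<^sub>R gwave p (Suc m) (Suc m) t z + gwave p (Suc (Suc m)) (Suc m) t z)"
      by (rule ext) (rule gwave_identity(2)[OF p0 t])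
    then have "(gwave p (Suc m) m t, gwave p (Suc (Suc m)) (Suc m) t) \<in> resolvent_op (Delta_p p) t"
      using gwave_in_Delta_p[OF p t, of "Suc m" "Suc m"] unfolding resolvent_op_def by auto
    with Suc show ?case by (rule relpow_Suc_I)
  qed
qed

text \<open>Komatsu's definition is met with \<alpha> = k / 2, \<sigma> = k and m = k + 1. The
  integrand t^(\<alpha> - 1) F(t) is O(t^(k / 2 - 1)) at 0 and O(t^(- k / 2 - 2)) at infinity; since
  k \<ge> 1, the exponents - 1/2 and - 3/2 serve for all k.\<close>

lemma wave_in_sobolev:
  assumes p: "1 < p" and k: "1 \<le> k"
  shows "wave p 1 0 \<in> sobolev p (real k)"
proof -
  have p1: "1 \<le> p" "0 < p" using p by auto
  define \<alpha> where "\<alpha> = real k / 2"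
  define F where "F = (\<lambda>t. gwave p (Suc k) k t)"
  define Y where "Y = (\<lambda>t z. t powr (\<alpha> - 1) *\<^sub>R F t z)"
  obtain C1 where C1: "0 \<le> C1" "\<And>t. 0 < t \<Longrightarrow> Lp_le rho p (F t) C1"
    using gwave_bound_small[OF p, of "Suc k" k] unfolding F_def by auto
  obtain C2 where C2: "0 \<le> C2" "\<And>t. 0 < t \<Longrightarrow> Lp_le rho p (F t) (C2 / t ^ Suc k)"
    using gwave_bound[OF p, of "Suc k" k] unfolding F_def by auto
  define C where "C = max C1 C2"
  have C: "0 \<le> C" "C1 \<le> C" "C2 \<le> C" using C1 by (auto simp: C_def)
  obtain D where D: "0 \<le> D" "\<And>t. 0 < t \<Longrightarrow> Lp_le rho p (kwave p (Suc k) k t) D" using kwave_bound[OF p] by blast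
  \<comment> \<open>All powers of t are gathered in one real factor, so that \<open>Y\<close> is a
    locally Lipschitz function times a bounded, locally Lipschitz curve.\<close>
  define V where "V = (\<lambda>t::real. t powr (\<alpha> - 1) * (2 * (- 1) ^ Suc k * t powr (- real (Suc k))))"
  have YV: "Y t z = V t *\<^sub>R kwave p (Suc k) k t z" if "0 < t" for t z
  proof -
    have "2 * (- 1) ^ Suc k / t ^ Suc k = 2 * (- 1) ^ Suc k * t powr (- real (Suc k))"
      using that by (simp only: powr_minus powr_realpow divide_inverse)
    then show ?thesis by (simp only: Y_def F_def V_def gwave_def scaleR_scaleR)
  qed
  have curve: "Lp_curve rho p Y (\<lambda>t. C * power_profile (- 1/2) (- 3/2) t)"
    unfolding Lp_curve_def
  proof (intro conjI allI impI)
    have Vm: "V \<in> borel_measurable half_line" unfolding V_def by (rule measurable_half_line) measurable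
    have "(\<lambda>x. V (fst x) *\<^sub>R (case x of (t, z) \<Rightarrow> kwave p (Suc k) k t z)) \<in> borel_measurable (half_line \<Otimes>\<^sub>M rho)"
      by (intro borel_measurable_scaleR measurable_compose[OF measurable_fst Vm] kwave_measurable)
    also have "?this \<longleftrightarrow> (\<lambda>(t, z). Y t z) \<in> borel_measurable (half_line \<Otimes>\<^sub>M rho)"
      by (intro measurable_cong) (auto simp: YV space_pair_measure space_restrict_space)
    finally show "(\<lambda>(t, z). Y t z) \<in> borel_measurable (half_line \<Otimes>\<^sub>M rho)" .
    have Vl: "locally_Lipschitz_real V"
    proof (rule locally_Lipschitz_realI)
      show "(V has_real_derivative (\<alpha> - 1) * t powr (\<alpha> - 1 - 1) * (2 * (- 1) ^ Suc k * t powr (- real (Suc k)))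
        + (2 * (- 1) ^ Suc k * ((- real (Suc k)) * t powr (- real (Suc k) - 1))) * t powr (\<alpha> - 1)) (at t)" if "0 < t" for t
        unfolding V_def by (intro DERIV_mult DERIV_cmult has_real_derivative_powr that)
    qed (auto intro!: continuous_intros)
    have "locally_Lipschitz_Lp rho p (\<lambda>t z. V t *\<^sub>R kwave p (Suc k) k t z)"
      by (rule locally_Lipschitz_Lp_scaleR[OF p1(1) Vl kwave_locally_Lipschitz[OF p] D(2)])
    then show "locally_Lipschitz_Lp rho p Y"
      unfolding locally_Lipschitz_Lp_def by (auto simp: YV)
    show "Lp_le rho p (Y t) (C * power_profile (- 1/2) (- 3/2) t)" if t: "0 < t" for t
    proof (cases "t \<le> 1")
      case True
      have "t powr (\<alpha> - 1) \<le> t powr (- 1/2)" using k t True by (intro powr_mono') (auto simp: \<alpha>_def)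
      then have "\<bar>t powr (\<alpha> - 1)\<bar> * C1 \<le> C * power_profile (- 1/2) (- 3/2) t"
        using True C C1 by (simp add: power_profile_def mult.commute[of C] mult_mono)
      with Lp_le_scaleR[OF C1(2)[OF t] p1(2), of "t powr (\<alpha> - 1)"] show ?thesis
        unfolding Y_def by (rule Lp_le_mono[OF _ _ p1(2)])
    next
      case False
      have "\<bar>t powr (\<alpha> - 1)\<bar> * (C2 / t ^ Suc k) = t powr (\<alpha> - 1 - real (Suc k)) * C2"
      proof -
        have "t ^ Suc k = t powr real (Suc k)" using t by (simp only: powr_realpow)
        then show ?thesis by (simp only: powr_diff) simp
      qed
      also have "\<dots> \<le> t powr (- 3/2) * C"
        using False C C2 by (intro mult_mono powr_mono) (auto simp: \<alpha>_def field_simps)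
      finally have "\<bar>t powr (\<alpha> - 1)\<bar> * (C2 / t ^ Suc k) \<le> C * power_profile (- 1/2) (- 3/2) t"
        using False by (simp add: power_profile_def mult.commute[of C])
      with Lp_le_scaleR[OF C2(2)[OF t] p1(2), of "t powr (\<alpha> - 1)"] show ?thesis
        unfolding Y_def by (rule Lp_le_mono[OF _ _ p1(2)])
    qed
    show "(\<lambda>t. C * power_profile (- 1/2) (- 3/2) t) \<in> borel_measurable borel" by measurable
    have "(\<integral>\<^sup>+t. ennreal (C * power_profile (- 1/2) (- 3/2) t) \<partial>half_line) = ennreal C * (\<integral>\<^sup>+t. ennreal (power_profile (- 1/2) (- 3/2) t) \<partial>half_line)"
      using C by (subst nn_integral_cmult[symmetric]) (auto simp: ennreal_mult power_profile_nonneg intro!: measurable_half_line)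
    also have "\<dots> < \<infinity>" using power_profile_integral[of "- 1/2" "- 3/2"] by (simp add: ennreal_mult_less_top)
    finally show "(\<integral>\<^sup>+t. ennreal (C * power_profile (- 1/2) (- 3/2) t) \<partial>half_line) < \<infinity>" .
  qed
  define g where "g = (\<lambda>z. \<integral>t. Y t z \<partial>half_line)"
  have int: "has_Lp_integral half_line rho p Y g"
    unfolding g_def by (rule Lp_curve_has_Lp_integral[OF sigma_finite_rho p1(1) curve])
  have gL: "g \<in> Lp rho p" using int unfolding has_Lp_integral_def Lp_tendsto_def Let_def by blast
  define c where "c = Gamma (real (Suc k)) / (Gamma \<alpha> * Gamma (real (Suc k) - \<alpha>))"
  have bound: "t powr real k * Lp_norm rho p (F t) \<le> C" if t: "0 < t" for t
  proof (cases "t \<le> 1")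
    case True
    have "t powr real k \<le> 1" using True t by (intro powr_le1) auto
    then have "t powr real k * Lp_norm rho p (F t) \<le> 1 * C1"
      using Lp_norm_le[OF C1(2)[OF t] p1(2)] C1 by (intro mult_mono) (auto simp: Lp_norm_nonneg)
    then show ?thesis using C by simp
  next
    case False
    have "t powr real k * Lp_norm rho p (F t) \<le> t ^ k * (C2 / t ^ Suc k)"
      unfolding powr_realpow[OF t] using t by (intro mult_left_mono Lp_norm_le[OF C2(2)[OF t] p1(2)]) simp
    also have "\<dots> = C2 / t" using t by simp
    also have "\<dots> \<le> C2" using False C2 by (simp add: divide_le_eq mult_le_cancel_left1)
    finally show ?thesis using C by simp
  qed
  have "(wave p 1 0, \<lambda>z. c *\<^sub>R g z) \<in> komatsu_op rho p (Delta_p p) (real k) \<alpha>"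
    unfolding komatsu_op_def c_def
  proof (intro CollectI exI conjI)
    show "real k < real (Suc k)" by simp
    show "\<forall>t>0. (wave p 1 0, F t) \<in> resolvent_op (Delta_p p) t ^^ Suc k"
      unfolding F_def using gwave_resolvent[OF p] by blast
    show "\<forall>t>0. t powr real k * Lp_norm rho p (F t) \<le> C" using bound by blast
    show "has_Lp_integral half_line rho p (\<lambda>t z. t powr (\<alpha> - 1) *\<^sub>R F t z) g" using int unfolding Y_def .
  qed simp
  moreover have "real k \<in> {\<alpha><..}" using k by (simp add: \<alpha>_def)
  ultimately have T: "(wave p 1 0, \<lambda>z. c *\<^sub>R g z) \<in> (\<Union>\<sigma>\<in>{\<alpha><..}. komatsu_op rho p (Delta_p p) \<sigma> \<alpha>)" by blast
  have wL: "wave p 1 0 \<in> Lp rho p" using wave_class_Lp[OF p wave_in_class] Lp_le_imp_Lp by blast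
  have cL: "(\<lambda>z. c *\<^sub>R g z) \<in> Lp rho p"
    using gL Lp_iff_Lp_le[OF p1(2)] Lp_le_scaleR[OF _ p1(2)] by blast
  have "(wave p 1 0, \<lambda>z. c *\<^sub>R g z) \<in> fractional_power rho p (Delta_p p) \<alpha>"
    unfolding fractional_power_def closure_op_iff[OF p1(1)]
  proof (intro allI impI)
    fix e :: real assume e: "0 < e"
    \<comment> \<open>The pair already belongs to Komatsu's operator, so in the closure it
      approximates itself with error 0.\<close>
    have z: "Lp_le rho p (\<lambda>z. h z - h z) e" for h :: "real \<times> real \<Rightarrow> complex"
      using Lp_le_mono[OF Lp_le_zero less_imp_le[OF e] p1(2)] by simp
    show "\<exists>(u, v)\<in>\<Union>\<sigma>\<in>{\<alpha><..}. komatsu_op rho p (Delta_p p) \<sigma> \<alpha>. u \<in> Lp rho p \<and> v \<in> Lp rho p \<and>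
        Lp_le rho p (\<lambda>z. u z - wave p 1 0 z) e \<and> Lp_le rho p (\<lambda>z. v z - c *\<^sub>R g z) e"
      by (rule bexI[OF _ T]) (simp only: prod.case wL cL z simp_thms)
  qed
  then show ?thesis using k wL cL unfolding sobolev_def \<alpha>_def by auto
qed

text \<open>In the cone x \<le> a \<le> 2 x the 2 p-th power of |\<phi>| is at least c / x, and
  \<integral> da / a over [x, 2 x] is at least 1/2. What remains is \<integral> c / (2 x) dx, which
  diverges logarithmically at 0.\<close>

lemma wave_square_not_in_Lp:
  assumes p: "1 < p"
  shows "(\<lambda>z. wave p 1 0 z * wave p 1 0 z) \<notin> Lp rho p"
proof
  assume L: "(\<lambda>z. wave p 1 0 z * wave p 1 0 z) \<in> Lp rho p"
  define f where "f = (\<lambda>z. ennreal (norm (wave p 1 0 z * wave p 1 0 z) powr p))"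
  have bp: "0 < beta p" using p by (simp add: beta_def add_pos_pos)
  have "(\<lambda>z. (\<lambda>(\<theta>, z). wave p 1 \<theta> z) (0, z)) \<in> borel_measurable borel"
    by (rule measurable_compose[OF measurable_Pair1' wave_class_measurable[OF wave_in_class]]) simp
  then have [measurable]: "wave p 1 0 \<in> borel_measurable borel" by simp
  have [measurable]: "f \<in> borel_measurable borel" unfolding f_def by measurable
  have fin: "(\<integral>\<^sup>+z. f z \<partial>rho) < \<infinity>"
    using L unfolding Lp_def integrable_iff_bounded f_def by simp
  \<comment> \<open>From |\<zeta>| \<le> 3 x and, as x \<le> 1/3, |\<zeta> + \<i>| \<le> 2, with 64
    = 2^6; the exponent 2 p comes from the square inside the p-th power.\<close>
  define c where "c = (3 powr (- beta p) / 64) powr (2 * p)"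
  have c0: "0 < c" by (simp add: c_def)
  have low: "ennreal (c / x) \<le> f (x, a)" if x: "0 < x" "x \<le> 1/3" and a: "x \<le> a" "a \<le> 2 * x" for x a
  proof -
    define \<zeta> where "\<zeta> = Complex x a"
    have w: "wave p 1 0 (x, a) = of_real a * gen p \<zeta>"
      using x a unfolding wave_1 wave_mono_def by (simp add: zeta_def \<zeta>_def gen_deriv_def)
    have n1: "norm \<zeta> \<le> 3 * x" using cmod_le[of \<zeta>] x a by (simp add: \<zeta>_def)
    have n2: "norm (\<zeta> + \<i>) \<le> 2" using norm_triangle_ineq[of \<zeta> \<i>] n1 x by simp
    have n0: "0 < norm \<zeta>" using x by (auto simp: \<zeta>_def complex_eq_iff)
    have n3: "0 < norm (\<zeta> + \<i>)" using x by (auto simp: \<zeta>_def complex_eq_iff)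
    have "x powr (1 - beta p) * (3 powr (- beta p) / 64) = x * (3 * x) powr (- beta p) * (1 / 2 ^ 6)"
      using x powr_add[of x 1 "- beta p"] by (simp add: powr_mult)
    also have "\<dots> \<le> a * norm \<zeta> powr (- beta p) * (1 / norm (\<zeta> + \<i>) ^ 6)"
      using x a n0 n1 n2 n3 bp
      by (intro mult_mono powr_mono2' divide_left_mono power_mono mult_pos_pos zero_less_power mult_nonneg_nonneg) auto
    also have "\<dots> = norm (wave p 1 0 (x, a))" unfolding w using x a by (simp add: norm_mult norm_gen)
    finally have A: "x powr (1 - beta p) * (3 powr (- beta p) / 64) \<le> norm (wave p 1 0 (x, a))" .
    have "c / x = (x powr (1 - beta p) * (3 powr (- beta p) / 64)) powr (2 * p)"
    proof -
      \<comment> \<open>Here the value of \<beta> decides: the exponent of x is exactly - 1.\<close>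
      have "(1 - beta p) * (2 * p) = - 1" using p by (simp add: beta_def)
      then have e: "(x powr (1 - beta p)) powr (2 * p) = inverse x"
        using x by (simp add: powr_powr powr_minus)
      have "c / x = inverse x * c" by (simp only: divide_inverse mult.commute)
      also have "\<dots> = (x powr (1 - beta p) * (3 powr (- beta p) / 64)) powr (2 * p)"
        unfolding powr_mult[of "x powr (1 - beta p)"] e c_def ..
      finally show ?thesis .
    qed
    also have "\<dots> \<le> norm (wave p 1 0 (x, a)) powr (2 * p)" using A p by (intro powr_mono2) auto
    also have "\<dots> = norm (wave p 1 0 (x, a) * wave p 1 0 (x, a)) powr p"
      using p by (simp add: norm_mult powr_mult powr_add[symmetric])
    finally show ?thesis unfolding f_def by (rule ennreal_leI)
  qed
  have "ennreal (c / 2 * real n) \<le> (\<integral>\<^sup>+z. f z \<partial>rho)" for n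
  proof -
    \<comment> \<open>The logarithm grows by n between e and 1/3, so the integral of c / (2 x) over
      [e, 1/3] is c n / 2.\<close>
    define e where "e = exp (- real n) / 3"
    have e: "0 < e" "e \<le> 1/3" by (auto simp: e_def)
    have "c / 2 * real n = c / 2 * ln (1/3) - c / 2 * ln e"
      by (simp add: e_def ln_div algebra_simps)
    then have "ennreal (c / 2 * real n) = (\<integral>\<^sup>+x. ennreal (c / 2 / x) * indicator {e..1/3} x \<partial>lborel)"
      using e c0 by (subst nn_integral_FTC_Icc[where F = "\<lambda>x. c / 2 * ln x"]) (auto intro!: derivative_eq_intros)
    also have "\<dots> \<le> (\<integral>\<^sup>+x. \<integral>\<^sup>+a. f (x, a) * ennreal (1 / a) * indicator {0<..} a \<partial>lborel \<partial>lborel)"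
    proof (rule nn_integral_mono)
      fix x :: real
      show "ennreal (c / 2 / x) * indicator {e..1/3} x \<le> (\<integral>\<^sup>+a. f (x, a) * ennreal (1 / a) * indicator {0<..} a \<partial>lborel)"
      proof (cases "x \<in> {e..1/3}")
        case True
        then have x: "0 < x" "x \<le> 1/3" using e by auto
        have "ennreal (c / 2 / x) = ennreal (c / x * (1 / (2 * x))) * emeasure lborel {x..2 * x}"
          using x c0 by (simp add: ennreal_mult[symmetric])
        also have "\<dots> = (\<integral>\<^sup>+a. ennreal (c / x * (1 / (2 * x))) * indicator {x..2 * x} a \<partial>lborel)"
          by (rule nn_integral_cmult_indicator[symmetric]) simp
        also have "\<dots> \<le> (\<integral>\<^sup>+a. f (x, a) * ennreal (1 / a) * indicator {0<..} a \<partial>lborel)"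
        proof (rule nn_integral_mono)
          fix a :: real
          show "ennreal (c / x * (1 / (2 * x))) * indicator {x..2 * x} a \<le> f (x, a) * ennreal (1 / a) * indicator {0<..} a"
          proof (cases "a \<in> {x..2 * x}")
            case True
            then have a: "x \<le> a" "a \<le> 2 * x" "0 < a" using x by auto
            have "ennreal (c / x * (1 / (2 * x))) = ennreal (c / x) * ennreal (1 / (2 * x))"
              using c0 x by (intro ennreal_mult) auto
            also have "\<dots> \<le> f (x, a) * ennreal (1 / a)"
              using a x by (intro mult_mono low ennreal_leI divide_left_mono) auto
            finally show ?thesis using True a by simp
          qed simp
        qed
        finally show ?thesis using True by simp
      qed simp
    qed
    also have "\<dots> = (\<integral>\<^sup>+z. f z \<partial>rho)" by (rule nn_integral_rho[symmetric]) measurable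
    finally show ?thesis .
  qed
  moreover obtain I where I: "(\<integral>\<^sup>+z. f z \<partial>rho) = ennreal I" "0 \<le> I"
    using fin by (cases "\<integral>\<^sup>+z. f z \<partial>rho") auto
  ultimately have "c / 2 * real n \<le> I" for n by (simp add: ennreal_le_iff)
  moreover obtain n where "I / (c / 2) < real n" using reals_Archimedean2 by blast
  then have "I < c / 2 * real n" using c0 by (simp add: field_simps)
  ultimately show False using not_le by blast
qed

theorem theorem3p3:
  fixes p :: real and k :: nat
  assumes "1 < p" and "k \<ge> 1"
  shows "\<not> (\<forall>f \<in> sobolev p (real k). \<forall>g \<in> sobolev p (real k).
              (\<lambda>z. f z * g z) \<in> sobolev p (real k))"
proof
  assume "\<forall>f \<in> sobolev p (real k). \<forall>g \<in> sobolev p (real k). (\<lambda>z. f z * g z) \<in> sobolev p (real k)"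
  then have "(\<lambda>z. wave p 1 0 z * wave p 1 0 z) \<in> sobolev p (real k)"
    using wave_in_sobolev[OF assms] by blast
  then have "(\<lambda>z. wave p 1 0 z * wave p 1 0 z) \<in> Lp rho p"
    by (auto simp: sobolev_def split: if_splits)
  then show False using wave_square_not_in_Lp[OF assms(1)] by contradiction
qed

end
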